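(* Let $(\mathbb{X},\mathcal{B},\mu)$ be a standard probability space without atoms, let $T\in\mathrm{MPT}$, let $d\in\mathbb{N}$, $d\ge 1$, be a fixed delay depth, and let $f\in L^2_\mu$ be an observable such that $(f,f\circ T^{-1},\ldots,f\circ T^{-d+1})$ is linearly independent in $L^2_\mu$. Let $c^T\in\mathbb{C}^d$ be the filter of $T$. Then for every $\varepsilon>0$ there is a predictive $S\in\mathrm{MPT}$ such that the filter $c^S\in\mathbb{C}^d$ of $S$ (for the same observable $f$ and delay depth $d$) is uniquely determined and satisfies $\|c^S-c^T\|<\varepsilon$.
   Context: A standard probability space without atoms is a probability space isomorphic modulo null sets to $[0,1]$ with Lebesgue measure. $\mathrm{MPT}$ is the set of maps $T:\mathbb{X}\to\mathbb{X}$ that are, after removing null sets, invertible with $T,T^{-1}$ measurable and $\mu$-preserving; maps agreeing up to a null set are identified. $L^2_\mu$ is the space of complex-valued square-integrable functions on $\mathbb{X}$. For $R\in\mathrm{MPT}$, the filter of $R$ (for the observable $f$ and delay depth $d$) is the minimizer $c^R=(c_0,\ldots,c_{d-1})\in\mathbb{C}^d$ of $$J_R(c)=\int_{\mathbb{X}}\Big|f(Rx)-\sum_{j=0}^{d-1}c_jf(R^{-j}x)\Big|^2\,d\mu(x).$$ For $S\in\mathrm{MPT}$, an observable $g\in L^2_\mu$ is predictive for $S$ if $\overline{\mathrm{span}\{g,g\circ S^{-1},g\circ S^{-2},\ldots\}}=L^2_\mu$. The map $S$ is called predictive if the set of observables in $L^2_\mu$ that are predictive for $S$ is prevalent and contains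 a dense $G_\delta$ set. Here a $G_\delta$ set is a countable intersection of open sets, and a subset $\mathbb{S}$ of a vector space $\mathbb{V}$ is prevalent if there is a finite-dimensional subspace $\mathbb{E}\subset\mathbb{V}$ such that for every $v\in\mathbb{V}$, Lebesgue-almost every point of $v+\mathbb{E}$ belongs to $\mathbb{S}$. *)

theory Defs
  imports "HOL-Probability.Probability"
begin

section \<open>Isomorphisms modulo null sets\<close>

definition iso_mod_null_map :: "'a measure \<Rightarrow> 'b measure \<Rightarrow> ('a \<Rightarrow> 'b) \<Rightarrow> bool" where
  "iso_mod_null_map M N \<phi> \<longleftrightarrow>
     (\<exists>A \<in> null_sets M. \<exists>B \<in> null_sets N.
        let M' = restrict_space M (space M - A); N' = restrict_space N (space N - B) in
          bij_betw \<phi> (space M - A) (space N - B) \<and>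
          \<phi> \<in> M' \<rightarrow>\<^sub>M N' \<and>
          inv_into (space M - A) \<phi> \<in> N' \<rightarrow>\<^sub>M M' \<and>
          distr M' N' \<phi> = N')"

definition iso_mod_null :: "'a measure \<Rightarrow> 'b measure \<Rightarrow> bool" where
  "iso_mod_null M N \<longleftrightarrow> (\<exists>\<phi>. iso_mod_null_map M N \<phi>)"

text \<open>Lebesgue measure on the unit interval may be taken on the Borel or on the Lebesgue
  measurable sets. Both conventions are in use and both are admitted here, because an isomorphism
  in the strict sense above does not identify the two sigma-algebras.\<close>

definition standard_nonatomic_prob_space :: "'a measure \<Rightarrow> bool" where
  "standard_nonatomic_prob_space M \<longleftrightarrow>
     prob_space M \<and>
     (iso_mod_null M (restrict_space lborel {0..1::real}) \<or>
      iso_mod_null M (lebesgue_on {0..1::real}))"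

text \<open>Elements of MPT are classes of maps modulo null sets. They are represented by
  everywhere defined maps. Measurability on the whole space loses no class (a map can be replaced
  by the identity on the exceptional null set), but without it compositions with observables could
  fail to be measurable and integrals would silently be 0.\<close>

definition MPT :: "'a measure \<Rightarrow> ('a \<Rightarrow> 'a) set" where
  "MPT M = {T \<in> M \<rightarrow>\<^sub>M M. iso_mod_null_map M M T}"

text \<open>The inverse is determined only up to null sets; an arbitrary representative is chosen.
  Existence and uniqueness modulo null sets are proved at the end of this section.\<close>

definition is_mpt_inv :: "'a measure \<Rightarrow> ('a \<Rightarrow> 'a) \<Rightarrow> ('a \<Rightarrow> 'a) \<Rightarrow> bool" where
  "is_mpt_inv M T S \<longleftrightarrow>
     S \<in> MPT M \<and> (AE x in M. S (T x) = x) \<and> (AE x in M. T (S x) = x)"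

definition mpt_inv :: "'a measure \<Rightarrow> ('a \<Rightarrow> 'a) \<Rightarrow> 'a \<Rightarrow> 'a" where
  "mpt_inv M T = (SOME S. is_mpt_inv M T S)"

definition delay :: "'a measure \<Rightarrow> ('a \<Rightarrow> 'a) \<Rightarrow> ('a \<Rightarrow> complex) \<Rightarrow> nat \<Rightarrow> 'a \<Rightarrow> complex" where
  "delay M T f j = f \<circ> (mpt_inv M T ^^ j)"

lemma MPT_E:
  assumes "T \<in> MPT M"
  obtains A B where "A \<in> null_sets M" "B \<in> null_sets M"
    "bij_betw T (space M - A) (space M - B)"
    "T \<in> restrict_space M (space M - A) \<rightarrow>\<^sub>M restrict_space M (space M - B)"
    "inv_into (space M - A) T \<in> restrict_space M (space M - B) \<rightarrow>\<^sub>M restrict_space M (space M - A)"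
    "distr (restrict_space M (space M - A)) (restrict_space M (space M - B)) T
       = restrict_space M (space M - B)"
  using assms unfolding MPT_def iso_mod_null_map_def Let_def by blast

lemma MPT_distr:
  assumes "T \<in> MPT M"
  shows "distr M M T = M"
proof (rule measure_eqI)
  fix X assume "X \<in> sets (distr M M T)"
  then have X: "X \<in> sets M" by simp
  have T: "T \<in> M \<rightarrow>\<^sub>M M" using assms by (simp add: MPT_def)
  obtain A B where A: "A \<in> null_sets M" and B: "B \<in> null_sets M"
    and bij: "bij_betw T (space M - A) (space M - B)"
    and meas: "T \<in> restrict_space M (space M - A) \<rightarrow>\<^sub>M restrict_space M (space M - B)"
    and "inv_into (space M - A) T \<in> restrict_space M (space M - B) \<rightarrow>\<^sub>M restrict_space M (space M - A)"
    and distr: "distr (restrict_space M (space M - A)) (restrict_space M (space M - B)) T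
       = restrict_space M (space M - B)"
    using assms by (rule MPT_E)
  have sA: "space M - A \<in> sets M" and sB: "space M - B \<in> sets M" using A B by auto
  have XB: "X - B \<in> sets (restrict_space M (space M - B))"
    using X B sets.sets_into_space[OF X] by (auto simp: sets_restrict_space_iff sB)
  have pre: "T -` X \<inter> space M \<in> sets M" using T X by (rule measurable_sets)
  have "emeasure M X = emeasure M (X - B)"
    using emeasure_Diff_null_set[OF B X] by simp
  also have "\<dots> = emeasure (restrict_space M (space M - B)) (X - B)"
    using XB sB by (subst emeasure_restrict_space) (auto simp: sets_restrict_space_iff)
  also have "\<dots> = emeasure (distr (restrict_space M (space M - A)) (restrict_space M (space M - B)) T) (X - B)"
    by (simp only: distr)
  also have "\<dots> = emeasure (restrict_space M (space M - A)) (T -` (X - B) \<inter> (space M - A))"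
    using emeasure_distr[OF meas XB] by (simp add: space_restrict_space Int_absorb2)
  also have "\<dots> = emeasure M (T -` (X - B) \<inter> (space M - A))"
    using sA by (intro emeasure_restrict_space) auto
  also have "T -` (X - B) \<inter> (space M - A) = T -` X \<inter> space M - A"
    using bij by (auto simp: bij_betw_def)
  also have "emeasure M \<dots> = emeasure M (T -` X \<inter> space M)"
    using emeasure_Diff_null_set[OF A pre] .
  finally show "emeasure (distr M M T) X = emeasure M X"
    using emeasure_distr[OF T X] by simp
qed simp

lemma MPT_AE:
  assumes "T \<in> MPT M" "AE x in M. P x"
  shows "AE x in M. P (T x)"
proof -
  have T: "T \<in> M \<rightarrow>\<^sub>M M" using assms by (simp add: MPT_def)
  have "AE x in distr M M T. P x" using assms(2) by (simp only: MPT_distr[OF assms(1)])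
  then show ?thesis using AE_distrD[OF T] by blast
qed

lemma is_mpt_inv_exists:
  assumes "T \<in> MPT M"
  shows "\<exists>S. is_mpt_inv M T S"
proof -
  obtain A B where A: "A \<in> null_sets M" and B: "B \<in> null_sets M"
    and bij: "bij_betw T (space M - A) (space M - B)"
    and meas: "T \<in> restrict_space M (space M - A) \<rightarrow>\<^sub>M restrict_space M (space M - B)"
    and imeas: "inv_into (space M - A) T \<in> restrict_space M (space M - B) \<rightarrow>\<^sub>M restrict_space M (space M - A)"
    and distr: "distr (restrict_space M (space M - A)) (restrict_space M (space M - B)) T
       = restrict_space M (space M - B)"
    using assms by (rule MPT_E)
  let ?MA = "restrict_space M (space M - A)" and ?MB = "restrict_space M (space M - B)"
  let ?I = "inv_into (space M - A) T"
  define S where "S = (\<lambda>y. if y \<in> space M - B then ?I y else y)"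
  have sA: "space M - A \<in> sets M" and sB: "space M - B \<in> sets M" using A B by auto
  have spA: "space ?MA = space M - A" and spB: "space ?MB = space M - B"
    by (auto simp: space_restrict_space)
  have S_eq: "S y = ?I y" if "y \<in> space M - B" for y using that by (simp add: S_def)
  have Smeas: "S \<in> M \<rightarrow>\<^sub>M M"
  proof -
    have "{y \<in> space M. y \<in> space M - B} = space M - B" by blast
    then have "{y \<in> space M. y \<in> space M - B} \<in> sets M" using sB by simp
    moreover have "?I \<in> restrict_space M {y. y \<in> space M - B} \<rightarrow>\<^sub>M M"
      using imeas unfolding measurable_restrict_space2_iff Collect_mem_eq by blast
    moreover have "(\<lambda>y. y) \<in> restrict_space M {y. y \<notin> space M - B} \<rightarrow>\<^sub>M M"
      by (rule measurable_restrict_space1) simp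
    ultimately show ?thesis
      unfolding S_def by (intro measurable_If_restrict_space_iff[THEN iffD2] conjI)
  qed
  have ibij: "bij_betw ?I (space M - B) (space M - A)" using bij by (rule bij_betw_inv_into)
  have Sbij: "bij_betw S (space M - B) (space M - A)"
    using ibij by (subst bij_betw_cong[of _ S ?I]) (auto simp: S_eq)
  have Sm': "S \<in> ?MB \<rightarrow>\<^sub>M ?MA"
    using imeas by (subst measurable_cong[of _ S ?I]) (auto simp: S_eq spB)
  have invS: "inv_into (space M - B) S x = T x" if "x \<in> space M - A" for x
  proof -
    have "T x \<in> space M - B" using bij that by (auto simp: bij_betw_def)
    moreover have "S (T x) = x" using bij that calculation
      by (simp add: S_eq bij_betw_def inv_into_f_f del: Diff_iff)
    ultimately show ?thesis using Sbij
      by (metis bij_betw_def inv_into_f_f)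
  qed
  have invSm: "inv_into (space M - B) S \<in> ?MA \<rightarrow>\<^sub>M ?MB"
    using meas by (subst measurable_cong[of _ _ T]) (auto simp: invS spA)
  have "distr ?MB ?MA S = distr (distr ?MA ?MB T) ?MA S" by (simp only: distr)
  also have "\<dots> = distr ?MA ?MA (S \<circ> T)" by (rule distr_distr[OF Sm' meas])
  also have "\<dots> = distr ?MA ?MA (\<lambda>x. x)"
  proof (rule distr_cong)
    fix x assume "x \<in> space ?MA"
    then have x: "x \<in> space M - A" by (simp add: spA)
    then have "T x \<in> space M - B" using bij by (auto simp: bij_betw_def)
    then show "(S \<circ> T) x = x" using bij x by (simp add: S_eq bij_betw_def inv_into_f_f del: Diff_iff)
  qed auto
  also have "\<dots> = ?MA" by simp
  finally have dS: "distr ?MB ?MA S = ?MA" .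
  have "S \<in> MPT M"
    unfolding MPT_def iso_mod_null_map_def Let_def
    using Smeas A B Sbij Sm' invSm dS by blast
  moreover have "AE x in M. S (T x) = x"
  proof (rule AE_I'[OF A], safe)
    fix x assume x: "x \<in> space M" "S (T x) \<noteq> x"
    show "x \<in> A"
    proof (rule ccontr)
      assume "x \<notin> A"
      with x have x': "x \<in> space M - A" by simp
      then have "T x \<in> space M - B" using bij by (auto simp: bij_betw_def)
      then have "S (T x) = x" using bij x' by (simp add: S_eq bij_betw_def inv_into_f_f del: Diff_iff)
      with x show False by simp
    qed
  qed
  moreover have "AE x in M. T (S x) = x"
  proof (rule AE_I'[OF B], safe)
    fix x assume x: "x \<in> space M" "T (S x) \<noteq> x"
    show "x \<in> B"
    proof (rule ccontr)
      assume "x \<notin> B"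
      with x have x': "x \<in> space M - B" by simp
      then have "T (S x) = x" using bij
        by (simp add: S_eq bij_betw_def f_inv_into_f del: Diff_iff)
      with x show False by simp
    qed
  qed
  ultimately show ?thesis unfolding is_mpt_inv_def by blast
qed

lemma is_mpt_inv_mpt_inv:
  "T \<in> MPT M \<Longrightarrow> is_mpt_inv M T (mpt_inv M T)"
  unfolding mpt_inv_def using is_mpt_inv_exists by (rule someI_ex)

lemma is_mpt_inv_unique:
  assumes "is_mpt_inv M T S" "is_mpt_inv M T S'"
  shows "AE x in M. S x = S' x"
proof -
  have "AE x in M. S (T (S' x)) = S' x"
    using assms unfolding is_mpt_inv_def by (blast intro: MPT_AE[of S' M "\<lambda>x. S (T x) = x"])
  moreover have "AE x in M. T (S' x) = x" using assms by (simp add: is_mpt_inv_def)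
  ultimately show ?thesis by eventually_elim simp
qed


section \<open>The space of square-integrable functions\<close>

text \<open>Elements are functions rather than classes modulo null sets. The topology is the one of
  the L2 pseudometric; it is not Hausdorff, and its Kolmogorov quotient is the usual
  L2 space. Open sets and their countable intersections are invariant under changes on
  null sets.\<close>

definition L2_space :: "'a measure \<Rightarrow> ('a \<Rightarrow> complex) set" where
  "L2_space M = {f \<in> borel_measurable M. integrable M (\<lambda>x. (cmod (f x))\<^sup>2)}"

definition L2_norm :: "'a measure \<Rightarrow> ('a \<Rightarrow> complex) \<Rightarrow> real" where
  "L2_norm M f = sqrt (\<integral>x. (cmod (f x))\<^sup>2 \<partial>M)"

definition L2_topology :: "'a measure \<Rightarrow> ('a \<Rightarrow> complex) topology" where
  "L2_topology M = topology (\<lambda>U. U \<subseteq> L2_space M \<and>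
     (\<forall>f\<in>U. \<exists>e>0. \<forall>g\<in>L2_space M. L2_norm M (\<lambda>x. g x - f x) < e \<longrightarrow> g \<in> U))"

lemma openin_L2_topology:
  "openin (L2_topology M) U \<longleftrightarrow> U \<subseteq> L2_space M \<and>
     (\<forall>f\<in>U. \<exists>e>0. \<forall>g\<in>L2_space M. L2_norm M (\<lambda>x. g x - f x) < e \<longrightarrow> g \<in> U)"
proof -
  have "istopology (\<lambda>U. U \<subseteq> L2_space M \<and>
     (\<forall>f\<in>U. \<exists>e>0. \<forall>g\<in>L2_space M. L2_norm M (\<lambda>x. g x - f x) < e \<longrightarrow> g \<in> U))" (is "istopology ?P")
    unfolding istopology_def
  proof (rule conjI; intro allI impI)
    fix S T assume S: "?P S" and T: "?P T"
    show "?P (S \<inter> T)"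
    proof (intro conjI ballI)
      show "S \<inter> T \<subseteq> L2_space M" using S by blast
      fix f assume "f \<in> S \<inter> T"
      then obtain e1 e2 where
        "e1 > 0" "\<forall>g\<in>L2_space M. L2_norm M (\<lambda>x. g x - f x) < e1 \<longrightarrow> g \<in> S"
        "e2 > 0" "\<forall>g\<in>L2_space M. L2_norm M (\<lambda>x. g x - f x) < e2 \<longrightarrow> g \<in> T"
        using S T by blast
      then show "\<exists>e>0. \<forall>g\<in>L2_space M. L2_norm M (\<lambda>x. g x - f x) < e \<longrightarrow> g \<in> S \<inter> T"
        by (intro exI[of _ "min e1 e2"]) auto
    qed
  next
    fix K assume "\<forall>S\<in>K. ?P S"
    then show "?P (\<Union>K)" by (meson Union_iff Union_least)
  qed
  from fun_cong[OF topology_inverse'[OF this], of U] show ?thesis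
    unfolding L2_topology_def .
qed

lemma topspace_L2_topology [simp]: "topspace (L2_topology M) = L2_space M"
proof
  show "topspace (L2_topology M) \<subseteq> L2_space M"
    by (auto simp: topspace_def openin_L2_topology)
  have "openin (L2_topology M) (L2_space M)"
    unfolding openin_L2_topology using zero_less_one by blast
  then show "L2_space M \<subseteq> topspace (L2_topology M)" by (rule openin_subset)
qed

definition lin_indep_mod_null :: "'a measure \<Rightarrow> nat \<Rightarrow> (nat \<Rightarrow> 'a \<Rightarrow> complex) \<Rightarrow> bool" where
  "lin_indep_mod_null M n e \<longleftrightarrow>
     (\<forall>a. (AE x in M. (\<Sum>i<n. a i * e i x) = 0) \<longrightarrow> (\<forall>i<n. a i = 0))"

definition lin_span :: "(nat \<Rightarrow> 'a \<Rightarrow> complex) \<Rightarrow> ('a \<Rightarrow> complex) set" where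
  "lin_span e = {(\<lambda>x. \<Sum>i<n. a i * e i x) | n a. True}"

text \<open>The finite-dimensional subspace is given by a basis
  \<open>e 0, \<dots>, e (m - 1)\<close>; the null sets of its translate through v are those of Lebesgue
  measure on the coordinate space of complex m-tuples.\<close>

definition prevalent :: "'a measure \<Rightarrow> ('a \<Rightarrow> complex) set \<Rightarrow> bool" where
  "prevalent M P \<longleftrightarrow>
     (\<exists>m e. (\<forall>i<m. e i \<in> L2_space M) \<and> lin_indep_mod_null M m e \<and>
        (\<forall>v\<in>L2_space M. AE t in (\<Pi>\<^sub>M i\<in>{..<m}. (lborel :: complex measure)).
           (\<lambda>x. v x + (\<Sum>i<m. t i * e i x)) \<in> P))"


section \<open>Predictive maps and filters\<close>

definition predictive_observable :: "'a measure \<Rightarrow> ('a \<Rightarrow> 'a) \<Rightarrow> ('a \<Rightarrow> complex) \<Rightarrow> bool" where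
  "predictive_observable M S g \<longleftrightarrow>
     g \<in> L2_space M \<and> L2_topology M closure_of lin_span (delay M S g) = L2_space M"

definition predictive :: "'a measure \<Rightarrow> ('a \<Rightarrow> 'a) \<Rightarrow> bool" where
  "predictive M S \<longleftrightarrow>
     prevalent M {g. predictive_observable M S g} \<and>
     (\<exists>G. G \<subseteq> {g. predictive_observable M S g} \<and> gdelta_in (L2_topology M) G \<and>
          L2_topology M closure_of G = L2_space M)"

definition filter_cost ::
    "'a measure \<Rightarrow> ('a \<Rightarrow> complex) \<Rightarrow> nat \<Rightarrow> ('a \<Rightarrow> 'a) \<Rightarrow> (nat \<Rightarrow> complex) \<Rightarrow> real" where
  "filter_cost M f d R c =
     (\<integral>x. (cmod (f (R x) - (\<Sum>j<d. c j * delay M R f j x)))\<^sup>2 \<partial>M)"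

text \<open>Vectors of length d are functions on the indices below d, made unique by
  extensionality.\<close>

definition is_delay_filter ::
    "'a measure \<Rightarrow> ('a \<Rightarrow> complex) \<Rightarrow> nat \<Rightarrow> ('a \<Rightarrow> 'a) \<Rightarrow> (nat \<Rightarrow> complex) \<Rightarrow> bool" where
  "is_delay_filter M f d R c \<longleftrightarrow>
     c \<in> extensional {..<d} \<and>
     (\<forall>c'\<in>extensional {..<d}. filter_cost M f d R c \<le> filter_cost M f d R c')"

definition filter_of ::
    "'a measure \<Rightarrow> ('a \<Rightarrow> complex) \<Rightarrow> nat \<Rightarrow> ('a \<Rightarrow> 'a) \<Rightarrow> nat \<Rightarrow> complex" where
  "filter_of M f d R = (THE c. is_delay_filter M f d R c)"

end

theory Submission
  imports Defs
begin

text \<open>The filter of a map R is the solution of a linear system whose coefficients are the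
  autocorrelations \<open>\<integral> f(R\<^sup>k x) cnj (f x) d\<mu>\<close> for \<open>k = 0, \<dots>, d\<close>, because inner products of delays
  depend only on the difference of the delays. Linear independence of the delays under T makes the
  Gram matrix positive definite, so the solution is unique and depends continuously on these
  \<open>d + 1\<close> numbers near T (\<open>filter_continuous\<close>). It remains to find predictive maps whose
  autocorrelations up to lag d are as close to those of T as desired
  (\<open>predictive_autocorrelations_dense\<close>); S itself need not be close to T.

  Predictivity comes from discrete simple spectrum. If unimodular eigenfunctions of S for distinct
  eigenvalues span a dense subspace, then the averages of the delays of g, rotated by an eigenvalue,
  converge to the projection of g to the eigenfunction. Hence g is predictive as soon as all its
  coefficients are nonzero. Such g form a dense \<open>G\<^sub>\<delta>\<close> set, and a line in the direction of one of
  them witnesses prevalence (locale \<open>discrete_simple_spectrum\<close>). Irrational rotations of the circle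
  are of this kind, since trigonometric polynomials are dense, and so are all maps isomorphic to
  them.

  An isomorphic copy of a rotation that imitates T is found as follows. Identify the space with the
  unit interval. For a large L, write
  \<open>f, f \<circ> T, \<dots>, f \<circ> T\<^sup>L\<^sup>-\<^sup>1\<close> side by side, each compressed by the factor L, as one function H on
  the unit interval (\<open>tower\<close>). The rotation by \<open>1 / L\<close> carries each piece to the next, so the
  autocorrelations of H under this rotation are those of f under T, up to an error of order
  \<open>k / L\<close> caused by the last pieces. By continuity of translations in L2 the same holds for an
  irrational angle close to \<open>1 / L\<close>. Finally, T preserves the measure, so H has the same
  distribution as f. After the values are rounded to a countable grid, equality of distributions
  provides an isomorphism of the space with the unit interval that takes f to H up to the rounding
  error (\<open>equidistributed_iso\<close>, transferred by \<open>standard_space_uniform_variable\<close>). Conjugating the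
  irrational rotation with this isomorphism gives S.\<close>

section \<open>Square-integrable functions\<close>

definition L2_inner :: "'a measure \<Rightarrow> ('a \<Rightarrow> complex) \<Rightarrow> ('a \<Rightarrow> complex) \<Rightarrow> complex" where
  "L2_inner M f g = (\<integral>x. f x * cnj (g x) \<partial>M)"

lemma borel_measurable_cnj [measurable (raw)]:
  "f \<in> borel_measurable M \<Longrightarrow> (\<lambda>x. cnj (f x)) \<in> borel_measurable M"
  by (rule borel_measurable_continuous_on[where f=cnj]) (intro continuous_intros)

lemma L2_space_measurable [measurable_dest]: "f \<in> L2_space M \<Longrightarrow> f \<in> borel_measurable M"
  by (simp add: L2_space_def)

lemma L2_space_integrable: "f \<in> L2_space M \<Longrightarrow> integrable M (\<lambda>x. (cmod (f x))\<^sup>2)"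
  by (simp add: L2_space_def)

lemma L2_norm_nonneg [simp]: "L2_norm M f \<ge> 0"
  by (simp add: L2_norm_def)

lemma L2_norm_power2: "(L2_norm M f)\<^sup>2 = (\<integral>x. (cmod (f x))\<^sup>2 \<partial>M)"
  by (simp add: L2_norm_def)

lemma L2_inner_self: "L2_inner M f f = of_real ((L2_norm M f)\<^sup>2)"
proof -
  have "L2_inner M f f = (\<integral>x. complex_of_real ((cmod (f x))\<^sup>2) \<partial>M)"
    unfolding L2_inner_def complex_norm_square ..
  then show ?thesis unfolding L2_norm_power2 integral_complex_of_real .
qed

lemma L2_norm_cong_AE:
  assumes "AE x in M. f x = g x" "f \<in> borel_measurable M" "g \<in> borel_measurable M"
  shows "L2_norm M f = L2_norm M g"
  unfolding L2_norm_def
  by (intro arg_cong[where f=sqrt] integral_cong_AE) (use assms in \<open>auto elim!: eventually_mono\<close>)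

lemma L2_space_cong_AE:
  assumes "AE x in M. f x = g x" "f \<in> borel_measurable M" "g \<in> L2_space M"
  shows "f \<in> L2_space M"
proof -
  have "integrable M (\<lambda>x. (cmod (f x))\<^sup>2) \<longleftrightarrow> integrable M (\<lambda>x. (cmod (g x))\<^sup>2)"
    by (intro integrable_cong_AE)
      (use assms in \<open>auto simp: L2_space_def elim!: eventually_mono\<close>)
  then show ?thesis using assms by (simp add: L2_space_def)
qed

lemma L2_inner_cong_AE:
  assumes "AE x in M. f x = f' x" "AE x in M. g x = g' x"
    and "f \<in> borel_measurable M" "f' \<in> borel_measurable M"
    and "g \<in> borel_measurable M" "g' \<in> borel_measurable M"
  shows "L2_inner M f g = L2_inner M f' g'"
  unfolding L2_inner_def
proof (rule integral_cong_AE)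
  show "AE x in M. f x * cnj (g x) = f' x * cnj (g' x)"
    using assms(1,2) by eventually_elim simp
qed (use assms(3-6) in measurable)

lemma L2_space_scale: "f \<in> L2_space M \<Longrightarrow> (\<lambda>x. a * f x) \<in> L2_space M"
  by (auto simp: L2_space_def norm_mult power_mult_distrib)

lemma L2_space_zero [simp]: "(\<lambda>x. 0) \<in> L2_space M"
  by (simp add: L2_space_def)

lemma cmod_add_power2_le: "(cmod (a + b))\<^sup>2 \<le> 2 * (cmod a)\<^sup>2 + 2 * (cmod b)\<^sup>2"
proof -
  have "(cmod (a + b))\<^sup>2 \<le> (cmod a + cmod b)\<^sup>2"
    by (intro power_mono norm_triangle_ineq) simp
  also have "\<dots> \<le> 2 * (cmod a)\<^sup>2 + 2 * (cmod b)\<^sup>2"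
    using zero_le_power2[of "cmod a - cmod b"] by (simp add: power2_eq_square algebra_simps)
  finally show ?thesis .
qed

lemma L2_space_add:
  assumes "f \<in> L2_space M" "g \<in> L2_space M"
  shows "(\<lambda>x. f x + g x) \<in> L2_space M"
proof -
  have "integrable M (\<lambda>x. 2 * (cmod (f x))\<^sup>2 + 2 * (cmod (g x))\<^sup>2)"
    using assms by (simp add: L2_space_def)
  then have "integrable M (\<lambda>x. (cmod (f x + g x))\<^sup>2)"
    by (rule Bochner_Integration.integrable_bound)
      (use assms cmod_add_power2_le in \<open>auto simp: L2_space_def\<close>)
  then show ?thesis using assms by (auto simp: L2_space_def)
qed

lemma L2_space_diff:
  assumes "f \<in> L2_space M" "g \<in> L2_space M"
  shows "(\<lambda>x. f x - g x) \<in> L2_space M"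
  using L2_space_add[OF assms(1) L2_space_scale[OF assms(2), of "-1"]] by simp

lemma L2_space_sum:
  assumes "\<And>i. i \<in> I \<Longrightarrow> f i \<in> L2_space M"
  shows "(\<lambda>x. \<Sum>i\<in>I. f i x) \<in> L2_space M"
  using assms by (induction I rule: infinite_finite_induct) (auto intro: L2_space_add)

lemma L2_space_bounded:
  assumes "finite_measure M" "f \<in> borel_measurable M" "\<And>x. cmod (f x) \<le> B"
  shows "f \<in> L2_space M"
proof -
  interpret finite_measure M by fact
  have "integrable M (\<lambda>x. (cmod (f x))\<^sup>2)"
  proof (rule integrable_const_bound)
    show "AE x in M. norm ((cmod (f x))\<^sup>2) \<le> B\<^sup>2" using assms(3) by (simp add: power_mono)
  qed (use assms(2) in measurable)
  then show ?thesis using assms(2) by (simp add: L2_space_def)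
qed

lemma L2_product_integrable:
  assumes "f \<in> L2_space M" "g \<in> L2_space M"
  shows "integrable M (\<lambda>x. cmod (f x) * cmod (g x))"
    and "integrable M (\<lambda>x. f x * cnj (g x))"
proof -
  have "integrable M (\<lambda>x. (cmod (f x))\<^sup>2 + (cmod (g x))\<^sup>2)"
    using assms by (simp add: L2_space_def)
  then show *: "integrable M (\<lambda>x. cmod (f x) * cmod (g x))"
  proof (rule Bochner_Integration.integrable_bound)
    have "a * b \<le> a\<^sup>2 + b\<^sup>2" if "a \<ge> 0" "b \<ge> 0" for a b :: real
      using sum_squares_bound[of a b] mult_nonneg_nonneg[OF that] by linarith
    then show "AE x in M. norm (cmod (f x) * cmod (g x)) \<le> norm ((cmod (f x))\<^sup>2 + (cmod (g x))\<^sup>2)"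
      by simp
  qed (use assms in \<open>auto simp: L2_space_def\<close>)
  show "integrable M (\<lambda>x. f x * cnj (g x))"
    by (rule Bochner_Integration.integrable_bound[OF *])
      (use assms in \<open>auto simp: L2_space_def norm_mult\<close>)
qed

lemma L2_inner_add_left:
  assumes "f \<in> L2_space M" "g \<in> L2_space M" "h \<in> L2_space M"
  shows "L2_inner M (\<lambda>x. f x + g x) h = L2_inner M f h + L2_inner M g h"
  unfolding L2_inner_def
  by (simp add: distrib_right L2_product_integrable[OF assms(1,3)] L2_product_integrable[OF assms(2,3)])

lemma L2_inner_scale_left: "L2_inner M (\<lambda>x. a * f x) g = a * L2_inner M f g"
  unfolding L2_inner_def by (simp add: mult.assoc)

lemma L2_inner_cnj: "cnj (L2_inner M f g) = L2_inner M g f"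
proof -
  have "cnj (L2_inner M f g) = (\<integral>x. cnj (f x * cnj (g x)) \<partial>M)"
    unfolding L2_inner_def by (rule Bochner_Integration.integral_cnj[symmetric])
  then show ?thesis unfolding L2_inner_def by (simp add: mult.commute)
qed

lemma L2_inner_diff_left:
  assumes "f \<in> L2_space M" "g \<in> L2_space M" "h \<in> L2_space M"
  shows "L2_inner M (\<lambda>x. f x - g x) h = L2_inner M f h - L2_inner M g h"
  unfolding L2_inner_def
  by (simp add: left_diff_distrib L2_product_integrable[OF assms(1,3)] L2_product_integrable[OF assms(2,3)])

lemma L2_inner_diff_right:
  assumes "f \<in> L2_space M" "g \<in> L2_space M" "h \<in> L2_space M"
  shows "L2_inner M h (\<lambda>x. f x - g x) = L2_inner M h f - L2_inner M h g"
  using L2_inner_diff_left[OF assms] by (metis L2_inner_cnj complex_cnj_diff)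

lemma L2_inner_sum_left:
  assumes "\<And>i. i \<in> I \<Longrightarrow> f i \<in> L2_space M" "g \<in> L2_space M"
  shows "L2_inner M (\<lambda>x. \<Sum>i\<in>I. a i * f i x) g = (\<Sum>i\<in>I. a i * L2_inner M (f i) g)"
proof -
  have "L2_inner M (\<lambda>x. \<Sum>i\<in>I. a i * f i x) g = (\<integral>x. (\<Sum>i\<in>I. a i * (f i x * cnj (g x))) \<partial>M)"
    unfolding L2_inner_def by (simp add: sum_distrib_right mult.assoc)
  also have "\<dots> = (\<Sum>i\<in>I. a i * L2_inner M (f i) g)"
    unfolding L2_inner_def
    by (subst Bochner_Integration.integral_sum) (auto intro!: L2_product_integrable assms)
  finally show ?thesis .
qed

lemma L2_inner_sum_right:
  assumes "\<And>i. i \<in> I \<Longrightarrow> f i \<in> L2_space M" "g \<in> L2_space M"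
  shows "L2_inner M g (\<lambda>x. \<Sum>i\<in>I. a i * f i x) = (\<Sum>i\<in>I. cnj (a i) * L2_inner M g (f i))"
proof -
  have "L2_inner M g (\<lambda>x. \<Sum>i\<in>I. a i * f i x) = cnj (\<Sum>i\<in>I. a i * L2_inner M (f i) g)"
    using L2_inner_sum_left[of I f M g a] assms by (metis L2_inner_cnj)
  then show ?thesis by (simp add: L2_inner_cnj)
qed

text \<open>Integrate \<open>2 a b \<le> t a\<^sup>2 + b\<^sup>2 / t\<close> and choose t as the quotient of the two norms.\<close>

lemma L2_Cauchy_Schwarz_abs:
  assumes f: "f \<in> L2_space M" and g: "g \<in> L2_space M"
  shows "(\<integral>x. cmod (f x) * cmod (g x) \<partial>M) \<le> L2_norm M f * L2_norm M g"
proof -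
  define I where "I = (\<integral>x. cmod (f x) * cmod (g x) \<partial>M)"
  define A where "A = L2_norm M f"
  define B where "B = L2_norm M g"
  have AB: "A \<ge> 0" "B \<ge> 0" by (simp_all add: A_def B_def)
  have *: "2 * I \<le> t * A\<^sup>2 + B\<^sup>2 / t" if t: "t > 0" for t
  proof -
    have "2 * I = (\<integral>x. 2 * (cmod (f x) * cmod (g x)) \<partial>M)" by (simp add: I_def)
    also have "\<dots> \<le> (\<integral>x. t * (cmod (f x))\<^sup>2 + (cmod (g x))\<^sup>2 / t \<partial>M)"
    proof (rule integral_mono)
      show "integrable M (\<lambda>x. 2 * (cmod (f x) * cmod (g x)))"
        using L2_product_integrable[OF f g] by simp
      show "integrable M (\<lambda>x. t * (cmod (f x))\<^sup>2 + (cmod (g x))\<^sup>2 / t)"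
        using f g by (simp add: L2_space_def)
      fix x
      have "0 \<le> (t * cmod (f x) - cmod (g x))\<^sup>2 / t" using t by simp
      also have "\<dots> = t * (cmod (f x))\<^sup>2 + (cmod (g x))\<^sup>2 / t - 2 * (cmod (f x) * cmod (g x))"
        using t by (simp add: power2_eq_square field_simps)
      finally show "2 * (cmod (f x) * cmod (g x)) \<le> t * (cmod (f x))\<^sup>2 + (cmod (g x))\<^sup>2 / t" by simp
    qed
    also have "\<dots> = t * A\<^sup>2 + B\<^sup>2 / t"
      using f g by (simp add: L2_space_def A_def B_def L2_norm_power2)
    finally show ?thesis .
  qed
  have "I \<le> A * B + e" if e: "e > 0" for e
  proof -
    \<comment> \<open>Both norms are enlarged by s, so that their quotient makes sense even if one of them is 0.\<close>
    define s where "s = e / (A + B + 1)"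
    have s: "s > 0" using e AB by (simp add: s_def)
    have "2 * I \<le> (B + s) / (A + s) * A\<^sup>2 + B\<^sup>2 / ((B + s) / (A + s))"
      using AB s by (intro *) (simp add: add_nonneg_pos)
    also have "(B + s) / (A + s) * A\<^sup>2 \<le> (B + s) * A"
    proof -
      have "(B + s) * A * A \<le> (B + s) * A * (A + s)"
        using AB s by (intro mult_left_mono) auto
      then show ?thesis using AB s by (simp add: power2_eq_square divide_le_eq mult_ac add_nonneg_pos)
    qed
    also have "B\<^sup>2 / ((B + s) / (A + s)) \<le> (A + s) * B"
    proof -
      have "(A + s) * B * B \<le> (A + s) * B * (B + s)"
        using AB s by (intro mult_left_mono) auto
      then show ?thesis using AB s by (simp add: power2_eq_square divide_le_eq mult_ac add_nonneg_pos)
    qed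
    finally have "2 * I \<le> 2 * (A * B) + s * (A + B)" by (simp add: algebra_simps)
    also have "s * (A + B) \<le> e"
      using AB e by (simp add: s_def divide_le_eq add_nonneg_pos)
    finally show ?thesis using e by simp
  qed
  then have "I \<le> A * B" by (rule field_le_epsilon)
  then show ?thesis by (simp add: I_def A_def B_def)
qed

lemma L2_Cauchy_Schwarz:
  assumes "f \<in> L2_space M" "g \<in> L2_space M"
  shows "cmod (L2_inner M f g) \<le> L2_norm M f * L2_norm M g"
proof -
  have "cmod (L2_inner M f g) \<le> (\<integral>x. cmod (f x * cnj (g x)) \<partial>M)"
    unfolding L2_inner_def by (rule integral_norm_bound)
  also have "\<dots> = (\<integral>x. cmod (f x) * cmod (g x) \<partial>M)" by (simp add: norm_mult)
  also have "\<dots> \<le> L2_norm M f * L2_norm M g" by (rule L2_Cauchy_Schwarz_abs[OF assms])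
  finally show ?thesis .
qed

lemma L2_norm_triangle:
  assumes f: "f \<in> L2_space M" and g: "g \<in> L2_space M"
  shows "L2_norm M (\<lambda>x. f x + g x) \<le> L2_norm M f + L2_norm M g"
proof (rule power2_le_imp_le)
  have "(L2_norm M (\<lambda>x. f x + g x))\<^sup>2 = (\<integral>x. (cmod (f x + g x))\<^sup>2 \<partial>M)"
    by (rule L2_norm_power2)
  also have "\<dots> \<le> (\<integral>x. (cmod (f x))\<^sup>2 + 2 * (cmod (f x) * cmod (g x)) + (cmod (g x))\<^sup>2 \<partial>M)"
  proof (rule integral_mono)
    show "integrable M (\<lambda>x. (cmod (f x + g x))\<^sup>2)"
      using L2_space_add[OF f g] by (rule L2_space_integrable)
    show "integrable M (\<lambda>x. (cmod (f x))\<^sup>2 + 2 * (cmod (f x) * cmod (g x)) + (cmod (g x))\<^sup>2)"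
      using f g L2_product_integrable[OF f g] by (simp add: L2_space_def)
    fix x
    have "(cmod (f x + g x))\<^sup>2 \<le> (cmod (f x) + cmod (g x))\<^sup>2"
      by (intro power_mono norm_triangle_ineq) simp
    then show "(cmod (f x + g x))\<^sup>2 \<le> (cmod (f x))\<^sup>2 + 2 * (cmod (f x) * cmod (g x)) + (cmod (g x))\<^sup>2"
      by (simp add: power2_eq_square algebra_simps)
  qed
  also have "\<dots> = (L2_norm M f)\<^sup>2 + 2 * (\<integral>x. cmod (f x) * cmod (g x) \<partial>M) + (L2_norm M g)\<^sup>2"
    using f g L2_product_integrable[OF f g] by (simp add: L2_space_def L2_norm_power2)
  also have "\<dots> \<le> (L2_norm M f + L2_norm M g)\<^sup>2"
    using L2_Cauchy_Schwarz_abs[OF f g] by (simp add: power2_eq_square algebra_simps)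
  finally show "(L2_norm M (\<lambda>x. f x + g x))\<^sup>2 \<le> (L2_norm M f + L2_norm M g)\<^sup>2" .
qed simp

lemma L2_norm_scale: "L2_norm M (\<lambda>x. a * f x) = cmod a * L2_norm M f"
  by (simp add: L2_norm_def norm_mult power_mult_distrib real_sqrt_mult)

lemma L2_norm_zero [simp]: "L2_norm M (\<lambda>x. 0) = 0"
  by (simp add: L2_norm_def)

lemma L2_norm_commute: "L2_norm M (\<lambda>x. f x - g x) = L2_norm M (\<lambda>x. g x - f x)"
  by (simp add: L2_norm_def norm_minus_commute)

lemma L2_norm_triangle_dist:
  assumes "f \<in> L2_space M" "g \<in> L2_space M" "h \<in> L2_space M"
  shows "L2_norm M (\<lambda>x. f x - h x) \<le> L2_norm M (\<lambda>x. f x - g x) + L2_norm M (\<lambda>x. g x - h x)"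
  using L2_norm_triangle[OF L2_space_diff[OF assms(1,2)] L2_space_diff[OF assms(2,3)]] by simp

lemma L2_norm_le_add_dist:
  assumes "f \<in> L2_space M" "g \<in> L2_space M"
  shows "L2_norm M f \<le> L2_norm M g + L2_norm M (\<lambda>x. f x - g x)"
  using L2_norm_triangle[OF assms(2) L2_space_diff[OF assms]] by simp

lemma L2_norm_sum_le:
  assumes "finite I" "\<And>i. i \<in> I \<Longrightarrow> f i \<in> L2_space M"
  shows "L2_norm M (\<lambda>x. \<Sum>i\<in>I. f i x) \<le> (\<Sum>i\<in>I. L2_norm M (f i))"
  using assms
proof (induction I)
  case (insert i I)
  have "L2_norm M (\<lambda>x. f i x + (\<Sum>i\<in>I. f i x)) \<le> L2_norm M (f i) + L2_norm M (\<lambda>x. \<Sum>i\<in>I. f i x)"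
    using insert by (intro L2_norm_triangle L2_space_sum) auto
  then show ?case using insert by auto
qed simp

lemma L2_norm_bounded:
  assumes "prob_space M" "f \<in> borel_measurable M" "AE x in M. cmod (f x) \<le> B" "B \<ge> 0"
  shows "L2_norm M f \<le> B"
proof -
  interpret prob_space M by fact
  have "(\<integral>x. (cmod (f x))\<^sup>2 \<partial>M) \<le> (\<integral>x. B\<^sup>2 \<partial>M)"
  proof (rule integral_mono_AE)
    have b: "AE x in M. norm ((cmod (f x))\<^sup>2) \<le> B\<^sup>2"
      using assms(3) by eventually_elim (simp add: power_mono)
    then show "integrable M (\<lambda>x. (cmod (f x))\<^sup>2)"
      by (rule integrable_const_bound) (use assms(2) in measurable)
    show "AE x in M. (cmod (f x))\<^sup>2 \<le> B\<^sup>2" using b by simp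
  qed simp
  then have "(\<integral>x. (cmod (f x))\<^sup>2 \<partial>M) \<le> B\<^sup>2" by (simp add: prob_space)
  then show ?thesis unfolding L2_norm_def using assms(4) real_le_lsqrt by blast
qed

lemma AE_measure_preserving:
  assumes "S \<in> M \<rightarrow>\<^sub>M K" "distr M K S = N" "AE y in N. P y"
  shows "AE x in M. P (S x)"
proof -
  have "AE y in distr M K S. P y" unfolding assms(2) by (rule assms(3))
  then show ?thesis by (rule AE_distrD[OF assms(1)])
qed

lemma L2_space_compose:
  assumes "S \<in> M \<rightarrow>\<^sub>M N" "distr M N S = N" "f \<in> L2_space N"
  shows "(\<lambda>x. f (S x)) \<in> L2_space M"
proof -
  have "f \<in> borel_measurable N" "integrable (distr M N S) (\<lambda>x. (cmod (f x))\<^sup>2)"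
    using assms(2,3) by (simp_all add: L2_space_def)
  then show ?thesis
    using assms(1) by (auto simp: L2_space_def intro: integrable_distr)
qed

lemma L2_inner_compose:
  assumes "S \<in> M \<rightarrow>\<^sub>M N" "distr M N S = N" "f \<in> borel_measurable N" "g \<in> borel_measurable N"
  shows "L2_inner M (\<lambda>x. f (S x)) (\<lambda>x. g (S x)) = L2_inner N f g"
proof -
  have "L2_inner N f g = (\<integral>x. f x * cnj (g x) \<partial>distr M N S)"
    by (simp add: L2_inner_def assms(2))
  also have "\<dots> = L2_inner M (\<lambda>x. f (S x)) (\<lambda>x. g (S x))"
    unfolding L2_inner_def by (rule integral_distr[OF assms(1)]) (use assms(3,4) in measurable)
  finally show ?thesis ..
qed

lemma L2_norm_compose:
  assumes "S \<in> M \<rightarrow>\<^sub>M N" "distr M N S = N" "f \<in> borel_measurable N"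
  shows "L2_norm M (\<lambda>x. f (S x)) = L2_norm N f"
proof -
  have "complex_of_real ((L2_norm M (\<lambda>x. f (S x)))\<^sup>2) = complex_of_real ((L2_norm N f)\<^sup>2)"
    unfolding L2_inner_self[symmetric] by (rule L2_inner_compose[OF assms assms(3)])
  then have "(L2_norm M (\<lambda>x. f (S x)))\<^sup>2 = (L2_norm N f)\<^sup>2" by (simp only: of_real_eq_iff)
  then show ?thesis by (simp add: power2_eq_iff_nonneg)
qed

section \<open>Constructing invertible measure-preserving maps\<close>

text \<open>A measure-preserving map with an almost everywhere two-sided measurable inverse is an
  isomorphism in the strict sense: remove a null set that contains both exceptional sets, and then
  the points that either map sends into it.\<close>

lemma MPT_I:
  assumes S: "S \<in> M \<rightarrow>\<^sub>M M" and S': "S' \<in> M \<rightarrow>\<^sub>M M" and pres: "distr M M S = M"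
    and inv1: "AE x in M. S' (S x) = x" and inv2: "AE x in M. S (S' x) = x"
  shows "S \<in> MPT M"
proof -
  have pres': "distr M M S' = M"
  proof -
    have "distr M M S' = distr (distr M M S) M S'" by (simp only: pres)
    also have "\<dots> = distr M M (S' \<circ> S)" by (rule distr_distr[OF S' S])
    also have "\<dots> = distr M M (\<lambda>x. x)"
      by (rule distr_cong_AE) (use inv1 S S' in auto)
    finally show ?thesis by simp
  qed
  obtain N where N: "N \<in> null_sets M"
    and sub: "{x\<in>space M. \<not> (S' (S x) = x \<and> S (S' x) = x)} \<subseteq> N"
    using AE_conjI[OF inv1 inv2] unfolding eventually_ae_filter by blast
  have pre_null: "R -` N \<inter> space M \<in> null_sets M" if "R \<in> M \<rightarrow>\<^sub>M M" "distr M M R = M" for R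
  proof -
    have "emeasure M (R -` N \<inter> space M) = emeasure (distr M M R) N"
      using that N by (subst emeasure_distr) auto
    then show ?thesis using that N measurable_sets[OF that(1)] by (auto simp: null_sets_def)
  qed
  \<comment> \<open>S maps the complement of A to the complement of B, and S' maps it back.\<close>
  define A where "A = N \<union> (S -` N \<inter> space M)"
  define B where "B = N \<union> (S' -` N \<inter> space M)"
  have A: "A \<in> null_sets M" unfolding A_def using N pre_null[OF S pres] by (rule null_sets.Un)
  have B: "B \<in> null_sets M" unfolding B_def using N pre_null[OF S' pres'] by (rule null_sets.Un)
  have SA: "S x \<in> space M - B \<and> S' (S x) = x" if "x \<in> space M - A" for x
  proof -
    have "S' (S x) = x" "S x \<in> space M" "S x \<notin> N" "x \<notin> N"
      using that sub measurable_space[OF S] by (auto simp: A_def)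
    then show ?thesis by (simp add: B_def)
  qed
  have SB: "S' y \<in> space M - A \<and> S (S' y) = y" if "y \<in> space M - B" for y
  proof -
    have "S (S' y) = y" "S' y \<in> space M" "S' y \<notin> N" "y \<notin> N"
      using that sub measurable_space[OF S'] by (auto simp: B_def)
    then show ?thesis by (simp add: A_def)
  qed
  have bij: "bij_betw S (space M - A) (space M - B)"
    by (rule bij_betw_byWitness[where f'=S']) (use SA SB in blast)+
  have inv: "inv_into (space M - A) S y = S' y" if "y \<in> space M - B" for y
    using SB[OF that] bij by (metis bij_betw_def inv_into_f_f)
  let ?MA = "restrict_space M (space M - A)" and ?MB = "restrict_space M (space M - B)"
  have sA: "space M - A \<in> sets M" and sB: "space M - B \<in> sets M" using A B by auto
  have spA: "space ?MA = space M - A" and spB: "space ?MB = space M - B"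
    by (auto simp: space_restrict_space)
  have m1: "S \<in> ?MA \<rightarrow>\<^sub>M ?MB"
    using SA S by (intro measurable_restrict_space3) auto
  have m2: "S' \<in> ?MB \<rightarrow>\<^sub>M ?MA"
    using SB S' by (intro measurable_restrict_space3) auto
  have m2': "inv_into (space M - A) S \<in> ?MB \<rightarrow>\<^sub>M ?MA"
    using m2 by (subst measurable_cong[of _ _ S']) (auto simp: inv spB)
  have "distr ?MA ?MB S = ?MB"
  proof (rule measure_eqI)
    fix X assume "X \<in> sets (distr ?MA ?MB S)"
    then have X: "X \<in> sets ?MB" by simp
    then have X': "X \<in> sets M" "X \<subseteq> space M - B"
      using sB by (auto simp: sets_restrict_space_iff)
    have "emeasure (distr ?MA ?MB S) X = emeasure ?MA (S -` X \<inter> (space M - A))"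
      using emeasure_distr[OF m1 X] by (simp add: spA)
    also have "\<dots> = emeasure M (S -` X \<inter> (space M - A))"
      using sA by (intro emeasure_restrict_space) auto
    also have "S -` X \<inter> (space M - A) = S -` X \<inter> space M - A" by auto
    also have "emeasure M \<dots> = emeasure M (S -` X \<inter> space M)"
      using emeasure_Diff_null_set[OF A measurable_sets[OF S X'(1)]] .
    also have "\<dots> = emeasure (distr M M S) X" using S X' by (simp add: emeasure_distr)
    also have "\<dots> = emeasure ?MB X"
      using X' sB by (simp add: pres emeasure_restrict_space)
    finally show "emeasure (distr ?MA ?MB S) X = emeasure ?MB X" .
  qed simp
  then show ?thesis
    unfolding MPT_def iso_mod_null_map_def Let_def using S A B bij m1 m2' by blast
qed

section \<open>The unit interval as a model\<close>

text \<open>As a measure on the whole line, so that maps between copies of the interval are plain Borel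
  functions of a real variable.\<close>

definition unif :: "real measure" where
  "unif = uniform_measure lborel {0<..<1}"

lemma sets_unif [simp, measurable_cong]: "sets unif = sets borel"
  and space_unif [simp]: "space unif = UNIV"
  by (simp_all add: unif_def)

lemma prob_space_unif: "prob_space unif"
  unfolding unif_def by (rule prob_space_uniform_measure) auto

interpretation unif: prob_space unif by (rule prob_space_unif)

lemma emeasure_unif: "A \<in> sets borel \<Longrightarrow> emeasure unif A = emeasure lborel (A \<inter> {0<..<1})"
  by (simp add: unif_def Int_commute divide_ennreal_def)

lemma AE_unif_iff: "(AE x in unif. P x) \<longleftrightarrow> (AE x in lborel. 0 < x \<and> x < 1 \<longrightarrow> P x)"
  unfolding unif_def by (subst AE_uniform_measure) auto

lemma AE_unif_bounds: "AE x in unif. 0 < x \<and> x < 1"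
  by (simp add: AE_unif_iff)

lemma unif_eq_distr: "unif = distr (restrict_space lborel {0<..<1}) borel (\<lambda>x. x)"
proof (rule measure_eqI)
  fix A assume "A \<in> sets unif"
  then have A: "A \<in> sets borel" by simp
  have "emeasure (distr (restrict_space lborel {0<..<1}) borel (\<lambda>x. x)) A
      = emeasure (restrict_space lborel {0<..<1}) (A \<inter> {0<..<1})"
    using A by (subst emeasure_distr) (auto intro!: measurable_restrict_space1)
  also have "\<dots> = emeasure lborel (A \<inter> {0<..<1})"
    using A by (intro emeasure_restrict_space) auto
  finally show "emeasure unif A = emeasure (distr (restrict_space lborel {0<..<1}) borel (\<lambda>x. x)) A"
    using A by (simp add: emeasure_unif)
qed simp

lemma borel_measurable_frac [measurable (raw)]:
  fixes f :: "'a \<Rightarrow> real"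
  shows "f \<in> borel_measurable M \<Longrightarrow> (\<lambda>x. frac (f x)) \<in> borel_measurable M"
  unfolding frac_def
  by (intro borel_measurable_diff measurable_compose[OF _ borel_measurable_real_floor])

text \<open>The interval is rearranged so that q becomes nondecreasing. The number \<open>Z x = q x + x\<close>
  determines both x and \<open>q x\<close>, and its distribution has no atoms. For an atomless distribution on
  the line the distribution function F and the generalized inverse G of F are inverse to each other
  up to null sets, so \<open>F \<circ> Z\<close> is an isomorphism. The last conclusion says that the value of q at
  position u of the rearranged interval is a function of the distribution of q alone.\<close>

lemma sorting_iso:
  fixes q :: "real \<Rightarrow> nat"
  assumes q [measurable]: "q \<in> borel \<rightarrow>\<^sub>M count_space UNIV"
  obtains \<Theta> \<Psi> where "\<Theta> \<in> borel_measurable borel" "\<Psi> \<in> borel_measurable borel"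
    "distr unif borel \<Theta> = unif" "AE x in unif. \<Psi> (\<Theta> x) = x" "AE u in unif. \<Theta> (\<Psi> u) = u"
    "AE u in unif. \<forall>i. q (\<Psi> u) < i \<longleftrightarrow> u \<le> measure unif {x. q x < i}"
proof -
  define Z where "Z = (\<lambda>x. real (q x) + x)"
  have Z [measurable]: "Z \<in> borel_measurable borel" unfolding Z_def by measurable
  define \<nu> where "\<nu> = distr unif borel Z"
  interpret \<nu>: real_distribution \<nu>
    unfolding \<nu>_def by (rule unif.real_distribution_distr) measurable
  interpret \<nu>: cdf_distribution \<nu> by unfold_locales
  define F where "F = cdf \<nu>"
  define G where "G = (\<lambda>u. if 0 < u \<and> u < 1 then Inf {x. u \<le> F x} else 0)"
  have F [measurable]: "F \<in> borel_measurable borel" unfolding F_def by measurable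
  have GF: "u \<le> F x \<longleftrightarrow> G u \<le> x" if "0 < u" "u < 1" for u x
    using \<nu>.pseudoinverse[of u x] that by (simp add: F_def G_def)
  have "\<nu>.I \<in> borel_measurable (restrict_space borel {0<..<1})" by (rule \<nu>.measurable_CI)
  moreover have "{u. 0 < u \<and> u < 1} = {0<..<1::real}" by auto
  ultimately have "(\<lambda>u. if u \<in> {0<..<1} then Inf {x. u \<le> F x} else 0) \<in> borel_measurable borel"
    unfolding F_def by (intro measurable_If_restrict_space_iff[THEN iffD2] conjI) auto
  then have G [measurable]: "G \<in> borel_measurable borel" by (simp add: G_def)
  have distrG: "distr unif borel G = \<nu>"
  proof -
    have "distr unif borel G = distr (restrict_space lborel {0<..<1}) borel (G \<circ> (\<lambda>x. x))"
      unfolding unif_eq_distr by (intro distr_distr G) (simp add: measurable_restrict_space1)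
    also have "\<dots> = distr (restrict_space lborel {0<..<1}) borel \<nu>.I"
      by (intro distr_cong) (auto simp: G_def F_def space_restrict_space)
    also have "\<dots> = \<nu>" by (rule \<nu>.distr_I_eq_M)
    finally show ?thesis .
  qed
  \<comment> \<open>A level set of Z has at most one point for each value of q.\<close>
  have atomless: "measure \<nu> {z} = 0" for z
  proof -
    have "countable {x. Z x = z}"
    proof (rule countable_subset)
      show "{x. Z x = z} \<subseteq> range (\<lambda>n::nat. z - real n)"
        unfolding Z_def by (auto intro!: image_eqI)
    qed simp
    then have null: "{x. Z x = z} \<in> null_sets lborel" by (rule countable_imp_null_set_lborel)
    have "{x. Z x = z} \<inter> {0<..<1} \<in> null_sets lborel"
      using null by (rule null_set_Int2) auto
    then have null': "emeasure lborel ({x. Z x = z} \<inter> {0<..<1}) = 0" by auto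
    have "emeasure \<nu> {z} = emeasure unif {x. Z x = z}"
      unfolding \<nu>_def by (subst emeasure_distr) (auto intro!: arg_cong2[where f=emeasure])
    also have "\<dots> = 0"
      using null by (subst emeasure_unif) (auto simp: null_sets_def null')
    finally show ?thesis by (simp add: measure_def)
  qed
  have Fcont: "isCont F z" for z
    unfolding F_def by (simp add: \<nu>.isCont_cdf atomless)
  have FG: "F (G u) = u" if u: "0 < u" "u < 1" for u
  proof (rule antisym)
    show "u \<le> F (G u)" using GF[OF u] by simp
    have "F z \<le> u" if "z < G u" for z
      using GF[OF u, of z] that by simp
    then have "eventually (\<lambda>z. F z \<le> u) (at_left (G u))"
      by (auto simp: eventually_at_filter intro!: always_eventually)
    moreover have "(F \<longlongrightarrow> F (G u)) (at_left (G u))"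
      using Fcont[of "G u"] by (simp add: continuous_within isCont_def filterlim_at_split)
    ultimately show "F (G u) \<le> u"
      by (intro tendsto_upperbound) auto
  qed
  have AE_\<nu>_Z: "(AE z in \<nu>. P z) \<longleftrightarrow> (AE x in unif. P (Z x))"
    if "{z. P z} \<in> sets borel" for P
    unfolding \<nu>_def using that by (intro AE_distr_iff) auto
  have AE_\<nu>_G: "(AE z in \<nu>. P z) \<longleftrightarrow> (AE u in unif. P (G u))"
    if "{z. P z} \<in> sets borel" for P
    unfolding distrG[symmetric] using that by (intro AE_distr_iff) auto
  have frac_Z: "frac (Z x) = x" if "0 < x" "x < 1" for x
    unfolding Z_def using that by (simp add: frac_unique_iff)
  have s1: "{z. G (F z) = z} \<in> sets borel" by measurable
  have frac_m: "(\<lambda>x::real. frac x) \<in> borel_measurable borel"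
    by measurable
  have qf [measurable]: "(\<lambda>z. real (q (frac z))) \<in> borel_measurable borel"
    by (rule measurable_compose[OF measurable_compose[OF frac_m q]]) simp
  have [measurable]: "(\<lambda>z. Z (frac z)) \<in> borel_measurable borel"
    by (rule measurable_compose[OF frac_m Z])
  have s2: "{z. Z (frac z) = z \<and> real (q (frac z)) < z \<and> z \<le> real (q (frac z)) + 1} \<in> sets borel" by measurable
  have "AE z in \<nu>. G (F z) = z"
    unfolding AE_\<nu>_G[OF s1] using AE_unif_bounds by eventually_elim (simp add: FG)
  then have GFZ: "AE x in unif. G (F (Z x)) = Z x"
    unfolding AE_\<nu>_Z[OF s1] .
  have "AE z in \<nu>. Z (frac z) = z \<and> real (q (frac z)) < z \<and> z \<le> real (q (frac z)) + 1"
    unfolding AE_\<nu>_Z[OF s2] using AE_unif_bounds by eventually_elim (simp add: frac_Z, simp add: Z_def)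
  then have ZG: "AE u in unif. Z (frac (G u)) = G u \<and> real (q (frac (G u))) < G u \<and> G u \<le> real (q (frac (G u))) + 1"
    unfolding AE_\<nu>_G[OF s2] .
  define \<Theta> where "\<Theta> = (\<lambda>x. F (Z x))"
  define \<Psi> where "\<Psi> = (\<lambda>u. frac (G u))"
  have m: "\<Theta> \<in> borel_measurable borel" "\<Psi> \<in> borel_measurable borel"
    unfolding \<Theta>_def \<Psi>_def by measurable
  have "distr unif borel \<Theta> = distr \<nu> borel F"
    unfolding \<Theta>_def \<nu>_def by (subst distr_distr) (auto simp: o_def)
  also have "\<dots> = distr unif borel (\<lambda>u. F (G u))"
    unfolding distrG[symmetric] by (subst distr_distr) (auto simp: o_def)
  also have "\<dots> = distr unif unif (\<lambda>u. u)"
  proof (rule distr_cong_AE)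
    show "AE u in unif. F (G u) = u"
      using AE_unif_bounds by eventually_elim (simp add: FG)
  qed auto
  finally have pres: "distr unif borel \<Theta> = unif" by simp
  have inv1: "AE x in unif. \<Psi> (\<Theta> x) = x"
    using GFZ AE_unif_bounds by eventually_elim (simp add: \<Psi>_def \<Theta>_def frac_Z)
  have inv2: "AE u in unif. \<Theta> (\<Psi> u) = u"
    using ZG AE_unif_bounds by eventually_elim (simp add: \<Psi>_def \<Theta>_def FG)
  have Fi: "F (real i) = measure unif {x. q x < i}" for i :: nat
  proof -
    have "F (real i) = measure unif {x. Z x \<le> real i}"
      unfolding F_def cdf_def \<nu>_def
      by (subst measure_distr) (auto intro!: arg_cong2[where f=measure])
    also have "\<dots> = measure unif {x. q x < i}"
    proof (rule unif.finite_measure_eq_AE)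
      show "AE x in unif. (x \<in> {x. Z x \<le> real i}) = (x \<in> {x. q x < i})"
        using AE_unif_bounds
      proof eventually_elim
        case (elim x)
        then show ?case by (auto simp: Z_def)
      qed
    qed measurable
    finally show ?thesis .
  qed
  have "AE u in unif. \<forall>i. q (\<Psi> u) < i \<longleftrightarrow> u \<le> measure unif {x. q x < i}"
    using ZG AE_unif_bounds
  proof eventually_elim
    case (elim u)
    show ?case
    proof
      fix i
      have "u \<le> measure unif {x. q x < i} \<longleftrightarrow> G u \<le> real i"
        using GF[of u "real i"] elim by (simp add: Fi)
      then show "q (\<Psi> u) < i \<longleftrightarrow> u \<le> measure unif {x. q x < i}"
        using elim by (auto simp: \<Psi>_def)
    qed
  qed
  then show ?thesis using that m pres inv1 inv2 by blast
qed

lemma AE_unif_compose: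
  assumes "AE x in unif. P x" "C \<in> borel_measurable borel" "distr unif borel C = unif"
  shows "AE x in unif. P (C x)"
  by (rule AE_measure_preserving[OF _ assms(3,1)]) (use assms(2) in simp)

text \<open>Sort q, then undo the sorting of r. Both sorted functions agree, because they are determined
  by the distribution.\<close>

lemma equidistributed_iso:
  fixes q r :: "real \<Rightarrow> nat"
  assumes q: "q \<in> borel \<rightarrow>\<^sub>M count_space UNIV" and r: "r \<in> borel \<rightarrow>\<^sub>M count_space UNIV"
    and eq: "\<And>i. measure unif {x. q x < i} = measure unif {x. r x < i}"
  obtains \<phi> \<phi>' where "\<phi> \<in> borel_measurable borel" "\<phi>' \<in> borel_measurable borel"
    "distr unif borel \<phi> = unif" "distr unif borel \<phi>' = unif"
    "AE x in unif. \<phi>' (\<phi> x) = x" "AE x in unif. \<phi> (\<phi>' x) = x"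
    "AE x in unif. r (\<phi> x) = q x"
proof -
  obtain A A' where A: "A \<in> borel_measurable borel" "A' \<in> borel_measurable borel"
    "distr unif borel A = unif" "AE x in unif. A' (A x) = x" "AE u in unif. A (A' u) = u"
    "AE u in unif. \<forall>i. q (A' u) < i \<longleftrightarrow> u \<le> measure unif {x. q x < i}"
    by (rule sorting_iso[OF q]) blast
  obtain B B' where B: "B \<in> borel_measurable borel" "B' \<in> borel_measurable borel"
    "distr unif borel B = unif" "AE x in unif. B' (B x) = x" "AE u in unif. B (B' u) = u"
    "AE u in unif. \<forall>i. r (B' u) < i \<longleftrightarrow> u \<le> measure unif {x. r x < i}"
    by (rule sorting_iso[OF r]) blast
  note [measurable] = A(1,2) B(1,2)
  have pres: "distr unif borel C' = unif"
    if "C \<in> borel_measurable borel" "C' \<in> borel_measurable borel"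
      "distr unif borel C = unif" "AE x in unif. C' (C x) = x" for C C'
  proof -
    note [measurable] = that(1,2)
    have "distr unif borel C' = distr (distr unif borel C) borel C'" by (simp only: that)
    also have "\<dots> = distr unif borel (C' \<circ> C)" by (intro distr_distr) measurable
    also have "\<dots> = distr unif unif (\<lambda>x. x)"
      using that(4) by (intro distr_cong_AE) auto
    finally show ?thesis by simp
  qed
  have A': "distr unif borel A' = unif" and B': "distr unif borel B' = unif"
    using pres[OF A(1-4)] pres[OF B(1-4)] .
  have comp: "distr unif borel (C \<circ> D) = unif"
    if "C \<in> borel_measurable borel" "D \<in> borel_measurable borel"
      "distr unif borel C = unif" "distr unif borel D = unif" for C D
  proof -
    have "distr unif borel (C \<circ> D) = distr (distr unif borel D) borel C"
      using that(1,2) by (intro distr_distr[symmetric]) auto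
    then show ?thesis by (simp only: that)
  qed
  show ?thesis
  proof (rule that[of "B' \<circ> A" "A' \<circ> B"])
    show "AE x in unif. (A' \<circ> B) ((B' \<circ> A) x) = x"
      using AE_unif_compose[OF B(5) A(1,3)] A(4) by eventually_elim simp
    show "AE x in unif. (B' \<circ> A) ((A' \<circ> B) x) = x"
      using AE_unif_compose[OF A(5) B(1,3)] B(4) by eventually_elim simp
    show "AE x in unif. r ((B' \<circ> A) x) = q x"
      using AE_unif_compose[OF B(6) A(1,3)] AE_unif_compose[OF A(6) A(1,3)] A(4)
    proof eventually_elim
      case (elim x)
      have "r (B' (A x)) < i \<longleftrightarrow> q x < i" for i using elim eq by simp
      then show ?case by (metis comp_apply nat_neq_iff)
    qed
  qed (use comp A B A' B' in auto)
qed

section \<open>Reduction to the unit interval\<close>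

text \<open>An isomorphism modulo null sets is extended by constants over the exceptional sets, which
  gives everywhere defined measurable maps that can be composed freely.\<close>

lemma iso_mod_null_pair:
  assumes iso: "iso_mod_null M N" and ne: "space M \<noteq> {}" "space N \<noteq> {}"
  obtains \<pi> \<rho> where "\<pi> \<in> M \<rightarrow>\<^sub>M N" "\<rho> \<in> N \<rightarrow>\<^sub>M M" "distr M N \<pi> = N" "distr N M \<rho> = M"
    "AE x in M. \<rho> (\<pi> x) = x" "AE y in N. \<pi> (\<rho> y) = y"
proof -
  obtain \<psi> A B where A: "A \<in> null_sets M" and B: "B \<in> null_sets N"
    and bij: "bij_betw \<psi> (space M - A) (space N - B)"
    and meas: "\<psi> \<in> restrict_space M (space M - A) \<rightarrow>\<^sub>M restrict_space N (space N - B)"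
    and imeas: "inv_into (space M - A) \<psi>
      \<in> restrict_space N (space N - B) \<rightarrow>\<^sub>M restrict_space M (space M - A)"
    and distr: "distr (restrict_space M (space M - A)) (restrict_space N (space N - B)) \<psi>
      = restrict_space N (space N - B)"
    using iso unfolding iso_mod_null_def iso_mod_null_map_def Let_def by blast
  obtain x0 y0 where x0: "x0 \<in> space M" and y0: "y0 \<in> space N" using ne by blast
  define \<pi> where "\<pi> = (\<lambda>x. if x \<in> space M - A then \<psi> x else y0)"
  define \<rho> where "\<rho> = (\<lambda>y. if y \<in> space N - B then inv_into (space M - A) \<psi> y else x0)"
  have sA: "space M - A \<in> sets M" and sB: "space N - B \<in> sets N" using A B by auto
  have ext: "(\<lambda>x. if x \<in> E then k x else c) \<in> P \<rightarrow>\<^sub>M Q"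
    if "E \<in> sets P" "k \<in> restrict_space P E \<rightarrow>\<^sub>M restrict_space Q E'" "c \<in> space Q"
    for E E' P Q and k :: "'x \<Rightarrow> 'y" and c
  proof -
    have "{x \<in> space P. x \<in> E} = E" using sets.sets_into_space[OF that(1)] by blast
    then have E: "{x \<in> space P. x \<in> E} \<in> sets P" using that(1) by simp
    have "k \<in> restrict_space P E \<rightarrow>\<^sub>M Q"
      using that(2) unfolding measurable_restrict_space2_iff by blast
    then show ?thesis using that(3)
      by (subst measurable_If_restrict_space_iff[OF E]) auto
  qed
  have \<pi>: "\<pi> \<in> M \<rightarrow>\<^sub>M N" unfolding \<pi>_def by (rule ext[OF sA meas y0])
  have \<rho>: "\<rho> \<in> N \<rightarrow>\<^sub>M M" unfolding \<rho>_def by (rule ext[OF sB imeas x0])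
  have \<pi>_in: "\<pi> x \<in> space N - B" and \<rho>\<pi>: "\<rho> (\<pi> x) = x" if "x \<in> space M - A" for x
  proof -
    show "\<pi> x \<in> space N - B" using that bij by (simp add: \<pi>_def bij_betw_def del: Diff_iff) blast
    then show "\<rho> (\<pi> x) = x" using that bij
      by (simp add: \<pi>_def \<rho>_def bij_betw_def inv_into_f_f del: Diff_iff)
  qed
  have \<pi>\<rho>: "\<pi> (\<rho> y) = y" if "y \<in> space N - B" for y
  proof -
    have "\<rho> y \<in> space M - A" using that bij inv_into_into[of y \<psi> "space M - A"]
      by (simp add: \<rho>_def bij_betw_def del: Diff_iff)
    then show ?thesis using that bij f_inv_into_f[of y \<psi> "space M - A"]
      by (simp add: \<pi>_def \<rho>_def bij_betw_def del: Diff_iff)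
  qed
  have AE1: "AE x in M. \<rho> (\<pi> x) = x"
    using AE_not_in[OF A] AE_space by eventually_elim (rule \<rho>\<pi>, simp)
  have AE2: "AE y in N. \<pi> (\<rho> y) = y"
    using AE_not_in[OF B] AE_space by eventually_elim (rule \<pi>\<rho>, simp)
  have pres: "distr M N \<pi> = N"
  proof (rule measure_eqI)
    fix X assume "X \<in> sets (distr M N \<pi>)"
    then have X: "X \<in> sets N" by simp
    let ?MA = "restrict_space M (space M - A)" and ?NB = "restrict_space N (space N - B)"
    have XB: "X - B \<in> sets ?NB"
      using X B sets.sets_into_space[OF X] by (auto simp: sets_restrict_space_iff sB)
    have pre: "\<pi> -` X \<inter> space M \<in> sets M" using \<pi> X by (rule measurable_sets)
    have "emeasure N X = emeasure N (X - B)"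
      using emeasure_Diff_null_set[OF B X] by simp
    also have "\<dots> = emeasure ?NB (X - B)"
      using XB sB by (subst emeasure_restrict_space) (auto simp: sets_restrict_space_iff)
    also have "\<dots> = emeasure (distr ?MA ?NB \<psi>) (X - B)" by (simp only: distr)
    also have "\<dots> = emeasure ?MA (\<psi> -` (X - B) \<inter> (space M - A))"
      using emeasure_distr[OF meas XB] by (simp add: space_restrict_space Int_absorb2)
    also have "\<dots> = emeasure M (\<psi> -` (X - B) \<inter> (space M - A))"
      using sA by (intro emeasure_restrict_space) auto
    also have "\<psi> -` (X - B) \<inter> (space M - A) = \<pi> -` X \<inter> space M - A"
      using \<pi>_in by (auto simp: \<pi>_def)
    also have "emeasure M \<dots> = emeasure M (\<pi> -` X \<inter> space M)"
      using emeasure_Diff_null_set[OF A pre] .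
    finally show "emeasure (distr M N \<pi>) X = emeasure N X"
      using emeasure_distr[OF \<pi> X] by simp
  qed simp
  have "distr N M \<rho> = distr (distr M N \<pi>) M \<rho>" by (simp only: pres)
  also have "\<dots> = distr M M (\<rho> \<circ> \<pi>)" by (rule distr_distr[OF \<rho> \<pi>])
  also have "\<dots> = distr M M (\<lambda>x. x)"
    by (rule distr_cong_AE) (use AE1 \<pi> \<rho> in auto)
  finally have "distr N M \<rho> = M" by simp
  then show ?thesis using that \<pi> \<rho> pres AE1 AE2 by blast
qed

text \<open>This lets Borel and Lebesgue measurable sets be treated alike: facts about the completion
  follow from the general theory of completions.\<close>

lemma lebesgue_on_eq_completion:
  assumes I [measurable]: "I \<in> sets borel"
  shows "lebesgue_on I = completion (restrict_space lborel I)"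
proof (rule measure_eqI)
  have null: "N \<in> null_sets (restrict_space lborel I) \<longleftrightarrow> N \<subseteq> I \<and> N \<in> null_sets lborel" for N
    by (rule null_sets_restrict_space) simp
  have meas: "S \<in> sets (restrict_space lborel I) \<longleftrightarrow> S \<subseteq> I \<and> S \<in> sets lborel" for S
    by (subst sets_restrict_space_iff) auto
  have leb: "A \<in> sets (lebesgue_on I) \<longleftrightarrow> A \<subseteq> I \<and> A \<in> sets lebesgue" for A
    by (subst sets_restrict_space_iff) auto
  have split: "\<exists>S N N'. A = S \<union> N \<and> S \<subseteq> I \<and> S \<in> sets lborel \<and> N \<subseteq> N' \<and> N' \<subseteq> I \<and> N' \<in> null_sets lborel"
    if A: "A \<subseteq> I" "A \<in> sets lebesgue" for A
  proof -
    obtain S N N' where *: "A = S \<union> N" "N \<subseteq> N'" "N' \<in> null_sets lborel" "S \<in> sets lborel"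
      using sets_completionE[OF A(2)] .
    moreover have "N' \<inter> I \<in> null_sets lborel" using *(3) by (rule null_set_Int2) simp
    ultimately show ?thesis using A(1) by (intro exI[of _ S] exI[of _ N] exI[of _ "N' \<inter> I"]) auto
  qed
  show "sets (lebesgue_on I) = sets (completion (restrict_space lborel I))"
  proof (intro equalityI subsetI)
    fix A assume "A \<in> sets (lebesgue_on I)"
    then obtain S N N' where *: "A = S \<union> N" "S \<subseteq> I" "S \<in> sets lborel" "N \<subseteq> N'" "N' \<subseteq> I" "N' \<in> null_sets lborel"
      using split[of A] leb by blast
    show "A \<in> sets (completion (restrict_space lborel I))"
      by (rule sets_completionI[of _ S N N']) (use * in \<open>auto simp: null meas\<close>)
  next
    fix A assume "A \<in> sets (completion (restrict_space lborel I))"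
    then obtain S N N' where *: "A = S \<union> N" "N \<subseteq> N'" "N' \<in> null_sets (restrict_space lborel I)"
      "S \<in> sets (restrict_space lborel I)"
      by (rule sets_completionE)
    then have "A \<in> sets lebesgue" by (intro sets_completionI[of _ S N N']) (auto simp: null meas)
    then show "A \<in> sets (lebesgue_on I)" using * by (auto simp: leb null meas)
  qed
  fix A assume "A \<in> sets (lebesgue_on I)"
  then obtain S N N' where *: "A = S \<union> N" "S \<subseteq> I" "S \<in> sets lborel" "N \<subseteq> N'" "N' \<subseteq> I" "N' \<in> null_sets lborel"
    using split[of A] leb by blast
  have N: "N \<in> null_sets lebesgue" "N \<in> null_sets (completion (restrict_space lborel I))"
    using * by (auto simp: null_sets_completion_iff2 null)
  have "emeasure (lebesgue_on I) A = emeasure lebesgue A"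
    using * by (intro emeasure_restrict_space) (auto)
  also have "\<dots> = emeasure lebesgue S"
    unfolding *(1) using * N by (intro emeasure_Un_null_set) auto
  also have "\<dots> = emeasure lborel S" using * by simp
  also have "\<dots> = emeasure (restrict_space lborel I) S"
    using * by (intro emeasure_restrict_space[symmetric]) auto
  also have "\<dots> = emeasure (completion (restrict_space lborel I)) S"
    using * by (simp add: meas)
  also have "\<dots> = emeasure (completion (restrict_space lborel I)) A"
    unfolding *(1) using * N by (intro emeasure_Un_null_set[symmetric]) (auto simp: meas)
  finally show "emeasure (lebesgue_on I) A = emeasure (completion (restrict_space lborel I)) A" .
qed

lemma distr_unit_interval: "distr (restrict_space lborel {0..1}) borel (\<lambda>x. x) = unif"
proof (rule measure_eqI)
  fix A assume "A \<in> sets (distr (restrict_space lborel {0..1::real}) borel (\<lambda>x. x))"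
  then have A: "A \<in> sets borel" by simp
  have "emeasure (distr (restrict_space lborel {0..1}) borel (\<lambda>x. x)) A
      = emeasure (restrict_space lborel {0..1}) (A \<inter> {0..1})"
    using A by (subst emeasure_distr) (auto intro!: measurable_restrict_space1)
  also have "\<dots> = emeasure lborel (A \<inter> {0..1})"
    using A by (intro emeasure_restrict_space) auto
  also have "\<dots> = emeasure lborel (A \<inter> {0<..<1})"
  proof (rule emeasure_eq_AE)
    show "AE x in lborel. (x \<in> A \<inter> {0..1}) = (x \<in> A \<inter> {0<..<1})"
      using AE_lborel_singleton[of 0] AE_lborel_singleton[of 1] by eventually_elim auto
  qed (use A in auto)
  finally show "emeasure (distr (restrict_space lborel {0..1}) borel (\<lambda>x. x)) A = emeasure unif A"
    using A by (simp add: emeasure_unif)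
qed simp

text \<open>All that the construction uses of a standard space. It is phrased with Borel functions only,
  for both conventions about the sigma-algebra of the unit interval: a Lebesgue measurable function
  agrees almost everywhere with a Borel function, and a Borel automorphism is Lebesgue measurable
  because it preserves null sets.\<close>

lemma standard_space_uniform_variable:
  assumes std: "standard_nonatomic_prob_space M"
  obtains \<pi> where "\<pi> \<in> borel_measurable M" "distr M borel \<pi> = unif"
    "\<And>h::'a \<Rightarrow> complex. h \<in> borel_measurable M \<Longrightarrow>
       \<exists>h'\<in>borel_measurable borel. AE x in M. h x = h' (\<pi> x)"
    "\<And>\<Phi> \<Phi>'. \<Phi> \<in> borel_measurable borel \<Longrightarrow> \<Phi>' \<in> borel_measurable borel \<Longrightarrow>
       distr unif borel \<Phi> = unif \<Longrightarrow> distr unif borel \<Phi>' = unif \<Longrightarrow>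
       AE y in unif. \<Phi>' (\<Phi> y) = y \<Longrightarrow> AE y in unif. \<Phi> (\<Phi>' y) = y \<Longrightarrow>
       \<exists>S\<in>MPT M. AE x in M. \<pi> (S x) = \<Phi> (\<pi> x)"
proof -
  define B where "B = restrict_space lborel {0..1::real}"
  interpret M: prob_space M using std by (simp add: standard_nonatomic_prob_space_def)
  obtain N where N: "N = B \<or> N = completion B" and iso: "iso_mod_null M N"
  proof -
    have "lebesgue_on {0..1::real} = completion B"
      unfolding B_def by (rule lebesgue_on_eq_completion) simp
    moreover have "iso_mod_null M B \<or> iso_mod_null M (lebesgue_on {0..1::real})"
      using std unfolding standard_nonatomic_prob_space_def B_def by simp
    ultimately have "iso_mod_null M B \<or> iso_mod_null M (completion B)" by simp
    then show ?thesis using that by blast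
  qed
  have spB: "space B = {0..1}" unfolding B_def by (subst space_restrict_space) simp
  have spN: "space N = {0..1}" using N by (elim disjE) (simp_all only: space_completion spB)
  have idB: "(\<lambda>x. x) \<in> B \<rightarrow>\<^sub>M borel" unfolding B_def by (simp add: measurable_restrict_space1)
  have idN: "(\<lambda>x. x) \<in> N \<rightarrow>\<^sub>M borel" using N idB measurable_completion[OF idB] by blast
  have distrB: "distr B borel (\<lambda>x. x) = unif" unfolding B_def by (rule distr_unit_interval)
  have distrN: "distr N borel (\<lambda>x. x) = unif" 
    using N
  proof
    assume "N = completion B"
    then show ?thesis by (simp only: distr_completion[OF idB] distrB)
  qed (simp only: distrB)
  note AE_N = AE_measure_preserving[OF idN distrN]
    and AE_B = AE_measure_preserving[OF idB distrB]
  obtain \<pi> \<rho> where \<pi> [measurable]: "\<pi> \<in> M \<rightarrow>\<^sub>M N" and \<rho> [measurable]: "\<rho> \<in> N \<rightarrow>\<^sub>M M"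
    and pres: "distr M N \<pi> = N" "distr N M \<rho> = M"
    and inv: "AE x in M. \<rho> (\<pi> x) = x" "AE y in N. \<pi> (\<rho> y) = y"
  proof (rule iso_mod_null_pair[OF iso M.not_empty])
    show "space N \<noteq> {}" by (simp add: spN)
  qed blast
  note AE_M = AE_measure_preserving[OF \<pi> pres(1)]
  have \<pi>b: "\<pi> \<in> borel_measurable M" using measurable_comp[OF \<pi> idN] by (simp add: o_def)
  have "distr M borel \<pi> = distr (distr M N \<pi>) borel (\<lambda>x. x)"
    using distr_distr[OF idN \<pi>] by (simp add: o_def)
  then have distr_\<pi>: "distr M borel \<pi> = unif" by (simp only: pres distrN)
  have repr: "\<exists>h'\<in>borel_measurable borel. AE x in M. h x = h' (\<pi> x)"
    if h [measurable]: "h \<in> borel_measurable M" for h :: "'a \<Rightarrow> complex"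
  proof -
    have real: "\<exists>k'\<in>borel_measurable borel. AE y in N. k y = k' y"
      if k: "k \<in> borel_measurable N" for k :: "real \<Rightarrow> real"
    proof -
      have "\<exists>k'\<in>borel_measurable B. AE y in N. k y = k' y"
        using N
      proof
        assume "N = completion B"
        then show ?thesis using completion_ex_borel_measurable_real[of k B] k AE_completion by blast
      qed (use k in auto)
      then obtain k' where k': "k' \<in> borel_measurable B" "AE y in N. k y = k' y" by blast
      have "(\<lambda>y. if y \<in> {0..1} then k' y else 0) \<in> borel_measurable lborel"
        using k'(1) unfolding B_def
        by (subst measurable_If_restrict_space_iff) (auto simp: atLeastAtMost_def atLeast_def atMost_def Int_def)
      moreover have "AE y in N. k y = (if y \<in> {0..1} then k' y else 0)"
        using k'(2) AE_space by eventually_elim (simp add: spN)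
      ultimately show ?thesis by (intro bexI[where x="\<lambda>y. if y \<in> {0..1} then k' y else 0"]) auto
    qed
    obtain a b where a: "a \<in> borel_measurable borel" "AE y in N. Re (h (\<rho> y)) = a y"
      and b: "b \<in> borel_measurable borel" "AE y in N. Im (h (\<rho> y)) = b y"
      using real[of "\<lambda>y. Re (h (\<rho> y))"] real[of "\<lambda>y. Im (h (\<rho> y))"] by auto
    have "AE x in M. h x = Complex (a (\<pi> x)) (b (\<pi> x))"
      using AE_M[OF a(2)] AE_M[OF b(2)] inv(1)
      by eventually_elim (metis complex.collapse)
    moreover have "(\<lambda>y. Complex (a y) (b y)) \<in> borel_measurable borel"
      using a(1) b(1) by (subst borel_measurable_complex_iff) simp
    ultimately show "\<exists>h'\<in>borel_measurable borel. AE x in M. h x = h' (\<pi> x)"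
      by (intro bexI[where x="\<lambda>y. Complex (a y) (b y)"])
  qed
  have lift: "\<exists>S\<in>MPT M. AE x in M. \<pi> (S x) = \<Phi> (\<pi> x)"
    if m: "\<Phi> \<in> borel_measurable borel" "\<Phi>' \<in> borel_measurable borel"
    and p: "distr unif borel \<Phi> = unif" "distr unif borel \<Phi>' = unif"
    and i: "AE y in unif. \<Phi>' (\<Phi> y) = y" "AE y in unif. \<Phi> (\<Phi>' y) = y"
    for \<Phi> \<Phi>' :: "real \<Rightarrow> real"
  proof -
    \<comment> \<open>The given maps of the line may send a null set of points outside the unit interval.\<close>
    define clip where "clip = (\<lambda>y::real. if 0 \<le> y \<and> y \<le> 1 then y else 0)"
    have clip_m [measurable]: "clip \<in> borel_measurable borel" unfolding clip_def by measurable
    have clip: "(\<lambda>y. clip (\<Theta> y)) \<in> N \<rightarrow>\<^sub>M N" "distr N N (\<lambda>y. clip (\<Theta> y)) = N"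
      "AE y in N. clip (\<Theta> y) = \<Theta> y"
      if \<Theta> [measurable]: "\<Theta> \<in> borel_measurable borel" and pr: "distr unif borel \<Theta> = unif" for \<Theta>
    proof -
      have "AE y in unif. 0 < \<Theta> y \<and> \<Theta> y < 1"
        by (rule AE_unif_compose[OF AE_unif_bounds \<Theta> pr])
      then have fixed: "AE y in unif. clip (\<Theta> y) = \<Theta> y"
        by eventually_elim (simp add: clip_def)
      show "AE y in N. clip (\<Theta> y) = \<Theta> y" by (rule AE_N[OF fixed])
      have AEclip: "AE y in B. clip (\<Theta> y) = \<Theta> y" by (rule AE_B[OF fixed])
      have cm: "(\<lambda>y. clip (\<Theta> y)) \<in> B \<rightarrow>\<^sub>M B"
        unfolding B_def
        by (intro measurable_restrict_space3) (auto simp: clip_def)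
      have "distr B B (\<lambda>y. clip (\<Theta> y)) = B"
      proof (rule measure_eqI)
        fix X assume "X \<in> sets (distr B B (\<lambda>y. clip (\<Theta> y)))"
        then have X: "X \<in> sets B" by simp
        then have X': "X \<in> sets borel" "X \<subseteq> {0..1}" by (auto simp: B_def sets_restrict_space_iff)
        have "emeasure (distr B B (\<lambda>y. clip (\<Theta> y))) X = emeasure B {y\<in>space B. clip (\<Theta> y) \<in> X}"
          using cm X by (subst emeasure_distr) (auto intro!: arg_cong2[where f=emeasure])
        also have "\<dots> = emeasure B {y\<in>space B. \<Theta> y \<in> X}"
        proof (rule emeasure_eq_AE)
          show "AE y in B. (y \<in> {y \<in> space B. clip (\<Theta> y) \<in> X}) = (y \<in> {y \<in> space B. \<Theta> y \<in> X})"
            using AEclip by eventually_elim simp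
          show "{y \<in> space B. clip (\<Theta> y) \<in> X} \<in> sets B" "{y \<in> space B. \<Theta> y \<in> X} \<in> sets B"
            using measurable_sets[OF cm X] measurable_sets[OF measurable_compose[OF idB \<Theta>] X'(1)]
            by (simp_all add: vimage_def Int_def conj_commute)
        qed
        also have "\<dots> = emeasure (distr B borel (\<lambda>x. x)) (\<Theta> -` X)"
        proof -
          have "\<Theta> -` X \<in> sets borel" using measurable_sets[OF \<Theta> X'(1)] by simp
          then show ?thesis
            by (simp add: emeasure_distr[OF idB] vimage_def Int_def conj_commute)
        qed
        also have "\<dots> = emeasure (distr unif borel \<Theta>) X"
          unfolding distrB using X'(1) \<Theta> by (simp add: emeasure_distr)
        also have "\<dots> = emeasure (distr B borel (\<lambda>x. x)) X" by (simp only: pr distrB)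
        also have "\<dots> = emeasure B X"
          using X' idB by (subst emeasure_distr) (auto simp: spB intro!: arg_cong2[where f=emeasure])
        finally show "emeasure (distr B B (\<lambda>y. clip (\<Theta> y))) X = emeasure B X" .
      qed simp
      then have dc: "distr (completion B) B (\<lambda>y. clip (\<Theta> y)) = B"
        by (simp add: distr_completion[OF cm])
      have cm': "(\<lambda>y. clip (\<Theta> y)) \<in> completion B \<rightarrow>\<^sub>M B"
        using cm by (rule measurable_completion)
      have "(\<lambda>y. clip (\<Theta> y)) \<in> completion B \<rightarrow>\<^sub>M completion B"
        by (rule completion.measurable_completion2[OF cm']) (simp add: dc)
      moreover have "distr (completion B) (completion B) (\<lambda>y. clip (\<Theta> y)) = completion B"
        using completion.completion_distr_eq[OF cm'] by (simp add: dc)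
      ultimately show "(\<lambda>y. clip (\<Theta> y)) \<in> N \<rightarrow>\<^sub>M N" "distr N N (\<lambda>y. clip (\<Theta> y)) = N"
        using N cm \<open>distr B B (\<lambda>y. clip (\<Theta> y)) = B\<close> by auto
    qed
    note c = clip[OF m(1) p(1)] and c' = clip[OF m(2) p(2)]
    define S where "S = (\<lambda>x. \<rho> (clip (\<Phi> (\<pi> x))))"
    define S' where "S' = (\<lambda>x. \<rho> (clip (\<Phi>' (\<pi> x))))"
    have Sm: "S \<in> M \<rightarrow>\<^sub>M M" and S'm: "S' \<in> M \<rightarrow>\<^sub>M M"
      unfolding S_def S'_def
      using measurable_compose[OF measurable_compose[OF \<pi> c(1)] \<rho>]
        measurable_compose[OF measurable_compose[OF \<pi> c'(1)] \<rho>] by simp_all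
    have "distr M M S = distr (distr (distr M N \<pi>) N (\<lambda>y. clip (\<Phi> y))) M \<rho>"
      unfolding S_def using c(1) by (simp add: distr_distr o_def)
    then have presS: "distr M M S = M" by (simp only: pres c(2))
    have conj: "AE x in M. \<pi> (\<rho> (clip (\<Theta> (\<pi> x)))) = \<Theta> (\<pi> x)"
      if \<Theta>: "\<Theta> \<in> borel_measurable borel" "distr unif borel \<Theta> = unif" for \<Theta>
      using AE_M[OF AE_measure_preserving[OF clip(1,2)[OF \<Theta>] inv(2)]] AE_M[OF clip(3)[OF \<Theta>]] by eventually_elim simp
    have inverse: "AE x in M. \<rho> (clip (\<Theta>' (\<pi> (\<rho> (clip (\<Theta> (\<pi> x))))))) = x"
      if \<Theta>: "\<Theta> \<in> borel_measurable borel" "distr unif borel \<Theta> = unif" "AE y in unif. \<Theta>' (\<Theta> y) = y"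
      for \<Theta> \<Theta>'
      using conj[OF \<Theta>(1,2)] AE_M[OF AE_N[OF \<Theta>(3)]] inv(1) AE_space
    proof eventually_elim
      case (elim x)
      have "0 \<le> \<pi> x" "\<pi> x \<le> 1" using measurable_space[OF \<pi> elim(4)] by (auto simp: spN)
      then show ?case using elim by (simp add: clip_def)
    qed
    have "S \<in> MPT M"
      using Sm S'm presS inverse[OF m(1) p(1) i(1)] inverse[OF m(2) p(2) i(2)]
      by (intro MPT_I[of S M S']) (auto simp: S_def S'_def)
    moreover have "AE x in M. \<pi> (S x) = \<Phi> (\<pi> x)"
      unfolding S_def by (rule conj[OF m(1) p(1)])
    ultimately show "\<exists>S\<in>MPT M. AE x in M. \<pi> (S x) = \<Phi> (\<pi> x)" by blast
  qed
  show ?thesis by (rule that[OF \<pi>b distr_\<pi> repr lift])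
qed

section \<open>Discrete simple spectrum implies predictivity\<close>

lemma MPT_measurable: "S \<in> MPT M \<Longrightarrow> S \<in> M \<rightarrow>\<^sub>M M"
  by (simp add: MPT_def)

lemma mpt_inv_MPT: "S \<in> MPT M \<Longrightarrow> mpt_inv M S \<in> MPT M"
  and AE_mpt_inv_left: "S \<in> MPT M \<Longrightarrow> AE x in M. mpt_inv M S (S x) = x"
  and AE_mpt_inv_right: "S \<in> MPT M \<Longrightarrow> AE x in M. S (mpt_inv M S x) = x"
  using is_mpt_inv_mpt_inv[of S M] by (simp_all add: is_mpt_inv_def)

lemma MPT_funpow:
  assumes "S \<in> MPT M"
  shows "S ^^ n \<in> M \<rightarrow>\<^sub>M M" "distr M M (S ^^ n) = M"
proof -
  have "S ^^ n \<in> M \<rightarrow>\<^sub>M M \<and> distr M M (S ^^ n) = M"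
  proof (induction n)
    case (Suc n)
    have "distr M M (S \<circ> (S ^^ n)) = distr (distr M M (S ^^ n)) M S"
      using Suc MPT_measurable[OF assms] by (intro distr_distr[symmetric]) auto
    also have "\<dots> = M" using Suc MPT_distr[OF assms] by simp
    finally show ?case using Suc MPT_measurable[OF assms] by (auto simp: comp_def intro: measurable_compose)
  qed (simp add: id_def)
  then show "S ^^ n \<in> M \<rightarrow>\<^sub>M M" "distr M M (S ^^ n) = M" by auto
qed

lemma MPT_AE_funpow:
  assumes "S \<in> MPT M" "AE x in M. P x"
  shows "AE x in M. P ((S ^^ n) x)"
  by (rule AE_measure_preserving[OF MPT_funpow[OF assms(1)] assms(2)])

lemma delay_L2:
  assumes "S \<in> MPT M" "f \<in> L2_space M"
  shows "delay M S f k \<in> L2_space M"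
  using L2_space_compose[OF MPT_funpow[OF mpt_inv_MPT[OF assms(1)]] assms(2)]
  by (simp add: delay_def comp_def)

lemma openin_L2_inner_nonzero:
  assumes "E \<in> L2_space M"
  shows "openin (L2_topology M) {g \<in> L2_space M. L2_inner M g E \<noteq> 0}"
  unfolding openin_L2_topology
proof (intro conjI ballI)
  fix g assume g: "g \<in> {g \<in> L2_space M. L2_inner M g E \<noteq> 0}"
  define e where "e = cmod (L2_inner M g E) / (L2_norm M E + 1)"
  have pos: "L2_norm M E + 1 > 0" by (rule add_nonneg_pos) auto
  have e: "e > 0" using g pos by (simp add: e_def)
  have "L2_inner M h E \<noteq> 0" if h: "h \<in> L2_space M" "L2_norm M (\<lambda>x. h x - g x) < e" for h
  proof
    assume "L2_inner M h E = 0"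
    then have "cmod (L2_inner M g E) = cmod (L2_inner M (\<lambda>x. h x - g x) E)"
      using L2_inner_diff_left[OF h(1) _ assms, of g] g by simp
    also have "\<dots> \<le> L2_norm M (\<lambda>x. h x - g x) * L2_norm M E"
      using h g assms by (intro L2_Cauchy_Schwarz L2_space_diff) auto
    also have "\<dots> \<le> e * L2_norm M E" using h by (intro mult_right_mono) auto
    also have "\<dots> < e * (L2_norm M E + 1)" using e by simp
    also have "\<dots> = cmod (L2_inner M g E)" using pos by (simp add: e_def)
    finally show False by simp
  qed
  then show "\<exists>e>0. \<forall>h\<in>L2_space M. L2_norm M (\<lambda>x. h x - g x) < e \<longrightarrow>
      h \<in> {g \<in> L2_space M. L2_inner M g E \<noteq> 0}"
    using e by (intro exI[of _ e]) auto
qed auto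

lemma L2_closureI:
  assumes "A \<subseteq> L2_space M"
    and "\<And>u e. u \<in> L2_space M \<Longrightarrow> e > 0 \<Longrightarrow> \<exists>g\<in>A. L2_norm M (\<lambda>x. g x - u x) < e"
  shows "L2_topology M closure_of A = L2_space M"
proof
  show "L2_topology M closure_of A \<subseteq> L2_space M"
    using closure_of_subset_topspace[of "L2_topology M" A] by simp
  show "L2_space M \<subseteq> L2_topology M closure_of A"
  proof
    fix u assume u: "u \<in> L2_space M"
    show "u \<in> L2_topology M closure_of A"
      unfolding in_closure_of
    proof (intro conjI allI impI)
      fix T assume T: "u \<in> T \<and> openin (L2_topology M) T"
      then obtain e where e: "e > 0" "\<forall>g\<in>L2_space M. L2_norm M (\<lambda>x. g x - u x) < e \<longrightarrow> g \<in> T"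
        unfolding openin_L2_topology by blast
      then show "\<exists>y. y \<in> A \<and> y \<in> T" using assms(1) assms(2)[OF u e(1)] by blast
    qed (use u in simp)
  qed
qed

text \<open>The eigenfunctions are orthogonal because S preserves inner products and the eigenvalues are
  distinct.\<close>

locale discrete_simple_spectrum =
  fixes M :: "'a measure" and S :: "'a \<Rightarrow> 'a" and E :: "nat \<Rightarrow> 'a \<Rightarrow> complex" and \<mu> :: "nat \<Rightarrow> complex"
  assumes prob: "prob_space M"
    and S: "S \<in> MPT M"
    and E_meas: "\<And>n. E n \<in> borel_measurable M"
    and E_unimodular: "\<And>n x. cmod (E n x) = 1"
    and eigen: "\<And>n. AE x in M. E n (S x) = \<mu> n * E n x"
    and eigenvalue_unimodular: "\<And>n. cmod (\<mu> n) = 1"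
    and eigenvalues_distinct: "inj \<mu>"
    and total: "\<And>g \<delta>. g \<in> L2_space M \<Longrightarrow> \<delta> > 0 \<Longrightarrow>
      \<exists>n a. L2_norm M (\<lambda>x. g x - (\<Sum>m<n. a m * E m x)) < \<delta>"
begin

interpretation M: prob_space M by (rule prob)

lemma E_L2: "E n \<in> L2_space M"
  by (rule L2_space_bounded[where B=1]) (use prob E_meas E_unimodular in \<open>auto simp: prob_space_def\<close>)

lemma E_norm: "L2_norm M (E n) = 1"
  by (simp add: L2_norm_def E_unimodular M.prob_space)

lemma eigenvalue_cnj: "cnj (\<mu> n) * \<mu> n = 1" "\<mu> n * cnj (\<mu> n) = 1"
  using eigenvalue_unimodular[of n] by (simp_all add: complex_norm_square[symmetric] mult.commute)

lemma E_orthonormal: "L2_inner M (E n) (E m) = (if n = m then 1 else 0)"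
proof (cases "n = m")
  case True
  then show ?thesis by (simp add: L2_inner_self E_norm)
next
  case False
  have "L2_inner M (E n) (E m) = L2_inner M (\<lambda>x. E n (S x)) (\<lambda>x. E m (S x))"
    using MPT_measurable[OF S] MPT_distr[OF S] E_meas by (intro L2_inner_compose[symmetric])
  also have "\<dots> = L2_inner M (\<lambda>x. \<mu> n * E n x) (\<lambda>x. \<mu> m * E m x)"
    using eigen E_meas measurable_compose[OF MPT_measurable[OF S] E_meas]
    by (intro L2_inner_cong_AE) auto
  also have "\<dots> = \<mu> n * cnj (\<mu> m) * L2_inner M (E n) (E m)"
    unfolding L2_inner_def by (simp add: mult_ac)
  finally have "(1 - \<mu> n * cnj (\<mu> m)) * L2_inner M (E n) (E m) = 0" by (simp add: algebra_simps)
  moreover have "\<mu> n * cnj (\<mu> m) \<noteq> 1"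
  proof
    assume "\<mu> n * cnj (\<mu> m) = 1"
    then have "\<mu> n * (cnj (\<mu> m) * \<mu> m) = \<mu> m" by (simp add: mult.assoc[symmetric])
    then show False using eigenvalues_distinct False by (simp add: eigenvalue_cnj inj_eq)
  qed
  ultimately show ?thesis using False by simp
qed

lemma E_delay: "AE x in M. delay M S (E n) k x = cnj (\<mu> n) ^ k * E n x"
proof (induction k)
  case (Suc k)
  let ?R = "mpt_inv M S"
  have "AE x in M. E n (?R x) = cnj (\<mu> n) * E n x"
    using MPT_AE[OF mpt_inv_MPT[OF S] eigen[of n]] AE_mpt_inv_right[OF S]
  proof eventually_elim
    case (elim x)
    then have "cnj (\<mu> n) * E n x = (cnj (\<mu> n) * \<mu> n) * E n (?R x)" by (simp add: mult.assoc)
    then show ?case by (simp add: eigenvalue_cnj)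
  qed
  with MPT_AE[OF mpt_inv_MPT[OF S] Suc] show ?case
  proof eventually_elim
    case (elim x)
    then show ?case by (simp add: delay_def funpow_swap1)
  qed
qed (simp add: delay_def)

definition average :: "nat \<Rightarrow> nat \<Rightarrow> ('a \<Rightarrow> complex) \<Rightarrow> 'a \<Rightarrow> complex" where
  "average n N g = (\<lambda>x. \<Sum>k<N. \<mu> n ^ k / of_nat N * delay M S g k x)"

lemma average_L2: "g \<in> L2_space M \<Longrightarrow> average n N g \<in> L2_space M"
  unfolding average_def by (intro L2_space_sum L2_space_scale delay_L2 S)

lemma delay_diff: "delay M S (\<lambda>x. g x - h x) k x = delay M S g k x - delay M S h k x"
  by (simp add: delay_def)

lemma average_diff: "average n N (\<lambda>x. g x - h x) x = average n N g x - average n N h x"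
  by (simp add: average_def delay_diff right_diff_distrib sum_subtractf)

lemma average_norm_le:
  assumes g: "g \<in> L2_space M"
  shows "L2_norm M (average n N g) \<le> L2_norm M g"
proof -
  have d: "L2_norm M (delay M S g k) = L2_norm M g" for k
    using L2_norm_compose[OF MPT_funpow[OF mpt_inv_MPT[OF S], of k] L2_space_measurable[OF g]]
    by (simp add: delay_def comp_def)
  have "L2_norm M (average n N g) \<le> (\<Sum>k<N. L2_norm M (\<lambda>x. \<mu> n ^ k / of_nat N * delay M S g k x))"
    unfolding average_def by (intro L2_norm_sum_le L2_space_scale delay_L2 S g) auto
  also have "\<dots> = (\<Sum>k<N. L2_norm M g / of_nat N)"
    unfolding L2_norm_scale by (simp add: d norm_divide norm_power eigenvalue_unimodular)
  also have "\<dots> \<le> L2_norm M g" by simp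
  finally show ?thesis .
qed

lemma geometric_average_tendsto:
  assumes z: "cmod z = 1"
  shows "(\<lambda>N. \<Sum>k<N. z ^ k / of_nat N) \<longlonglongrightarrow> (if z = 1 then 1 else 0)"
proof (cases "z = 1")
  case True
  have "eventually (\<lambda>N. (\<Sum>k<N. z ^ k / of_nat N) = 1) sequentially"
    using eventually_gt_at_top[of 0] by eventually_elim (simp add: True)
  then show ?thesis using True by (simp add: tendsto_eventually)
next
  case False
  have "(\<lambda>N. 2 / cmod (1 - z) / real N) \<longlonglongrightarrow> 0" by real_asymp
  moreover have "cmod (\<Sum>k<N. z ^ k / of_nat N) \<le> 2 / cmod (1 - z) / real N" for N
  proof -
    have "(\<Sum>k<N. z ^ k / of_nat N) = (1 - z ^ N) / (1 - z) / of_nat N"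
      using False by (simp add: sum_divide_distrib[symmetric] sum_gp_strict)
    moreover have "cmod (1 - z ^ N) \<le> 2"
      using norm_triangle_ineq4[of 1 "z ^ N"] z by (simp add: norm_power)
    ultimately show ?thesis by (simp add: norm_divide norm_mult divide_right_mono)
  qed
  ultimately have "(\<lambda>N. \<Sum>k<N. z ^ k / of_nat N) \<longlonglongrightarrow> 0"
    by (intro Lim_null_comparison[OF _ \<open>(\<lambda>N. 2 / cmod (1 - z) / real N) \<longlonglongrightarrow> 0\<close>]) auto
  then show ?thesis using False by simp
qed

text \<open>A mean ergodic theorem. On a finite combination of eigenfunctions the averages are geometric
  averages of the ratios of eigenvalues, and only the ratio 1 survives. Finite combinations are
  dense and averaging does not increase norms, so the convergence extends to all g.\<close>

lemma average_tendsto_projection: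
  assumes g: "g \<in> L2_space M"
  shows "(\<lambda>N. L2_norm M (\<lambda>x. average n N g x - L2_inner M g (E n) * E n x)) \<longlonglongrightarrow> 0"
proof (rule LIMSEQ_I)
  fix e :: real assume "e > 0"
  then have "e / 3 > 0" by simp
  from total[OF g this] obtain K a where
    p: "L2_norm M (\<lambda>x. g x - (\<Sum>m<K. a m * E m x)) < e / 3" by blast
  define p where "p = (\<lambda>x. \<Sum>m<K. a m * E m x)"
  have pL2: "p \<in> L2_space M" unfolding p_def by (intro L2_space_sum L2_space_scale E_L2)
  have gp: "(\<lambda>x. g x - p x) \<in> L2_space M" using g pL2 by (rule L2_space_diff)
  have gp_norm: "L2_norm M (\<lambda>x. g x - p x) < e / 3" using p by (simp add: p_def)
  have coeff: "L2_inner M p (E n) = (\<Sum>m<K. a m * (if m = n then 1 else 0))"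
    unfolding p_def by (subst L2_inner_sum_left) (auto simp: E_L2 E_orthonormal)
  define \<kappa> where "\<kappa> = (\<lambda>m N. \<Sum>k<N. (\<mu> n * cnj (\<mu> m)) ^ k / of_nat N)"
  have one: "\<mu> n * cnj (\<mu> m) = 1 \<longleftrightarrow> m = n" for m
  proof
    assume "\<mu> n * cnj (\<mu> m) = 1"
    then have "\<mu> n * (cnj (\<mu> m) * \<mu> m) = \<mu> m" by (simp add: mult.assoc[symmetric])
    then show "m = n" using eigenvalues_distinct by (simp add: eigenvalue_cnj inj_eq)
  qed (simp add: eigenvalue_cnj)
  have \<kappa>: "\<kappa> m \<longlonglongrightarrow> (if m = n then 1 else 0)" for m
    using geometric_average_tendsto[of "\<mu> n * cnj (\<mu> m)"]
    by (simp add: \<kappa>_def norm_mult eigenvalue_unimodular one)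
  have avg_p: "AE x in M. average n N p x = (\<Sum>m<K. a m * \<kappa> m N * E m x)" for N
  proof -
    have "AE x in M. \<forall>m\<in>{..<K}. \<forall>k\<in>{..<N}. delay M S (E m) k x = cnj (\<mu> m) ^ k * E m x"
      by (intro AE_finite_allI E_delay) auto
    then show ?thesis
    proof eventually_elim
      case (elim x)
      have "average n N p x = (\<Sum>k<N. \<mu> n ^ k / of_nat N * (\<Sum>m<K. a m * delay M S (E m) k x))"
        by (simp add: average_def p_def delay_def)
      also have "\<dots> = (\<Sum>k<N. \<Sum>m<K. \<mu> n ^ k / of_nat N * (a m * (cnj (\<mu> m) ^ k * E m x)))"
        using elim by (simp add: sum_distrib_left)
      also have "\<dots> = (\<Sum>m<K. \<Sum>k<N. \<mu> n ^ k / of_nat N * (a m * (cnj (\<mu> m) ^ k * E m x)))"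
        by (rule sum.swap)
      also have "\<dots> = (\<Sum>m<K. a m * \<kappa> m N * E m x)"
        by (simp add: \<kappa>_def sum_distrib_left sum_distrib_right power_mult_distrib mult_ac)
      finally show ?case .
    qed
  qed
  define r where "r = (\<lambda>N. \<Sum>m<K. cmod (a m * (\<kappa> m N - (if m = n then 1 else 0))))"
  have "r \<longlonglongrightarrow> (\<Sum>m<K. cmod (a m * ((if m = n then 1 else 0) - (if m = n then 1 else 0))))"
    unfolding r_def by (intro tendsto_intros \<kappa>)
  then have "r \<longlonglongrightarrow> 0" by simp
  then obtain N0 where N0: "r N < e / 3" if "N \<ge> N0" for N
    using \<open>e / 3 > 0\<close> unfolding LIMSEQ_def dist_real_def by (metis abs_less_iff diff_zero)
  have "L2_norm M (\<lambda>x. average n N g x - L2_inner M g (E n) * E n x) < e" if N: "N \<ge> N0" for N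
  proof -
    let ?d = "\<lambda>x. (average n N (\<lambda>x. g x - p x) x)
      + ((average n N p x - L2_inner M p (E n) * E n x) + (- L2_inner M (\<lambda>x. g x - p x) (E n)) * E n x)"
    have "(\<lambda>x. average n N g x - L2_inner M g (E n) * E n x) = ?d"
      by (simp add: average_diff L2_inner_diff_left[OF g pL2 E_L2] algebra_simps fun_eq_iff)
    then have "L2_norm M (\<lambda>x. average n N g x - L2_inner M g (E n) * E n x) = L2_norm M ?d" by simp
    also have "\<dots> \<le> L2_norm M (average n N (\<lambda>x. g x - p x))
        + (L2_norm M (\<lambda>x. average n N p x - L2_inner M p (E n) * E n x)
        + L2_norm M (\<lambda>x. (- L2_inner M (\<lambda>x. g x - p x) (E n)) * E n x))"
      by (intro order_trans[OF L2_norm_triangle] add_left_mono L2_norm_triangle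
          L2_space_add L2_space_diff L2_space_scale average_L2 E_L2 gp pL2)
    also have "L2_norm M (average n N (\<lambda>x. g x - p x)) < e / 3"
      using average_norm_le[OF gp, of n N] gp_norm by simp
    also have "L2_norm M (\<lambda>x. (- L2_inner M (\<lambda>x. g x - p x) (E n)) * E n x) < e / 3"
      using L2_Cauchy_Schwarz[OF gp E_L2, of n] gp_norm
      unfolding L2_norm_scale E_norm norm_minus_cancel by simp
    also have "L2_norm M (\<lambda>x. average n N p x - L2_inner M p (E n) * E n x) < e / 3"
    proof -
      have "AE x in M. average n N p x - L2_inner M p (E n) * E n x
          = (\<Sum>m<K. a m * (\<kappa> m N - (if m = n then 1 else 0)) * E m x)"
        using avg_p[of N]
      proof eventually_elim
        case (elim x)
        have "L2_inner M p (E n) * E n x = (\<Sum>m<K. a m * (if m = n then 1 else 0) * E m x)"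
          unfolding coeff sum_distrib_right by (intro sum.cong) auto
        then show ?case unfolding elim
          by (simp add: sum_subtractf[symmetric] left_diff_distrib right_diff_distrib)
      qed
      then have "L2_norm M (\<lambda>x. average n N p x - L2_inner M p (E n) * E n x)
          = L2_norm M (\<lambda>x. \<Sum>m<K. a m * (\<kappa> m N - (if m = n then 1 else 0)) * E m x)"
        by (intro L2_norm_cong_AE L2_space_measurable[OF L2_space_diff] L2_space_measurable[OF L2_space_sum]
            average_L2 pL2 L2_space_scale E_L2)
      also have "\<dots> \<le> (\<Sum>m<K. L2_norm M (\<lambda>x. a m * (\<kappa> m N - (if m = n then 1 else 0)) * E m x))"
        by (intro L2_norm_sum_le L2_space_scale E_L2) auto
      also have "\<dots> = r N" unfolding L2_norm_scale E_norm by (simp add: r_def)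
      also have "\<dots> < e / 3" by (rule N0[OF N])
      finally show ?thesis .
    qed
    finally show ?thesis by simp
  qed
  then show "\<exists>N0. \<forall>N\<ge>N0. norm (L2_norm M (\<lambda>x. average n N g x - L2_inner M g (E n) * E n x) - 0) < e"
    by auto
qed

text \<open>The averages are finite combinations of delays of g, so each eigenfunction lies in the closed
  span of the delays if g has a nonzero coefficient there.\<close>

lemma predictive_observableI:
  assumes g: "g \<in> L2_space M" and nz: "\<And>n. L2_inner M g (E n) \<noteq> 0"
  shows "predictive_observable M S g"
  unfolding predictive_observable_def
proof (intro conjI g L2_closureI)
  have "(\<lambda>x. \<Sum>i<n. a i * delay M S g i x) \<in> L2_space M" for n a
    by (intro L2_space_sum L2_space_scale delay_L2 S g)
  then show "lin_span (delay M S g) \<subseteq> L2_space M" by (auto simp: lin_span_def)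
  fix u and e :: real assume u: "u \<in> L2_space M" and "e > 0"
  then have "e / 2 > 0" by simp
  from total[OF u this] obtain K a where
    p: "L2_norm M (\<lambda>x. u x - (\<Sum>m<K. a m * E m x)) < e / 2" by blast
  define w where "w = (\<lambda>N x. \<Sum>m<K. a m / L2_inner M g (E m) * average m N g x)"
  have wL2: "w N \<in> L2_space M" for N
    unfolding w_def by (intro L2_space_sum L2_space_scale average_L2 g)
  have pL2: "(\<lambda>x. \<Sum>m<K. a m * E m x) \<in> L2_space M" by (intro L2_space_sum L2_space_scale E_L2)
  have bound: "L2_norm M (\<lambda>x. w N x - (\<Sum>m<K. a m * E m x))
      \<le> (\<Sum>m<K. cmod (a m / L2_inner M g (E m))
          * L2_norm M (\<lambda>x. average m N g x - L2_inner M g (E m) * E m x))" for N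
  proof -
    have "(\<lambda>x. w N x - (\<Sum>m<K. a m * E m x)) = (\<lambda>x. \<Sum>m<K. a m / L2_inner M g (E m)
        * (average m N g x - L2_inner M g (E m) * E m x))"
      using nz by (simp add: w_def sum_subtractf[symmetric] right_diff_distrib)
    then have "L2_norm M (\<lambda>x. w N x - (\<Sum>m<K. a m * E m x)) = L2_norm M (\<lambda>x. \<Sum>m<K. a m / L2_inner M g (E m)
        * (average m N g x - L2_inner M g (E m) * E m x))" by (rule arg_cong)
    also have "\<dots> \<le> (\<Sum>m<K. L2_norm M (\<lambda>x. a m / L2_inner M g (E m)
        * (average m N g x - L2_inner M g (E m) * E m x)))"
      by (intro L2_norm_sum_le L2_space_scale L2_space_diff average_L2 g E_L2) auto
    finally show ?thesis by (simp only: L2_norm_scale)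
  qed
  have "(\<lambda>N. \<Sum>m<K. cmod (a m / L2_inner M g (E m))
      * L2_norm M (\<lambda>x. average m N g x - L2_inner M g (E m) * E m x)) \<longlonglongrightarrow> (\<Sum>m<K. cmod (a m / L2_inner M g (E m)) * 0)"
    by (intro tendsto_intros average_tendsto_projection g)
  then have "(\<lambda>N. \<Sum>m<K. cmod (a m / L2_inner M g (E m))
      * L2_norm M (\<lambda>x. average m N g x - L2_inner M g (E m) * E m x)) \<longlonglongrightarrow> 0" by simp
  from order_tendstoD(2)[OF this \<open>e / 2 > 0\<close>] obtain N where
    "(\<Sum>m<K. cmod (a m / L2_inner M g (E m))
      * L2_norm M (\<lambda>x. average m N g x - L2_inner M g (E m) * E m x)) < e / 2"
    by (meson eventually_happens sequentially_bot)
  then have N: "L2_norm M (\<lambda>x. w N x - (\<Sum>m<K. a m * E m x)) < e / 2"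
    using bound[of N] by simp
  have "L2_norm M (\<lambda>x. w N x - u x)
      \<le> L2_norm M (\<lambda>x. w N x - (\<Sum>m<K. a m * E m x)) + L2_norm M (\<lambda>x. (\<Sum>m<K. a m * E m x) - u x)"
    by (rule L2_norm_triangle_dist[OF wL2 pL2 u])
  also have "\<dots> < e" using N p by (simp add: L2_norm_commute[of M "\<lambda>x. \<Sum>m<K. a m * E m x"])
  finally have close: "L2_norm M (\<lambda>x. w N x - u x) < e" .
  define b where "b = (\<lambda>k. \<Sum>m<K. a m / L2_inner M g (E m) * (\<mu> m ^ k / of_nat N))"
  have "w N = (\<lambda>x. \<Sum>k<N. b k * delay M S g k x)"
  proof
    fix x
    have "w N x = (\<Sum>m<K. \<Sum>k<N. a m / L2_inner M g (E m) * (\<mu> m ^ k / of_nat N) * delay M S g k x)"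
      by (simp add: w_def average_def sum_distrib_left mult.assoc)
    also have "\<dots> = (\<Sum>k<N. \<Sum>m<K. a m / L2_inner M g (E m) * (\<mu> m ^ k / of_nat N) * delay M S g k x)"
      by (rule sum.swap)
    finally show "w N x = (\<Sum>k<N. b k * delay M S g k x)"
      by (simp only: sum_distrib_right b_def)
  qed
  then have "w N \<in> lin_span (delay M S g)" 
    unfolding lin_span_def by (intro CollectI exI[of _ N] exI[of _ b] conjI TrueI)
  then show "\<exists>g'\<in>lin_span (delay M S g). L2_norm M (\<lambda>x. g' x - u x) < e" using close by blast
qed

text \<open>A series of all eigenfunctions with summable nonzero weights. It spans the line that
  witnesses prevalence.\<close>

lemma exists_observable_nonzero_coefficients:
  "\<exists>h\<in>L2_space M. \<forall>n. L2_inner M h (E n) \<noteq> 0"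
proof -
  define h where "h = (\<lambda>x. \<Sum>k. (1/2)^k * E k x)"
  have sm: "summable (\<lambda>k. (1/2::real)^k)" by (rule summable_geometric) simp
  have sz: "cmod ((1/2)^k * E k x) = (1/2)^k" for k x
    by (simp add: norm_mult norm_power E_unimodular)
  have h_meas: "h \<in> borel_measurable M"
    unfolding h_def by (intro borel_measurable_suminf borel_measurable_times borel_measurable_const E_meas)
  have "cmod (h x) \<le> 2" for x
  proof -
    have "cmod (h x) \<le> (\<Sum>k. cmod ((1/2)^k * E k x))"
      unfolding h_def using sm by (intro summable_norm) (simp only: sz)
    also have "\<dots> = 2" unfolding sz by (simp add: suminf_geometric)
    finally show ?thesis .
  qed
  then have hL2: "h \<in> L2_space M"
    by (intro L2_space_bounded[where B=2] h_meas) (auto simp: M.finite_measure_axioms)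
  have "L2_inner M h (E n) = (1/2)^n" for n
  proof -
    have sz': "cmod ((1/2)^k * E k x * cnj (E n x)) = (1/2)^k" for k x
      by (simp add: norm_mult norm_power E_unimodular)
    have int: "integrable M (\<lambda>x. (1/2)^k * E k x * cnj (E n x))" for k
      by (rule L2_product_integrable[OF L2_space_scale[OF E_L2] E_L2])
    have "L2_inner M h (E n) = (\<integral>x. (\<Sum>k. (1/2)^k * E k x * cnj (E n x)) \<partial>M)"
      unfolding L2_inner_def h_def
    proof (intro Bochner_Integration.integral_cong refl suminf_mult2)
      show "summable (\<lambda>k. (1 / 2) ^ k * E k x)" for x
        by (rule summable_norm_cancel) (simp only: sz sm)
    qed
    also have "\<dots> = (\<Sum>k. \<integral>x. (1/2)^k * E k x * cnj (E n x) \<partial>M)"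
    proof (rule integral_suminf[OF int])
      show "AE x in M. summable (\<lambda>k. norm ((1/2)^k * E k x * cnj (E n x)))"
        by (simp only: sz' sm) simp
      show "summable (\<lambda>k. \<integral>x. norm ((1/2)^k * E k x * cnj (E n x)) \<partial>M)"
        unfolding sz' using sm by (simp add: M.prob_space)
    qed
    also have "\<dots> = (\<Sum>k. (1/2)^k * L2_inner M (E k) (E n))"
      unfolding L2_inner_def by (simp add: mult.assoc)
    also have "\<dots> = (1/2)^n"
      unfolding E_orthonormal by (subst suminf_finite[of "{n}"]) auto
    finally show ?thesis .
  qed
  then show ?thesis using hL2 by (intro bexI[of _ h]) auto
qed

text \<open>On a line in the direction of h, each coefficient vanishes at one point only.\<close>

lemma countable_exceptions:
  assumes "v \<in> L2_space M" "h \<in> L2_space M" "\<And>n. L2_inner M h (E n) \<noteq> 0"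
  shows "countable {t. \<exists>n. L2_inner M (\<lambda>x. v x + t * h x) (E n) = 0}"
proof (rule countable_subset)
  show "{t. \<exists>n. L2_inner M (\<lambda>x. v x + t * h x) (E n) = 0}
      \<subseteq> range (\<lambda>n. - L2_inner M v (E n) / L2_inner M h (E n))"
  proof safe
    fix t n assume "L2_inner M (\<lambda>x. v x + t * h x) (E n) = 0"
    then have "L2_inner M v (E n) + t * L2_inner M h (E n) = 0"
      using L2_inner_add_left[OF assms(1) L2_space_scale[OF assms(2)] E_L2] by (simp add: L2_inner_scale_left)
    then have "t * L2_inner M h (E n) = - L2_inner M v (E n)"
      by (metis add.commute add_eq_0_iff)
    then have "t = - L2_inner M v (E n) / L2_inner M h (E n)" using assms(3)[of n] by (metis nonzero_mult_div_cancel_right)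
    then show "t \<in> range (\<lambda>n. - L2_inner M v (E n) / L2_inner M h (E n))" by blast
  qed
qed simp

theorem predictive: "predictive M S"
proof -
  obtain h where h: "h \<in> L2_space M" "\<And>n. L2_inner M h (E n) \<noteq> 0"
    using exists_observable_nonzero_coefficients by blast
  have "lin_indep_mod_null M 1 (\<lambda>i. h)"
    unfolding lin_indep_mod_null_def
  proof (intro allI impI)
    fix a :: "nat \<Rightarrow> complex" and i :: nat
    assume a: "AE x in M. (\<Sum>i<1. a i * h x) = 0" and i: "i < 1"
    have "a 0 * L2_inner M h (E 0) = L2_inner M (\<lambda>x. a 0 * h x) (E 0)" by (simp add: L2_inner_scale_left)
    also have "\<dots> = L2_inner M (\<lambda>x. 0) (E 0)"
      using a h E_meas by (intro L2_inner_cong_AE) (auto simp: lessThan_Suc intro: L2_space_measurable L2_space_scale)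
    also have "\<dots> = 0" by (simp add: L2_inner_def)
    finally show "a i = 0" using h i by simp
  qed
  moreover have "AE t in (\<Pi>\<^sub>M i\<in>{..<1::nat}. (lborel :: complex measure)).
      (\<lambda>x. v x + (\<Sum>i<1. t i * h x)) \<in> {g. predictive_observable M S g}" if v: "v \<in> L2_space M" for v
  proof -
    interpret product_sigma_finite "\<lambda>i::nat. (lborel :: complex measure)"
      by (simp add: product_sigma_finite_def sigma_finite_lborel)
    define C where "C = {t. \<exists>n. L2_inner M (\<lambda>x. v x + t * h x) (E n) = 0}"
    have "C \<in> null_sets lborel"
      unfolding C_def by (intro countable_imp_null_set_lborel countable_exceptions v h)
    then have C: "C \<in> sets lborel" "emeasure lborel C = 0" by auto
    have "(\<Pi>\<^sub>E i\<in>{..<1::nat}. C) \<in> null_sets (\<Pi>\<^sub>M i\<in>{..<1::nat}. (lborel :: complex measure))"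
      using C by (auto simp: null_sets_def emeasure_PiM)
    from AE_not_in[OF this] show ?thesis
    proof (rule AE_mp, intro AE_I2 impI)
      fix t assume t: "t \<in> space (\<Pi>\<^sub>M i\<in>{..<1::nat}. (lborel :: complex measure))"
        and nt: "t \<notin> (\<Pi>\<^sub>E i\<in>{..<1::nat}. C)"
      then have "t 0 \<notin> C" by (auto simp: space_PiM PiE_iff)
      then have "\<And>n. L2_inner M (\<lambda>x. v x + t 0 * h x) (E n) \<noteq> 0" by (auto simp: C_def)
      then show "(\<lambda>x. v x + (\<Sum>i<1. t i * h x)) \<in> {g. predictive_observable M S g}"
        by (auto simp: lessThan_Suc intro!: predictive_observableI L2_space_add L2_space_scale v h)
    qed
  qed
  ultimately have "prevalent M {g. predictive_observable M S g}"
    unfolding prevalent_def using h by (intro exI[of _ "1::nat"] exI[of _ "\<lambda>i. h"]) auto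
  moreover
  define G where "G = (\<Inter>n. {g \<in> L2_space M. L2_inner M g (E n) \<noteq> 0})"
  have "G \<subseteq> {g. predictive_observable M S g}"
    unfolding G_def by (auto intro!: predictive_observableI)
  moreover have "gdelta_in (L2_topology M) G"
    unfolding G_def
    by (intro gdelta_in_Inter) (auto intro!: open_imp_gdelta_in openin_L2_inner_nonzero E_L2)
  moreover have "L2_topology M closure_of G = L2_space M"
  proof (rule L2_closureI)
    show "G \<subseteq> L2_space M" by (auto simp: G_def)
    fix u and e :: real assume u: "u \<in> L2_space M" and e: "e > 0"
    have pos: "L2_norm M h + 1 > 0" by (rule add_nonneg_pos) auto
    define b where "b = e / (L2_norm M h + 1)"
    have b: "b > 0" using e pos by (simp add: b_def)
    let ?C = "{t. \<exists>n. L2_inner M (\<lambda>x. u x + t * h x) (E n) = 0}"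
    \<comment> \<open>The real parameters below b alone are uncountably many.\<close>
    have "\<not> complex_of_real ` {0<..<b} \<subseteq> ?C"
    proof
      assume "complex_of_real ` {0<..<b} \<subseteq> ?C"
      then have "countable (complex_of_real ` {0<..<b})"
        using countable_exceptions[OF u h] by (rule countable_subset)
      then have "countable {0<..<b}" by (rule countable_image_inj_on) (simp add: inj_on_def)
      then show False using b uncountable_open_interval by blast
    qed
    then obtain t where t: "t \<in> {0<..<b}" "of_real t \<notin> ?C" by blast
    have "(\<lambda>x. u x + of_real t * h x) \<in> G"
      using t(2) by (auto simp: G_def intro!: L2_space_add L2_space_scale u h)
    moreover have "L2_norm M (\<lambda>x. (u x + of_real t * h x) - u x) < e"
    proof -
      have "L2_norm M (\<lambda>x. (u x + of_real t * h x) - u x) = t * L2_norm M h"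
        using t by (simp add: L2_norm_scale)
      also have "\<dots> \<le> b * L2_norm M h" using t by (intro mult_right_mono) auto
      also have "\<dots> < b * (L2_norm M h + 1)" using b by simp
      also have "\<dots> = e" using pos by (simp add: b_def)
      finally show ?thesis .
    qed
    ultimately show "\<exists>g\<in>G. L2_norm M (\<lambda>x. g x - u x) < e"
      by (intro bexI[where x="\<lambda>x. u x + of_real t * h x"])
  qed
  ultimately show ?thesis unfolding predictive_def by blast
qed

end

section \<open>Rotations and trigonometric polynomials\<close>

lemma emeasure_lborel_translate:
  fixes c :: real
  assumes "A \<in> sets borel"
  shows "emeasure lborel ((\<lambda>t. c + t) -` A) = emeasure lborel A"
proof -
  have "emeasure lborel A = emeasure (distr lborel borel ((+) c)) A"
    by (simp add: lborel_distr_plus)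
  also have "\<dots> = emeasure lborel ((+) c -` A \<inter> space lborel)"
    using assms by (intro emeasure_distr) auto
  finally show ?thesis by simp
qed

text \<open>The rotation translates the two arcs on either side of the point that is sent to 0.\<close>

lemma distr_unif_rotation: "distr unif borel (\<lambda>t. frac (t + b)) = unif"
proof (rule measure_eqI)
  fix A assume "A \<in> sets (distr unif borel (\<lambda>t. frac (t + b)))"
  then have A [measurable]: "A \<in> sets borel" by simp
  define c where "c = frac b"
  have c: "0 \<le> c" "c < 1" by (auto simp: c_def frac_lt_1)
  define A1 where "A1 = A \<inter> {c<..<1}"
  define A2 where "A2 = A \<inter> {0<..<c}"
  define B1 where "B1 = (\<lambda>t. c + t) -` A1"
  define B2 where "B2 = (\<lambda>t. (c - 1) + t) -` A2"
  have [measurable]: "A1 \<in> sets borel" "A2 \<in> sets borel" by (auto simp: A1_def A2_def)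
  have [measurable]: "B1 \<in> sets borel" "B2 \<in> sets borel"
    using measurable_sets[of "(+) c" borel borel A1] measurable_sets[of "(+) (c - 1)" borel borel A2]
    by (simp_all add: B1_def B2_def)
  have frac_eq: "frac (t + b) = (if t < 1 - c then c + t else (c - 1) + t)" if "0 < t" "t < 1" for t
  proof -
    have "t + b = (t + c) + of_int \<lfloor>b\<rfloor>" by (simp add: c_def frac_def)
    also have "frac \<dots> = frac (t + c)" by (simp add: frac_def)
    also have "\<dots> = (if t < 1 - c then c + t else (c - 1) + t)"
    proof (cases "t < 1 - c")
      case True
      then show ?thesis using c that by (auto simp: frac_eq)
    next
      case False
      then have "\<lfloor>t + c\<rfloor> = 1" using c that by (intro floor_unique) auto
      then show ?thesis using False by (simp add: frac_def)
    qed
    finally show ?thesis .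
  qed
  have "emeasure (distr unif borel (\<lambda>t. frac (t + b))) A = emeasure unif {t. frac (t + b) \<in> A}"
    by (subst emeasure_distr) (auto intro!: arg_cong2[where f=emeasure])
  also have "\<dots> = emeasure lborel ({t. frac (t + b) \<in> A} \<inter> {0<..<1})"
    by (rule emeasure_unif) measurable
  also have "\<dots> = emeasure lborel (B1 \<union> B2)"
  proof (rule emeasure_eq_AE)
    show "AE t in lborel. (t \<in> {t. frac (t + b) \<in> A} \<inter> {0<..<1}) = (t \<in> B1 \<union> B2)"
      using AE_lborel_singleton[of 0] AE_lborel_singleton[of "1 - c"]
    proof eventually_elim
      case (elim t)
      show ?case
      proof (cases "0 < t \<and> t < 1")
        case True
        then show ?thesis using elim c by (auto simp: frac_eq B1_def B2_def A1_def A2_def)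
      next
        case False
        then show ?thesis using elim c by (auto simp: B1_def B2_def A1_def A2_def)
      qed
    qed
  qed measurable
  also have "\<dots> = emeasure lborel B1 + emeasure lborel B2"
    by (rule plus_emeasure[symmetric]) (auto simp: B1_def B2_def A1_def A2_def)
  also have "\<dots> = emeasure lborel A1 + emeasure lborel A2"
    unfolding B1_def B2_def by (simp add: emeasure_lborel_translate)
  also have "\<dots> = emeasure lborel (A1 \<union> A2)"
    by (rule plus_emeasure) (auto simp: A1_def A2_def)
  also have "\<dots> = emeasure lborel (A \<inter> {0<..<1})"
  proof (rule emeasure_eq_AE)
    show "AE t in lborel. (t \<in> A1 \<union> A2) = (t \<in> A \<inter> {0<..<1})"
      using AE_lborel_singleton[of c] by eventually_elim (use c in \<open>auto simp: A1_def A2_def\<close>)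
  qed measurable
  also have "\<dots> = emeasure unif A" by (rule emeasure_unif[symmetric]) (rule A)
  finally show "emeasure (distr unif borel (\<lambda>t. frac (t + b))) A = emeasure unif A" .
qed simp

lemma unif_eq_density: "unif = density lborel (\<lambda>x. ennreal (indicator {0<..<1} x))"
  unfolding unif_def uniform_measure_def
  by (intro arg_cong2[where f=density] refl ext) (simp add: divide_ennreal_def ennreal_indicator)

text \<open>The unit interval is cut into L equal pieces \<open>J l\<close>, each an affine image of the whole.\<close>

lemma integral_unif_pieces:
  fixes G :: "real \<Rightarrow> 'b::{banach, second_countable_topology}"
  assumes G: "integrable unif G" and L: "L > 0"
  shows "(\<integral>y. G y \<partial>unif) = (\<Sum>l<L. (1 / real L) *\<^sub>R (\<integral>t. G ((t + real l) / real L) \<partial>unif))"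
proof -
  have [measurable]: "G \<in> borel_measurable borel" using borel_measurable_integrable[OF G] by simp
  have int: "integral\<^sup>L unif g = (\<integral>x. indicator {0<..<1} x *\<^sub>R g x \<partial>lborel)"
    if "g \<in> borel_measurable borel" for g :: "real \<Rightarrow> 'b"
    unfolding unif_eq_density using that by (intro integral_density) auto
  have intG: "integrable lborel (\<lambda>x. indicator {0<..<1} x *\<^sub>R G x)"
    using G unfolding unif_eq_density by (subst (asm) integrable_density) auto
  define J where "J = (\<lambda>l::nat. {real l / real L<..<(real l + 1) / real L})"
  have [measurable]: "J l \<in> sets borel" for l by (simp add: J_def)
  have J01: "J l \<subseteq> {0<..<1}" if "l < L" for l
  proof -
    have "(real l + 1) / real L \<le> 1" using that by (simp add: divide_le_eq)
    moreover have "0 \<le> real l / real L" by simp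
    ultimately show ?thesis unfolding J_def greaterThanLessThan_subseteq_greaterThanLessThan by blast
  qed
  have intJ: "integrable lborel (\<lambda>x. indicator (J l) x *\<^sub>R G x)" if "l < L" for l
  proof (rule Bochner_Integration.integrable_bound[OF intG])
    show "AE x in lborel. norm (indicator (J l) x *\<^sub>R G x) \<le> norm (indicator {0<..<1} x *\<^sub>R G x)"
      using J01[OF that] by (intro AE_I2) (auto simp: indicator_def)
  qed measurable
  have "AE x in lborel. \<forall>l\<in>{..L}. x \<noteq> real l / real L"
    by (intro AE_finite_allI AE_lborel_singleton) auto
  then have "AE x in lborel. indicator {0<..<1} x *\<^sub>R G x = (\<Sum>l<L. indicator (J l) x *\<^sub>R G x)"
  proof eventually_elim
    case (elim x)
    show ?case
    proof (cases "0 < x \<and> x < 1")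
      case True
      define k where "k = nat \<lfloor>real L * x\<rfloor>"
      have kx: "real k \<le> real L * x" "real L * x < real k + 1"
        using True L by (auto simp: k_def)
      have kL: "k < L"
      proof -
        have "real k < real L" using kx True L by (smt (verit) mult_less_cancel_left2 of_nat_0_less_iff)
        then show ?thesis by simp
      qed
      have "x \<noteq> real k / real L" using elim kL by auto
      then have xJ: "x \<in> J k" using kx L by (auto simp: J_def field_simps)
      have "x \<notin> J l" if "l \<noteq> k" for l
      proof
        assume "x \<in> J l"
        then have "real l < real L * x" "real L * x < real l + 1" using L by (auto simp: J_def field_simps)
        then show False using kx that by linarith
      qed
      then have "indicator (J l) x *\<^sub>R G x = (if l = k then G x else 0)" for l
        using xJ by (auto simp: indicator_def)
      then show ?thesis using True kL by simp
    next
      case False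
      then have "x \<notin> J l" if "l < L" for l using J01[OF that] by auto
      then show ?thesis using False by simp
    qed
  qed
  then have "(\<integral>y. G y \<partial>unif) = (\<integral>x. (\<Sum>l<L. indicator (J l) x *\<^sub>R G x) \<partial>lborel)"
    by (subst int) (measurable, intro integral_cong_AE, measurable)
  also have "\<dots> = (\<Sum>l<L. \<integral>x. indicator (J l) x *\<^sub>R G x \<partial>lborel)"
    by (intro Bochner_Integration.integral_sum intJ) auto
  also have "\<dots> = (\<Sum>l<L. (1 / real L) *\<^sub>R (\<integral>t. G ((t + real l) / real L) \<partial>unif))"
  proof (rule sum.cong[OF refl])
    fix l assume "l \<in> {..<L}"
    have "(\<integral>x. indicator (J l) x *\<^sub>R G x \<partial>lborel)
        = (1 / real L) *\<^sub>R (\<integral>x. indicator (J l) (real l / real L + 1 / real L * x)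
            *\<^sub>R G (real l / real L + 1 / real L * x) \<partial>lborel)"
      using lborel_integral_real_affine[of "1 / real L" "\<lambda>x. indicator (J l) x *\<^sub>R G x" "real l / real L"] L
      by simp
    also have "(\<lambda>x. indicator (J l) (real l / real L + 1 / real L * x)
          *\<^sub>R G (real l / real L + 1 / real L * x)) = (\<lambda>x. indicator {0<..<1} x *\<^sub>R G ((x + real l) / real L))"
    proof
      fix x
      have "real l / real L + 1 / real L * x = (x + real l) / real L" by (simp add: add_divide_distrib)
      moreover have "(x + real l) / real L \<in> J l \<longleftrightarrow> x \<in> {0<..<1}"
        using L by (auto simp: J_def field_simps)
      ultimately show "indicator (J l) (real l / real L + 1 / real L * x)
          *\<^sub>R G (real l / real L + 1 / real L * x) = indicator {0<..<1} x *\<^sub>R G ((x + real l) / real L)"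
        by (simp add: indicator_def)
    qed
    finally show "(\<integral>x. indicator (J l) x *\<^sub>R G x \<partial>lborel)
        = (1 / real L) *\<^sub>R (\<integral>t. G ((t + real l) / real L) \<partial>unif)"
      by (subst int) auto
  qed
  finally show ?thesis .
qed

lemma L2_dominated_convergence:
  assumes f: "f \<in> borel_measurable M" and s: "\<And>i. s i \<in> borel_measurable M"
    and w: "integrable M (\<lambda>x. (w x)\<^sup>2)"
    and lim: "\<And>x. x \<in> space M \<Longrightarrow> (\<lambda>i. s i x) \<longlonglongrightarrow> f x"
    and bound: "\<And>i x. x \<in> space M \<Longrightarrow> cmod (f x - s i x) \<le> w x"
  shows "(\<lambda>i. L2_norm M (\<lambda>x. f x - s i x)) \<longlonglongrightarrow> 0"
proof -
  have "(\<lambda>i. \<integral>x. (cmod (f x - s i x))\<^sup>2 \<partial>M) \<longlonglongrightarrow> (\<integral>x. 0 \<partial>M)"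
  proof (rule integral_dominated_convergence[where w="\<lambda>x. (w x)\<^sup>2"])
    show "AE x in M. (\<lambda>i. (cmod (f x - s i x))\<^sup>2) \<longlonglongrightarrow> 0"
    proof (rule AE_I2)
      fix x assume "x \<in> space M"
      then have "(\<lambda>i. (cmod (f x - s i x))\<^sup>2) \<longlonglongrightarrow> (cmod (f x - f x))\<^sup>2"
        by (intro tendsto_intros lim)
      then show "(\<lambda>i. (cmod (f x - s i x))\<^sup>2) \<longlonglongrightarrow> 0" by simp
    qed
    show "AE x in M. norm ((cmod (f x - s i x))\<^sup>2) \<le> (w x)\<^sup>2" for i
      using bound by (intro AE_I2) (simp add: power_mono)
  qed (use f s w in measurable)
  then have "(\<lambda>i. sqrt (\<integral>x. (cmod (f x - s i x))\<^sup>2 \<partial>M)) \<longlonglongrightarrow> sqrt (\<integral>x. 0 \<partial>M)"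
    by (rule tendsto_real_sqrt)
  then show ?thesis by (simp add: L2_norm_def)
qed

inductive trig_poly :: "(real \<Rightarrow> complex) \<Rightarrow> bool" where
  monomial: "trig_poly (\<lambda>t. c * cis (2 * pi * real_of_int n * t))"
| add: "trig_poly p \<Longrightarrow> trig_poly q \<Longrightarrow> trig_poly (\<lambda>t. p t + q t)"

lemma trig_poly_const: "trig_poly (\<lambda>t. c)"
  using monomial[of c 0] by simp

lemma trig_poly_mult:
  assumes "trig_poly p" "trig_poly q"
  shows "trig_poly (\<lambda>t. p t * q t)"
  using assms
proof (induction p arbitrary: q rule: trig_poly.induct)
  case (monomial c n)
  then show ?case
  proof (induction q rule: trig_poly.induct)
    case (monomial c' n')
    have "(\<lambda>t. c * cis (2 * pi * real_of_int n * t) * (c' * cis (2 * pi * real_of_int n' * t)))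
        = (\<lambda>t. (c * c') * cis (2 * pi * real_of_int (n + n') * t))"
      by (simp add: fun_eq_iff cis_mult[symmetric] algebra_simps)
    then show ?case by (simp only: trig_poly.monomial)
  next
    case (add p q)
    then show ?case using trig_poly.add by (simp add: distrib_left)
  qed
next
  case (add p p')
  then show ?case using trig_poly.add[of "\<lambda>t. p t * q t" "\<lambda>t. p' t * q t"] by (simp add: distrib_right)
qed

lemma trig_poly_measurable: "trig_poly p \<Longrightarrow> p \<in> borel_measurable borel"
proof (induction rule: trig_poly.induct)
  case (monomial c n)
  show ?case by (intro borel_measurable_continuous_onI continuous_intros)
qed simp

lemma trig_poly_bounded: "trig_poly p \<Longrightarrow> \<exists>B. \<forall>t. cmod (p t) \<le> B"
proof (induction rule: trig_poly.induct)
  case (monomial c n)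
  show ?case by (intro exI[of _ "cmod c"]) (simp add: norm_mult)
next
  case (add p q)
  then obtain A B where "\<forall>t. cmod (p t) \<le> A" "\<forall>t. cmod (q t) \<le> B" by blast
  then have "cmod (p t + q t) \<le> A + B" for t
    using norm_triangle_ineq[of "p t" "q t"] by (smt (verit))
  then show ?case by blast
qed

lemma trig_poly_L2:
  assumes "trig_poly p"
  shows "p \<in> L2_space unif"
proof -
  obtain B where "\<forall>t. cmod (p t) \<le> B" using trig_poly_bounded[OF assms] by blast
  moreover have "p \<in> borel_measurable unif" using trig_poly_measurable[OF assms] by simp
  ultimately show ?thesis
    by (intro L2_space_bounded[where B=B]) (simp_all add: unif.finite_measure_axioms)
qed

text \<open>On the unit circle Re z and Im z are the combinations \<open>(z + cnj z) / 2\<close> and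
  \<open>(z - cnj z) / (2 \<i>)\<close> of characters, so polynomials in them are trigonometric polynomials. This
  makes the Stone-Weierstrass theorem for real polynomial functions applicable.\<close>

lemma trig_poly_real_polynomial:
  fixes g :: "complex \<Rightarrow> real"
  assumes "real_polynomial_function g"
  shows "trig_poly (\<lambda>t. of_real (g (cis (2 * pi * t))))"
  using assms
proof (induction rule: real_polynomial_function.induct)
  case (linear g)
  interpret bounded_linear g by fact
  have g_real: "g z = g 1 * Re z + g \<i> * Im z" for z
  proof -
    have "g z = g (Re z *\<^sub>R 1 + Im z *\<^sub>R \<i>)"
      by (intro arg_cong[where f=g]) (simp add: complex_eq_iff)
    also have "\<dots> = g 1 * Re z + g \<i> * Im z" by (simp only: add scaleR real_scaleR_def mult.commute)
    finally show ?thesis .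
  qed
  have g_Re_Im: "complex_of_real (g z) = of_real (g 1) * of_real (Re z) + of_real (g \<i>) * of_real (Im z)" for z
    by (subst g_real) (simp only: of_real_add of_real_mult)
  have ReIm: "complex_of_real (Re z) = (z + cnj z) / 2" "complex_of_real (Im z) = (z - cnj z) / (2 * \<i>)" for z
    by (simp_all add: complex_eq_iff)
  have regroup: "a * ((z + w) / 2) + b * ((z - w) / (2 * \<i>))
      = (a / 2 + b / (2 * \<i>)) * z + (a / 2 - b / (2 * \<i>)) * w" for a b z w :: complex
    by (simp add: add_divide_distrib diff_divide_distrib ring_distribs mult_ac)
  have g: "complex_of_real (g z) = (of_real (g 1) / 2 + of_real (g \<i>) / (2 * \<i>)) * z
      + (of_real (g 1) / 2 - of_real (g \<i>) / (2 * \<i>)) * cnj z" for z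
    by (subst g_Re_Im) (simp only: ReIm regroup)
  have "trig_poly (\<lambda>t. (of_real (g 1) / 2 + of_real (g \<i>) / (2 * \<i>)) * cis (2 * pi * real_of_int 1 * t)
          + (of_real (g 1) / 2 - of_real (g \<i>) / (2 * \<i>)) * cis (2 * pi * real_of_int (- 1) * t))"
    by (intro trig_poly.intros)
  moreover have "complex_of_real (g (cis (2 * pi * t)))
      = (of_real (g 1) / 2 + of_real (g \<i>) / (2 * \<i>)) * cis (2 * pi * real_of_int 1 * t)
        + (of_real (g 1) / 2 - of_real (g \<i>) / (2 * \<i>)) * cis (2 * pi * real_of_int (- 1) * t)" for t
    by (subst g) (simp add: cis_cnj)
  ultimately show ?case by (simp only:)
next
  case (const c)
  show ?case by (rule trig_poly_const)
next
  case (add f g)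
  show ?case using trig_poly.add[OF add.IH] by simp
next
  case (mult f g)
  show ?case using trig_poly_mult[OF mult.IH] by simp
qed

definition trig_approximable :: "(real \<Rightarrow> complex) \<Rightarrow> bool" where
  "trig_approximable h \<longleftrightarrow> h \<in> L2_space unif \<and>
     (\<forall>\<delta>>0. \<exists>p. trig_poly p \<and> L2_norm unif (\<lambda>t. h t - p t) < \<delta>)"

lemma trig_approximable_limit:
  assumes h: "h \<in> L2_space unif" and s: "\<And>i. trig_approximable (s i)"
    and lim: "(\<lambda>i. L2_norm unif (\<lambda>t. h t - s i t)) \<longlonglongrightarrow> 0"
  shows "trig_approximable h"
  unfolding trig_approximable_def
proof (intro conjI h allI impI)
  fix \<delta> :: real assume "\<delta> > 0"
  then have "\<delta> / 2 > 0" by simp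
  from order_tendstoD(2)[OF lim this] obtain i where i: "L2_norm unif (\<lambda>t. h t - s i t) < \<delta> / 2"
    by (meson eventually_happens sequentially_bot)
  obtain p where p: "trig_poly p" "L2_norm unif (\<lambda>t. s i t - p t) < \<delta> / 2"
    using s[of i] \<open>\<delta> / 2 > 0\<close> unfolding trig_approximable_def by blast
  have "L2_norm unif (\<lambda>t. h t - p t) < \<delta>"
    using L2_norm_triangle_dist[OF h _ trig_poly_L2[OF p(1)], of "s i"] s[of i] i p(2)
    by (simp add: trig_approximable_def)
  then show "\<exists>p. trig_poly p \<and> L2_norm unif (\<lambda>t. h t - p t) < \<delta>" using p by blast
qed

lemma trig_approximable_add:
  assumes "trig_approximable f" "trig_approximable g"
  shows "trig_approximable (\<lambda>t. f t + g t)"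
  unfolding trig_approximable_def
proof (intro conjI allI impI)
  show "(\<lambda>t. f t + g t) \<in> L2_space unif"
    using assms by (simp add: trig_approximable_def L2_space_add)
  fix \<delta> :: real assume "\<delta> > 0"
  then have "\<delta> / 2 > 0" by simp
  then obtain p q where p: "trig_poly p" "L2_norm unif (\<lambda>t. f t - p t) < \<delta> / 2"
    and q: "trig_poly q" "L2_norm unif (\<lambda>t. g t - q t) < \<delta> / 2"
    using assms unfolding trig_approximable_def by blast
  have "L2_norm unif (\<lambda>t. (f t - p t) + (g t - q t)) < \<delta>"
    using L2_norm_triangle[OF L2_space_diff L2_space_diff, of f unif p g q] assms p q
    by (simp add: trig_approximable_def trig_poly_L2)
  then show "\<exists>p. trig_poly p \<and> L2_norm unif (\<lambda>t. (f t + g t) - p t) < \<delta>"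
    using trig_poly.add[OF p(1) q(1)] by (intro exI[of _ "\<lambda>t. p t + q t"]) (simp add: algebra_simps)
qed

lemma trig_approximable_scale:
  assumes "trig_approximable f"
  shows "trig_approximable (\<lambda>t. c * f t)"
  unfolding trig_approximable_def
proof (intro conjI allI impI)
  show "(\<lambda>t. c * f t) \<in> L2_space unif"
    using assms by (simp add: trig_approximable_def L2_space_scale)
  fix \<delta> :: real assume "\<delta> > 0"
  have pos: "cmod c + 1 > 0" by (rule add_nonneg_pos) auto
  then have "\<delta> / (cmod c + 1) > 0" using \<open>\<delta> > 0\<close> by simp
  then obtain p where p: "trig_poly p" "L2_norm unif (\<lambda>t. f t - p t) < \<delta> / (cmod c + 1)"
    using assms unfolding trig_approximable_def by blast
  have "L2_norm unif (\<lambda>t. c * f t - c * p t) = cmod c * L2_norm unif (\<lambda>t. f t - p t)"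
    by (simp add: L2_norm_scale[symmetric] right_diff_distrib)
  also have "\<dots> \<le> cmod c * (\<delta> / (cmod c + 1))" using p by (intro mult_left_mono) auto
  also have "\<dots> < \<delta>" using pos \<open>\<delta> > 0\<close> by (simp add: field_simps)
  finally show "\<exists>p. trig_poly p \<and> L2_norm unif (\<lambda>t. c * f t - p t) < \<delta>"
    using trig_poly_mult[OF trig_poly_const p(1)] by (intro exI[of _ "\<lambda>t. c * p t"]) auto
qed

lemma trig_approximable_trig_poly: "trig_poly p \<Longrightarrow> trig_approximable p"
  unfolding trig_approximable_def using trig_poly_L2 by (auto intro!: exI[of _ p])

lemma trig_approximable_sum:
  "(\<And>i. i \<in> I \<Longrightarrow> trig_approximable (f i)) \<Longrightarrow> trig_approximable (\<lambda>t. \<Sum>i\<in>I. f i t)"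
  by (induction I rule: infinite_finite_induct)
    (auto intro: trig_approximable_add trig_approximable_trig_poly trig_poly_const)

lemma trig_approximable_continuous:
  fixes g :: "complex \<Rightarrow> real"
  assumes g: "continuous_on UNIV g"
  shows "trig_approximable (\<lambda>t. of_real (g (cis (2 * pi * t))))"
  unfolding trig_approximable_def
proof (intro conjI allI impI)
  let ?h = "\<lambda>t. complex_of_real (g (cis (2 * pi * t)))"
  have "continuous_on UNIV ?h"
    by (intro continuous_intros continuous_on_compose2[OF g]) auto
  then have "?h \<in> borel_measurable borel" by (rule borel_measurable_continuous_onI)
  then have m: "?h \<in> borel_measurable unif" by simp
  have cs: "compact (sphere (0::complex) 1)" by simp
  have "compact (g ` sphere 0 1)"
    using continuous_on_subset[OF g] cs by (intro compact_continuous_image) auto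
  then obtain B where "\<forall>y\<in>g ` sphere 0 1. norm y \<le> B"
    using compact_imp_bounded bounded_iff by metis
  then show hL2: "?h \<in> L2_space unif"
    by (intro L2_space_bounded[where B=B] m) (auto simp: unif.finite_measure_axioms)
  fix \<delta> :: real assume "\<delta> > 0"
  then have d: "\<delta> / 2 > 0" by simp
  obtain q where q: "polynomial_function q" "\<And>z. z \<in> sphere 0 1 \<Longrightarrow> norm (g z - q z) < \<delta> / 2"
    using Stone_Weierstrass_polynomial_function[OF cs continuous_on_subset[OF g] d] by blast
  let ?p = "\<lambda>t. complex_of_real (q (cis (2 * pi * t)))"
  have p: "trig_poly ?p"
    by (rule trig_poly_real_polynomial) (use q in \<open>simp add: real_polynomial_function_eq\<close>)
  have "L2_norm unif (\<lambda>t. ?h t - ?p t) \<le> \<delta> / 2"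
  proof (rule L2_norm_bounded)
    show "(\<lambda>t. ?h t - ?p t) \<in> borel_measurable unif"
      using m trig_poly_measurable[OF p] by simp
    have "cmod (?h t - ?p t) \<le> \<delta> / 2" for t
      using q(2)[of "cis (2 * pi * t)"] by (simp flip: of_real_diff)
    then show "AE t in unif. cmod (?h t - ?p t) \<le> \<delta> / 2" by simp
  qed (use prob_space_unif d in auto)
  then have "L2_norm unif (\<lambda>t. ?h t - ?p t) < \<delta>" using \<open>\<delta> > 0\<close> by simp
  then show "\<exists>p. trig_poly p \<and> L2_norm unif (\<lambda>t. ?h t - p t) < \<delta>" using p by blast
qed

text \<open>The indicator of C is the decreasing limit of the continuous functions
  \<open>max 0 (1 - i dist(z, C))\<close>.\<close>

lemma trig_approximable_closed:
  fixes C :: "complex set"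
  assumes C: "closed C" "C \<noteq> {}"
  shows "trig_approximable (\<lambda>t. indicator C (cis (2 * pi * t)))"
proof -
  define g where "g = (\<lambda>(i::nat) z. max 0 (1 - real i * infdist z C))"
  have gcont: "continuous_on UNIV (g i)" for i
    unfolding g_def by (intro continuous_intros)
  have g01: "0 \<le> g i z" "g i z \<le> 1" for i z
    by (auto simp: g_def infdist_nonneg)
  have glim: "(\<lambda>i. g i z) \<longlonglongrightarrow> indicator C z" for z
  proof (cases "z \<in> C")
    case True
    then show ?thesis by (simp add: g_def)
  next
    case False
    then have pos: "infdist z C > 0"
      using C in_closed_iff_infdist_zero infdist_nonneg[of z C] by (metis less_eq_real_def)
    obtain i0 :: nat where i0: "1 / infdist z C < real i0" using reals_Archimedean2 by blast
    have "g i z = 0" if "i \<ge> i0" for i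
    proof -
      have "1 / infdist z C < real i" using i0 that by (meson le_less_trans less_le_trans of_nat_mono order.strict_implies_order order_le_less_trans)
      then have "1 < real i * infdist z C" using pos by (simp add: field_simps)
      then show ?thesis by (simp add: g_def)
    qed
    then have "eventually (\<lambda>i. g i z = 0) sequentially" by (auto simp: eventually_sequentially)
    then show ?thesis using False by (simp add: tendsto_eventually)
  qed
  have im: "(\<lambda>t. indicator C (cis (2 * pi * t)) :: complex) \<in> borel_measurable unif"
  proof -
    have "(\<lambda>t::real. cis (2 * pi * t)) \<in> borel_measurable borel"
      by (intro borel_measurable_continuous_onI continuous_intros)
    then have "(\<lambda>t::real. cis (2 * pi * t)) \<in> borel_measurable unif" by simp
    then show ?thesis
      by (rule measurable_compose) (use C in \<open>auto intro: borel_closed\<close>)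
  qed
  have ind: "complex_of_real (indicator C z) = indicator C z" for z by (simp add: indicator_def)
  have si: "trig_approximable (\<lambda>t. of_real (g i (cis (2 * pi * t))))" for i
    by (rule trig_approximable_continuous[OF gcont])
  show ?thesis
  proof (rule trig_approximable_limit[OF _ si])
    show "(\<lambda>t. indicator C (cis (2 * pi * t))) \<in> L2_space unif"
      by (intro L2_space_bounded[where B=1] im) (auto simp: unif.finite_measure_axioms indicator_def)
    show "(\<lambda>i. L2_norm unif (\<lambda>t. indicator C (cis (2 * pi * t)) - of_real (g i (cis (2 * pi * t))))) \<longlonglongrightarrow> 0"
    proof (rule L2_dominated_convergence[where w="\<lambda>_. 1"])
      fix t
      have "(\<lambda>i. complex_of_real (g i (cis (2 * pi * t)))) \<longlonglongrightarrow> of_real (indicator C (cis (2 * pi * t)))"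
        by (intro tendsto_of_real glim)
      then show "(\<lambda>i. complex_of_real (g i (cis (2 * pi * t)))) \<longlonglongrightarrow> indicator C (cis (2 * pi * t))"
        by (simp only: ind)
      fix i
      have "cmod (of_real (indicator C (cis (2 * pi * t)) - g i (cis (2 * pi * t)))) \<le> 1"
        using g01[of i "cis (2 * pi * t)"] unfolding norm_of_real by (auto simp: indicator_def)
      then show "cmod (indicator C (cis (2 * pi * t)) - of_real (g i (cis (2 * pi * t)))) \<le> 1"
        by (simp only: of_real_diff ind)
    next
      show "(\<lambda>t. complex_of_real (g i (cis (2 * pi * t)))) \<in> borel_measurable unif" for i
        using si by (simp add: trig_approximable_def L2_space_measurable)
    qed (use im in auto)
  qed
qed

lemma cis_2pi_inj:
  assumes "0 \<le> s" "s < 1" "0 \<le> t" "t < 1" "cis (2 * pi * s) = cis (2 * pi * t)"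
  shows "s = t"
proof -
  have "cis (2 * pi * s - 2 * pi * t) = 1"
    using assms(5) by (simp add: cis_divide[symmetric])
  then have "cos (2 * pi * (s - t)) = 1" by (simp add: complex_eq_iff right_diff_distrib)
  then obtain n :: int where "2 * pi * (s - t) = of_int n * 2 * pi"
    unfolding cos_one_2pi_int by blast
  then have "s - t = of_int n" by simp
  then have "n = 0" using assms by linarith
  then show ?thesis using \<open>s - t = of_int n\<close> by simp
qed

lemma trig_approximable_AE_cong:
  assumes "trig_approximable f" "AE t in unif. f t = g t" "g \<in> borel_measurable borel"
  shows "trig_approximable g"
proof -
  have f: "f \<in> L2_space unif" using assms by (simp add: trig_approximable_def)
  have gm: "g \<in> borel_measurable unif" using assms(3) by simp
  have ae: "AE t in unif. g t = f t" using assms(2) by eventually_elim simp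
  have g: "g \<in> L2_space unif"
    by (rule L2_space_cong_AE[OF ae gm f])
  have "L2_norm unif (\<lambda>t. g t - f t) = L2_norm unif (\<lambda>t. 0)"
    using ae by (intro L2_norm_cong_AE) (use gm L2_space_measurable[OF f] in auto)
  then show ?thesis
    using assms(1) by (intro trig_approximable_limit[OF g, of "\<lambda>_. f"]) auto
qed

lemma indicator_L2_unif:
  assumes "A \<in> sets borel"
  shows "(\<lambda>t. indicator A t) \<in> L2_space unif"
proof (rule L2_space_bounded[where B=1])
  show "(\<lambda>t. indicator A t :: complex) \<in> borel_measurable unif" using assms by simp
qed (auto simp: unif.finite_measure_axioms indicator_def)

text \<open>Approximable sets are closed under complements and countable disjoint unions, and they contain
  the intervals \<open>{..a}\<close>: within the unit interval such a set is empty, everything, or the preimage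
  of a closed arc.\<close>

lemma trig_approximable_indicator:
  assumes "A \<in> sets borel"
  shows "trig_approximable (\<lambda>t. indicator A t)"
proof -
  have "Int_stable (range (\<lambda>a::real. {..a}))"
    by (auto simp: Int_stable_def)
  moreover have "range (\<lambda>a::real. {..a}) \<subseteq> Pow UNIV" by simp
  moreover have "A \<in> sigma_sets UNIV (range (\<lambda>a::real. {..a}))"
    using assms unfolding borel_eq_atMost by (simp add: sets_measure_of)
  ultimately show ?thesis
  proof (induction rule: sigma_sets_induct_disjoint)
    case (basic A)
    then obtain a where A: "A = {..a}" by blast
    consider "a < 0" | "0 \<le> a" "a < 1" | "1 \<le> a" by linarith
    then show ?case
    proof cases
      case 1
      have "trig_approximable (\<lambda>t. 0)" by (intro trig_approximable_trig_poly trig_poly_const)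
      then show ?thesis
        by (rule trig_approximable_AE_cong)
          (use AE_unif_bounds in \<open>eventually_elim, use 1 in \<open>simp add: A\<close>\<close>, simp add: A)
    next
      case 2
      define C where "C = (\<lambda>t. cis (2 * pi * t)) ` {0..a}"
      have "compact C" unfolding C_def
        by (intro compact_continuous_image continuous_intros) simp
      then have "closed C" by (rule compact_imp_closed)
      moreover have "C \<noteq> {}" using 2 by (auto simp: C_def)
      ultimately have "trig_approximable (\<lambda>t. indicator C (cis (2 * pi * t)))"
        by (rule trig_approximable_closed)
      moreover have "AE t in unif. (indicator C (cis (2 * pi * t)) :: complex) = indicator A t"
        using AE_unif_bounds
      proof eventually_elim
        case (elim t)
        have "cis (2 * pi * t) \<in> C \<longleftrightarrow> t \<le> a"
        proof
          assume "cis (2 * pi * t) \<in> C"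
          then obtain s where s: "0 \<le> s" "s \<le> a" "cis (2 * pi * t) = cis (2 * pi * s)"
            by (auto simp: C_def)
          have "t = s" by (rule cis_2pi_inj) (use s elim 2 in auto)
          then show "t \<le> a" using s by simp
        qed (use elim in \<open>auto simp: C_def\<close>)
        then show ?case by (simp add: indicator_def A)
      qed
      ultimately show ?thesis by (rule trig_approximable_AE_cong) (simp add: A)
    next
      case 3
      have "trig_approximable (\<lambda>t. 1)" by (intro trig_approximable_trig_poly trig_poly_const)
      then show ?thesis
        by (rule trig_approximable_AE_cong)
          (use AE_unif_bounds in \<open>eventually_elim, use 3 in \<open>simp add: A\<close>\<close>, simp add: A)
    qed
  next
    case empty
    show ?case by (simp add: trig_approximable_trig_poly trig_poly_const)
  next
    case (compl A)
    have "(\<lambda>t. indicator (UNIV - A) t :: complex) = (\<lambda>t. 1 + (- 1) * indicator A t)"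
      by (auto simp: indicator_def)
    then show ?case
      using trig_approximable_add[OF trig_approximable_trig_poly[OF trig_poly_const[of 1]]
          trig_approximable_scale[OF compl.IH, of "- 1"]] by simp
  next
    case (union A)
    have A: "A i \<in> sets borel" for i
    proof -
      have "A i \<in> sigma_sets UNIV (range (\<lambda>a::real. {..a}))" using union.hyps(2) by blast
      then show ?thesis unfolding borel_eq_atMost by (simp add: sets_measure_of)
    qed
    have UA: "(\<Union>i. A i) \<in> sets borel" using A by blast
    define s where "s = (\<lambda>n t. \<Sum>i<n. indicator (A i) t :: complex)"
    have s: "trig_approximable (s n)" for n
      unfolding s_def by (intro trig_approximable_sum union.IH)
    have s_eq: "s n t = indicator (\<Union>i<n. A i) t" for n t
    proof -
      have "disjoint_family_on A {..<n}" using union.hyps(1) by (auto simp: disjoint_family_on_def)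
      then show ?thesis unfolding s_def by (simp add: indicator_UN_disjoint)
    qed
    show ?case
    proof (rule trig_approximable_limit[OF indicator_L2_unif[OF UA] s])
      show "(\<lambda>n. L2_norm unif (\<lambda>t. indicator (\<Union>i. A i) t - s n t)) \<longlonglongrightarrow> 0"
      proof (rule L2_dominated_convergence[where w="\<lambda>_. 1"])
        fix t
        show "(\<lambda>n. s n t) \<longlonglongrightarrow> indicator (\<Union>i. A i) t"
          unfolding s_eq by (rule LIMSEQ_indicator_UN)
        show "cmod (indicator (\<Union>i. A i) t - s n t) \<le> 1" for n
          unfolding s_eq by (auto simp: indicator_def)
      next
        show "s n \<in> borel_measurable unif" for n
          using s[of n] by (simp add: trig_approximable_def L2_space_measurable)
      qed (use UA in auto)
    qed
  qed
qed

theorem trig_polys_dense: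
  assumes h: "h \<in> L2_space unif"
  shows "trig_approximable h"
proof -
  have hm: "h \<in> borel_measurable unif" by (rule L2_space_measurable[OF h])
  obtain F where F: "\<And>i. simple_function unif (F i)"
    "\<And>x. (\<lambda>i. F i x) \<longlonglongrightarrow> h x" "\<And>i x. dist (F i x) 0 \<le> 2 * dist (h x) 0"
    using borel_measurable_implies_sequence_metric[OF hm, of 0] by auto
  have "trig_approximable (F i)" for i
  proof -
    have fin: "finite (range (F i))" using F(1)[of i] by (simp add: simple_function_def)
    have ms: "F i -` {y} \<in> sets borel" for y
      using simple_functionD(2)[OF F(1)[of i], of "{y}"] by simp
    have "F i = (\<lambda>t. \<Sum>y\<in>range (F i). y * indicator (F i -` {y}) t)"
    proof
      fix t
      have "(\<Sum>y\<in>range (F i). y * indicator (F i -` {y}) t) = (\<Sum>y\<in>range (F i). if y = F i t then y else 0)"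
        by (intro sum.cong) (auto simp: indicator_def)
      then show "F i t = (\<Sum>y\<in>range (F i). y * indicator (F i -` {y}) t)" using fin by simp
    qed
    moreover have "trig_approximable (\<lambda>t. \<Sum>y\<in>range (F i). y * indicator (F i -` {y}) t)"
      by (intro trig_approximable_sum trig_approximable_scale trig_approximable_indicator ms)
    ultimately show ?thesis by simp
  qed
  moreover have "(\<lambda>i. L2_norm unif (\<lambda>t. h t - F i t)) \<longlonglongrightarrow> 0"
  proof (rule L2_dominated_convergence[where w="\<lambda>t. 3 * cmod (h t)"])
    show "integrable unif (\<lambda>x. (3 * cmod (h x))\<^sup>2)"
      using L2_space_integrable[OF h] by (simp add: power_mult_distrib)
    show "cmod (h x - F i x) \<le> 3 * cmod (h x)" for i x
      using norm_triangle_ineq4[of "h x" "F i x"] F(3)[of i x] by simp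
    show "F i \<in> borel_measurable unif" for i
      using F(1)[of i] by (rule borel_measurable_simple_function)
  qed (use hm F(2) in auto)
  ultimately show ?thesis using trig_approximable_limit[OF h] by blast
qed

text \<open>The integer frequencies are enumerated, since eigenfunctions are indexed by natural
  numbers.\<close>

definition character :: "nat \<Rightarrow> real \<Rightarrow> complex" where
  "character k t = cis (2 * pi * real_of_int (int_decode k) * t)"

lemma trig_poly_characters:
  "trig_poly p \<Longrightarrow> \<exists>n a. p = (\<lambda>t. \<Sum>k<n. a k * character k t)"
proof (induction rule: trig_poly.induct)
  case (monomial c n)
  have "(\<lambda>t. c * cis (2 * pi * real_of_int n * t))
      = (\<lambda>t. \<Sum>k<Suc (int_encode n). (if k = int_encode n then c else 0) * character k t)"
    by (simp add: character_def if_distrib[of "\<lambda>x. x * _"] cong: if_cong)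
  then show ?case
    by (intro exI[of _ "Suc (int_encode n)"] exI[of _ "\<lambda>k. if k = int_encode n then c else 0"])
next
  case (add p q)
  then obtain n a m b where p: "p = (\<lambda>t. \<Sum>k<n. a k * character k t)"
    and q: "q = (\<lambda>t. \<Sum>k<m. b k * character k t)" by blast
  have pad: "(\<Sum>k<n. a k * character k t) = (\<Sum>k<max n m. (if k < n then a k else 0) * character k t)"
    for n m a t
    by (rule sum.mono_neutral_cong_left) auto
  have "(\<lambda>t. p t + q t) = (\<lambda>t. \<Sum>k<max n m. ((if k < n then a k else 0) + (if k < m then b k else 0)) * character k t)"
    unfolding p q using pad[where n=n and m=m and a=a] pad[where n=m and m=n and a=b]
    by (simp add: distrib_right sum.distrib max.commute)
  then show ?case
    by (intro exI[of _ "max n m"] exI[of _ "\<lambda>k. (if k < n then a k else 0) + (if k < m then b k else 0)"])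
qed

section \<open>Least squares and the filter\<close>

lemma L2_inner_zero_norm:
  assumes "f \<in> L2_space M" "g \<in> L2_space M" "L2_norm M g = 0"
  shows "L2_inner M f g = 0"
  using L2_Cauchy_Schwarz[OF assms(1,2)] assms(3) by simp

lemma L2_inner_add_right:
  assumes "f \<in> L2_space M" "g \<in> L2_space M" "h \<in> L2_space M"
  shows "L2_inner M h (\<lambda>x. f x + g x) = L2_inner M h f + L2_inner M h g"
  using L2_inner_add_left[OF assms] by (metis L2_inner_cnj complex_cnj_add)

text \<open>Orthogonal projection to a finite-dimensional span, one Gram-Schmidt step at a time: a new
  vector \<open>v i\<close> is replaced by its residual w against the previous ones. If w has norm 0 there is
  nothing to add.\<close>

lemma L2_projection:
  assumes "finite I" "\<And>i. i \<in> I \<Longrightarrow> v i \<in> L2_space M" "u \<in> L2_space M"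
  shows "\<exists>c. \<forall>k\<in>I. L2_inner M (\<lambda>x. u x - (\<Sum>j\<in>I. c j * v j x)) (v k) = 0"
  using assms
proof (induction I arbitrary: u rule: finite_induct)
  case (insert i I)
  have v: "v k \<in> L2_space M" if "k \<in> insert i I" for k using insert.prems that by blast
  have span: "(\<lambda>x. \<Sum>j\<in>I. c j * v j x) \<in> L2_space M" for c
    using v by (intro L2_space_sum L2_space_scale) auto
  obtain a where a: "\<forall>k\<in>I. L2_inner M (\<lambda>x. v i x - (\<Sum>j\<in>I. a j * v j x)) (v k) = 0"
    using insert.IH[of "v i"] v by auto
  obtain b where b: "\<forall>k\<in>I. L2_inner M (\<lambda>x. u x - (\<Sum>j\<in>I. b j * v j x)) (v k) = 0"
    using insert.IH[of u] insert.prems v by auto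
  define w where "w = (\<lambda>x. v i x - (\<Sum>j\<in>I. a j * v j x))"
  define r where "r = (\<lambda>x. u x - (\<Sum>j\<in>I. b j * v j x))"
  have wL2: "w \<in> L2_space M" unfolding w_def by (intro L2_space_diff span v) simp
  have rL2: "r \<in> L2_space M" unfolding r_def by (intro L2_space_diff span insert.prems)
  define t where "t = L2_inner M r w / L2_inner M w w"
  have tww: "t * L2_inner M w w = L2_inner M r w"
  proof (cases "L2_inner M w w = 0")
    case True
    then have "L2_norm M w = 0" by (simp add: L2_inner_self)
    then show ?thesis using L2_inner_zero_norm[OF rL2 wL2] True by simp
  qed (simp add: t_def)
  define c where "c = (\<lambda>j. if j = i then t else b j - t * a j)"
  have c_eq: "(\<lambda>x. u x - (\<Sum>j\<in>insert i I. c j * v j x)) = (\<lambda>x. r x - t * w x)"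
  proof
    fix x
    have "(\<Sum>j\<in>I. c j * v j x) = (\<Sum>j\<in>I. (b j - t * a j) * v j x)"
      using insert.hyps by (intro sum.cong) (auto simp: c_def)
    also have "\<dots> = (\<Sum>j\<in>I. b j * v j x) - t * (\<Sum>j\<in>I. a j * v j x)"
      by (simp add: left_diff_distrib sum_subtractf sum_distrib_left mult.assoc)
    finally show "u x - (\<Sum>j\<in>insert i I. c j * v j x) = r x - t * w x"
      using insert.hyps by (simp add: r_def w_def c_def right_diff_distrib)
  qed
  have orthI: "L2_inner M (\<lambda>x. r x - t * w x) (v k) = 0" if "k \<in> I" for k
    using a b that v by (simp add: L2_inner_diff_left[OF rL2 L2_space_scale[OF wL2]] L2_inner_scale_left)
      (simp add: w_def r_def)
  have orthw: "L2_inner M (\<lambda>x. r x - t * w x) w = 0"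
    by (simp add: L2_inner_diff_left[OF rL2 L2_space_scale[OF wL2] wL2] L2_inner_scale_left tww)
  have rtw: "(\<lambda>x. r x - t * w x) \<in> L2_space M" by (intro L2_space_diff L2_space_scale rL2 wL2)
  have "L2_inner M (\<lambda>x. r x - t * w x) (v i)
      = L2_inner M (\<lambda>x. r x - t * w x) (\<lambda>x. w x + (\<Sum>j\<in>I. a j * v j x))"
    by (simp add: w_def)
  also have "\<dots> = L2_inner M (\<lambda>x. r x - t * w x) (\<lambda>x. \<Sum>j\<in>I. a j * v j x)"
    by (simp add: L2_inner_add_right[OF wL2 span rtw] orthw)
  also have "\<dots> = 0"
    using v by (subst L2_inner_sum_right[OF _ rtw]) (auto simp: orthI)
  finally have "L2_inner M (\<lambda>x. r x - t * w x) (v i) = 0" .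
  then have "\<forall>k\<in>insert i I. L2_inner M (\<lambda>x. r x - t * w x) (v k) = 0" using orthI by blast
  then show ?case unfolding c_eq[symmetric] by blast
qed simp

lemma L2_norm_zero_AE:
  assumes "f \<in> L2_space M" "L2_norm M f = 0"
  shows "AE x in M. f x = 0"
proof -
  have "(\<integral>x. (cmod (f x))\<^sup>2 \<partial>M) = 0" using assms(2) by (simp add: L2_norm_def)
  then have "AE x in M. (cmod (f x))\<^sup>2 = 0"
    using L2_space_integrable[OF assms(1)] by (subst (asm) integral_nonneg_eq_0_iff_AE) auto
  then show ?thesis by simp
qed

text \<open>The coefficient of \<open>v k\<close> is controlled by the inner product with the residual w of \<open>v k\<close>
  against all other vectors, and w is nonzero by linear independence.\<close>

lemma lin_indep_lower_bound:
  assumes v: "\<And>i. i < d \<Longrightarrow> v i \<in> L2_space M" and indep: "lin_indep_mod_null M d v"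
  shows "\<exists>\<kappa>>0. \<forall>c. \<kappa> * (\<Sum>k<d. (cmod (c k))\<^sup>2) \<le> (L2_norm M (\<lambda>x. \<Sum>j<d. c j * v j x))\<^sup>2"
proof -
  have "\<exists>B>0. \<forall>c. (cmod (c k))\<^sup>2 \<le> B * (L2_norm M (\<lambda>x. \<Sum>j<d. c j * v j x))\<^sup>2" if k: "k < d" for k
  proof -
    let ?I = "{..<d} - {k}"
    obtain a where a: "\<forall>l\<in>?I. L2_inner M (\<lambda>x. v k x - (\<Sum>j\<in>?I. a j * v j x)) (v l) = 0"
      using L2_projection[of ?I v M "v k"] v k by auto
    define w where "w = (\<lambda>x. v k x - (\<Sum>j\<in>?I. a j * v j x))"
    have wL2: "w \<in> L2_space M"
      unfolding w_def using v k by (intro L2_space_diff L2_space_sum L2_space_scale) auto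
    define e where "e = (\<lambda>j. if j = k then 1 else - a j)"
    have w_eq: "w x = (\<Sum>j<d. e j * v j x)" for x
    proof -
      have "(\<Sum>j<d. e j * v j x) = e k * v k x + (\<Sum>j\<in>?I. e j * v j x)"
        using k by (intro sum.remove) auto
      also have "(\<Sum>j\<in>?I. e j * v j x) = - (\<Sum>j\<in>?I. a j * v j x)"
        unfolding sum_negf[symmetric] by (intro sum.cong) (auto simp: e_def)
      finally show ?thesis by (simp add: w_def e_def)
    qed
    have pos: "L2_norm M w > 0"
    proof (rule ccontr)
      assume "\<not> L2_norm M w > 0"
      then have "L2_norm M w = 0" using L2_norm_nonneg[of M w] by linarith
      then have "AE x in M. (\<Sum>j<d. e j * v j x) = 0"
        using L2_norm_zero_AE[OF wL2] by (simp add: w_eq)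
      then have "e k = 0" using indep k unfolding lin_indep_mod_null_def by blast
      then show False by (simp add: e_def)
    qed
    have "L2_inner M w (v k) = L2_inner M w (\<lambda>x. w x + (\<Sum>j\<in>?I. a j * v j x))"
      by (simp add: w_def)
    also have "\<dots> = L2_inner M w w + L2_inner M w (\<lambda>x. \<Sum>j\<in>?I. a j * v j x)"
      using v by (intro L2_inner_add_right wL2 L2_space_sum L2_space_scale) auto
    also have "L2_inner M w (\<lambda>x. \<Sum>j\<in>?I. a j * v j x) = 0"
      using a v by (subst L2_inner_sum_right[OF _ wL2]) (auto simp: w_def)
    finally have wk: "L2_inner M w (v k) = of_real ((L2_norm M w)\<^sup>2)" by (simp add: L2_inner_self)
    have "(cmod (c k))\<^sup>2 \<le> 1 / (L2_norm M w)\<^sup>2 * (L2_norm M (\<lambda>x. \<Sum>j<d. c j * v j x))\<^sup>2" for c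
    proof -
      let ?V = "\<lambda>x. \<Sum>j<d. c j * v j x"
      have VL2: "?V \<in> L2_space M" using v by (intro L2_space_sum L2_space_scale) auto
      have "L2_inner M w ?V = (\<Sum>j<d. cnj (c j) * L2_inner M w (v j))"
        using v by (intro L2_inner_sum_right wL2) auto
      also have "\<dots> = (\<Sum>j<d. if j = k then cnj (c k) * of_real ((L2_norm M w)\<^sup>2) else 0)"
        using a wk by (intro sum.cong) (auto simp: w_def)
      also have "\<dots> = cnj (c k) * of_real ((L2_norm M w)\<^sup>2)" using k by simp
      finally have "cmod (c k) * (L2_norm M w)\<^sup>2 = cmod (L2_inner M w ?V)"
        by (simp add: norm_mult norm_power)
      also have "\<dots> \<le> L2_norm M w * L2_norm M ?V" by (rule L2_Cauchy_Schwarz[OF wL2 VL2])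
      finally have "cmod (c k) * L2_norm M w \<le> L2_norm M ?V"
        using pos by (simp add: power2_eq_square)
      then have "(cmod (c k) * L2_norm M w)\<^sup>2 \<le> (L2_norm M ?V)\<^sup>2"
        using pos by (intro power_mono) auto
      then show ?thesis using pos by (simp add: power_mult_distrib field_simps)
    qed
    then show ?thesis using pos by (intro exI[of _ "1 / (L2_norm M w)\<^sup>2"]) auto
  qed
  then obtain B where B: "\<And>k. k < d \<Longrightarrow> B k > 0"
    "\<And>k c. k < d \<Longrightarrow> (cmod (c k))\<^sup>2 \<le> B k * (L2_norm M (\<lambda>x. \<Sum>j<d. c j * v j x))\<^sup>2"
    by metis
  define S where "S = 1 + (\<Sum>k<d. B k)"
  have "(\<Sum>k<d. B k) \<ge> 0" using B(1) by (intro sum_nonneg) (auto intro: less_imp_le)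
  then have S: "S > 0" by (simp add: S_def)
  have "1 / S * (\<Sum>k<d. (cmod (c k))\<^sup>2) \<le> (L2_norm M (\<lambda>x. \<Sum>j<d. c j * v j x))\<^sup>2" for c
  proof -
    let ?V = "(L2_norm M (\<lambda>x. \<Sum>j<d. c j * v j x))\<^sup>2"
    have "(\<Sum>k<d. (cmod (c k))\<^sup>2) \<le> (\<Sum>k<d. B k * ?V)" using B(2) by (intro sum_mono) auto
    also have "\<dots> \<le> S * ?V" by (simp add: S_def sum_distrib_right[symmetric] distrib_right)
    finally show ?thesis using S by (simp add: field_simps)
  qed
  then show ?thesis using S by (intro exI[of _ "1 / S"]) auto
qed

definition normal_equations ::
    "'a measure \<Rightarrow> nat \<Rightarrow> (nat \<Rightarrow> 'a \<Rightarrow> complex) \<Rightarrow> ('a \<Rightarrow> complex) \<Rightarrow> (nat \<Rightarrow> complex) \<Rightarrow> bool" where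
  "normal_equations M d v u c \<longleftrightarrow>
     (\<forall>k<d. (\<Sum>j<d. c j * L2_inner M (v j) (v k)) = L2_inner M u (v k))"

lemma normal_equations_solvable:
  assumes v: "\<And>i. i < d \<Longrightarrow> v i \<in> L2_space M" and u: "u \<in> L2_space M"
  shows "\<exists>c\<in>extensional {..<d}. normal_equations M d v u c"
proof -
  obtain c where c: "\<forall>k\<in>{..<d}. L2_inner M (\<lambda>x. u x - (\<Sum>j<d. c j * v j x)) (v k) = 0"
    using L2_projection[of "{..<d}" v M u] v u by auto
  have "(\<Sum>j<d. c j * L2_inner M (v j) (v k)) = L2_inner M u (v k)" if k: "k < d" for k
  proof -
    have "L2_inner M (\<lambda>x. u x - (\<Sum>j<d. c j * v j x)) (v k)
        = L2_inner M u (v k) - L2_inner M (\<lambda>x. \<Sum>j<d. c j * v j x) (v k)"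
      using v k by (intro L2_inner_diff_left u L2_space_sum L2_space_scale) auto
    also have "L2_inner M (\<lambda>x. \<Sum>j<d. c j * v j x) (v k) = (\<Sum>j<d. c j * L2_inner M (v j) (v k))"
      using v k by (intro L2_inner_sum_left) auto
    finally show ?thesis using c k by simp
  qed
  then have "normal_equations M d v u (restrict c {..<d})"
    by (simp add: normal_equations_def)
  then show ?thesis by (intro bexI[of _ "restrict c {..<d}"]) auto
qed

text \<open>The residual of a solution is orthogonal to the span, so the cost of any other coefficient
  vector exceeds the minimum by the squared norm of the deviation. This gives existence and
  uniqueness of the filter.\<close>

lemma normal_equations_Pythagoras:
  assumes v: "\<And>i. i < d \<Longrightarrow> v i \<in> L2_space M" and u: "u \<in> L2_space M"
    and c: "normal_equations M d v u c"
  shows "(L2_norm M (\<lambda>x. u x - (\<Sum>j<d. c' j * v j x)))\<^sup>2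
    = (L2_norm M (\<lambda>x. u x - (\<Sum>j<d. c j * v j x)))\<^sup>2 + (L2_norm M (\<lambda>x. \<Sum>j<d. (c j - c' j) * v j x))\<^sup>2"
proof -
  define r where "r = (\<lambda>x. u x - (\<Sum>j<d. c j * v j x))"
  define w where "w = (\<lambda>x. \<Sum>j<d. (c j - c' j) * v j x)"
  have sL2: "(\<lambda>x. \<Sum>j<d. a j * v j x) \<in> L2_space M" for a
    using v by (intro L2_space_sum L2_space_scale) auto
  have rL2: "r \<in> L2_space M" unfolding r_def by (intro L2_space_diff u sL2)
  have wL2: "w \<in> L2_space M" unfolding w_def by (rule sL2)
  have rv: "L2_inner M r (v k) = 0" if k: "k < d" for k
  proof -
    have "L2_inner M r (v k) = L2_inner M u (v k) - L2_inner M (\<lambda>x. \<Sum>j<d. c j * v j x) (v k)"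
      unfolding r_def using v k by (intro L2_inner_diff_left u sL2)
    also have "L2_inner M (\<lambda>x. \<Sum>j<d. c j * v j x) (v k) = (\<Sum>j<d. c j * L2_inner M (v j) (v k))"
      using v k by (intro L2_inner_sum_left) auto
    finally show ?thesis using c k by (simp add: normal_equations_def)
  qed
  have rw: "L2_inner M r w = 0"
    unfolding w_def using v rv by (subst L2_inner_sum_right[OF _ rL2]) auto
  have wr: "L2_inner M w r = 0" using rw by (metis L2_inner_cnj complex_cnj_zero)
  have "(\<lambda>x. u x - (\<Sum>j<d. c' j * v j x)) = (\<lambda>x. r x + w x)"
    by (simp add: r_def w_def left_diff_distrib sum_subtractf)
  moreover have "L2_inner M (\<lambda>x. r x + w x) (\<lambda>x. r x + w x) = L2_inner M r r + L2_inner M w w"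
    using rw wr by (simp add: L2_inner_add_left[OF rL2 wL2 L2_space_add[OF rL2 wL2]]
        L2_inner_add_right[OF rL2 wL2 rL2] L2_inner_add_right[OF rL2 wL2 wL2])
  ultimately have "complex_of_real ((L2_norm M (\<lambda>x. u x - (\<Sum>j<d. c' j * v j x)))\<^sup>2)
      = of_real ((L2_norm M r)\<^sup>2 + (L2_norm M w)\<^sup>2)"
    by (simp add: L2_inner_self)
  then show ?thesis unfolding of_real_eq_iff by (simp add: r_def w_def)
qed

lemma filter_cost_L2_norm:
  "filter_cost M f d S c = (L2_norm M (\<lambda>x. f (S x) - (\<Sum>j<d. c j * delay M S f j x)))\<^sup>2"
  by (simp add: filter_cost_def L2_norm_power2)

lemma filter_unique:
  assumes S: "S \<in> MPT M" and f: "f \<in> L2_space M"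
    and \<kappa>: "\<kappa> > 0" "\<And>c. \<kappa> * (\<Sum>k<d. (cmod (c k))\<^sup>2) \<le> (L2_norm M (\<lambda>x. \<Sum>j<d. c j * delay M S f j x))\<^sup>2"
  shows "\<exists>!c. is_delay_filter M f d S c"
    and "normal_equations M d (delay M S f) (\<lambda>x. f (S x)) (filter_of M f d S)"
proof -
  let ?v = "delay M S f" and ?u = "\<lambda>x. f (S x)"
  have v: "?v i \<in> L2_space M" for i by (rule delay_L2[OF S f])
  have u: "?u \<in> L2_space M"
    by (rule L2_space_compose[OF MPT_measurable[OF S] MPT_distr[OF S] f])
  obtain c where c: "c \<in> extensional {..<d}" "normal_equations M d ?v ?u c"
    using normal_equations_solvable[of d ?v M ?u] v u by blast
  have P: "filter_cost M f d S c' = filter_cost M f d S c + (L2_norm M (\<lambda>x. \<Sum>j<d. (c j - c' j) * ?v j x))\<^sup>2" for c'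
    unfolding filter_cost_L2_norm by (rule normal_equations_Pythagoras[OF v u c(2)])
  have F: "is_delay_filter M f d S c"
    unfolding is_delay_filter_def
  proof (intro conjI ballI c(1))
    show "filter_cost M f d S c \<le> filter_cost M f d S c'" for c'
      unfolding P[of c'] by (rule le_add_same_cancel1[THEN iffD2]) (rule zero_le_power2)
  qed
  have uniq: "c' = c" if c': "is_delay_filter M f d S c'" for c'
  proof -
    have "filter_cost M f d S c' \<le> filter_cost M f d S c"
      using c' c(1) by (simp add: is_delay_filter_def)
    then have "(L2_norm M (\<lambda>x. \<Sum>j<d. (c j - c' j) * ?v j x))\<^sup>2 \<le> 0" using P[of c'] by linarith
    then have "\<kappa> * (\<Sum>k<d. (cmod (c k - c' k))\<^sup>2) \<le> 0"
      using \<kappa>(2)[of "\<lambda>k. c k - c' k"] by linarith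
    then have "(\<Sum>k<d. (cmod (c k - c' k))\<^sup>2) \<le> 0" using \<kappa>(1) by (simp add: mult_le_0_iff)
    moreover have "(\<Sum>k<d. (cmod (c k - c' k))\<^sup>2) \<ge> 0" by (intro sum_nonneg) simp
    ultimately have "(\<Sum>k<d. (cmod (c k - c' k))\<^sup>2) = 0" by simp
    then have "\<forall>k\<in>{..<d}. (cmod (c k - c' k))\<^sup>2 = 0"
      by (subst (asm) sum_nonneg_eq_0_iff) auto
    then have "c' k = c k" if "k \<in> {..<d}" for k using that by simp
    then show ?thesis using c' c(1) by (intro extensionalityI[of _ "{..<d}"]) (auto simp: is_delay_filter_def)
  qed
  show "\<exists>!c. is_delay_filter M f d S c" using F uniq by blast
  have "filter_of M f d S = c" unfolding filter_of_def using F uniq by (rule the_equality)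
  then show "normal_equations M d ?v ?u (filter_of M f d S)" using c(2) by simp
qed

lemma gram_norm:
  assumes v: "\<And>i. i < d \<Longrightarrow> v i \<in> L2_space M"
  shows "complex_of_real ((L2_norm M (\<lambda>x. \<Sum>j<d. a j * v j x))\<^sup>2)
    = (\<Sum>k<d. cnj (a k) * (\<Sum>j<d. a j * L2_inner M (v j) (v k)))"
proof -
  have V: "(\<lambda>x. \<Sum>j<d. a j * v j x) \<in> L2_space M"
    using v by (intro L2_space_sum L2_space_scale) auto
  have "L2_inner M (\<lambda>x. \<Sum>j<d. a j * v j x) (\<lambda>x. \<Sum>j<d. a j * v j x)
      = (\<Sum>k<d. cnj (a k) * L2_inner M (\<lambda>x. \<Sum>j<d. a j * v j x) (v k))"
    using v by (intro L2_inner_sum_right V) auto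
  also have "\<dots> = (\<Sum>k<d. cnj (a k) * (\<Sum>j<d. a j * L2_inner M (v j) (v k)))"
    using v by (intro sum.cong refl arg_cong2[where f="(*)"] L2_inner_sum_left) auto
  finally show ?thesis by (simp only: L2_inner_self)
qed

lemma sum_cmod_le_L2_set: "(\<Sum>k<d. cmod (a k)) \<le> real d * L2_set (\<lambda>k. cmod (a k)) {..<d}"
proof -
  have "(\<Sum>k<d. cmod (a k)) \<le> (\<Sum>k<d. L2_set (\<lambda>k. cmod (a k)) {..<d})"
    by (intro sum_mono member_le_L2_set) auto
  then show ?thesis by simp
qed

definition inner_products_close ::
    "'a measure \<Rightarrow> nat \<Rightarrow> real \<Rightarrow> (nat \<Rightarrow> 'a \<Rightarrow> complex) \<Rightarrow> ('a \<Rightarrow> complex)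
      \<Rightarrow> (nat \<Rightarrow> 'a \<Rightarrow> complex) \<Rightarrow> ('a \<Rightarrow> complex) \<Rightarrow> bool" where
  "inner_products_close M d \<delta> v u v' u' \<longleftrightarrow>
     (\<forall>i<d. v' i \<in> L2_space M) \<and> u' \<in> L2_space M \<and>
     (\<forall>j<d. \<forall>k<d. cmod (L2_inner M (v' j) (v' k) - L2_inner M (v j) (v k)) \<le> \<delta>) \<and>
     (\<forall>k<d. cmod (L2_inner M u' (v' k) - L2_inner M u (v k)) \<le> \<delta>)"

text \<open>A small perturbation of the inner products costs at most half of the lower bound \<open>\<kappa>\<close> of the
  Gram matrix. The difference of the two solutions solves the perturbed system with a small right-hand
  side, hence is small.\<close>

lemma least_squares_stable:
  assumes v: "\<And>i. i < d \<Longrightarrow> v i \<in> L2_space M" and u: "u \<in> L2_space M"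
    and \<kappa>: "\<kappa> > 0" "\<And>c. \<kappa> * (\<Sum>k<d. (cmod (c k))\<^sup>2) \<le> (L2_norm M (\<lambda>x. \<Sum>j<d. c j * v j x))\<^sup>2"
    and c: "normal_equations M d v u c" and \<epsilon>: "\<epsilon> > 0"
  shows "\<exists>\<delta>>0. \<forall>v' u'. inner_products_close M d \<delta> v u v' u' \<longrightarrow>
      (\<forall>a. \<kappa> / 2 * (\<Sum>k<d. (cmod (a k))\<^sup>2) \<le> (L2_norm M (\<lambda>x. \<Sum>j<d. a j * v' j x))\<^sup>2) \<and>
      (\<forall>c'. normal_equations M d v' u' c' \<longrightarrow> L2_set (\<lambda>j. cmod (c' j - c j)) {..<d} < \<epsilon>)"
proof -
  define C where "C = 1 + (\<Sum>j<d. cmod (c j))"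
  have C: "C > 0" unfolding C_def by (intro add_pos_nonneg sum_nonneg) auto
  define D where "D = real d + 1"
  have D: "D > 0" "real d < D" by (auto simp: D_def)
  \<comment> \<open>The first bound keeps half of \<open>\<kappa>\<close>, the second one makes the difference of the solutions at
    most \<open>\<epsilon> / 2\<close>. D exceeds the dimension by 1, so that it is positive.\<close>
  define \<delta> where "\<delta> = min (\<kappa> / (2 * D\<^sup>2)) (\<kappa> * \<epsilon> / (4 * C * D))"
  have \<delta>: "\<delta> > 0" using \<kappa> \<epsilon> C D by (simp add: \<delta>_def)
  have \<delta>1: "\<delta> * D\<^sup>2 \<le> \<kappa> / 2"
  proof -
    have "\<delta> * D\<^sup>2 \<le> \<kappa> / (2 * D\<^sup>2) * D\<^sup>2" by (intro mult_right_mono) (auto simp: \<delta>_def)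
    then show ?thesis using D by simp
  qed
  have \<delta>2: "2 * \<delta> * C * D \<le> \<kappa> * \<epsilon> / 2"
  proof -
    have "2 * \<delta> * C * D \<le> 2 * (\<kappa> * \<epsilon> / (4 * C * D)) * C * D"
      using C D by (intro mult_right_mono mult_left_mono) (auto simp: \<delta>_def)
    then show ?thesis using D C by (simp add: mult_ac)
  qed
  have lower: "\<kappa> / 2 * (\<Sum>k<d. (cmod (a k))\<^sup>2) \<le> (L2_norm M (\<lambda>x. \<Sum>j<d. a j * v' j x))\<^sup>2"
    if close: "inner_products_close M d \<delta> v u v' u'" for v' u' a
  proof -
    have v': "\<forall>i<d. v' i \<in> L2_space M"
      and G: "\<forall>j<d. \<forall>k<d. cmod (L2_inner M (v' j) (v' k) - L2_inner M (v j) (v k)) \<le> \<delta>"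
      using close unfolding inner_products_close_def by blast+
    let ?L = "L2_set (\<lambda>k. cmod (a k)) {..<d}"
    have L2: "?L\<^sup>2 = (\<Sum>k<d. (cmod (a k))\<^sup>2)" by (simp add: L2_set_def sum_nonneg)
    have L0: "?L \<ge> 0" by simp
    let ?N = "(L2_norm M (\<lambda>x. \<Sum>j<d. a j * v j x))\<^sup>2" and ?N' = "(L2_norm M (\<lambda>x. \<Sum>j<d. a j * v' j x))\<^sup>2"
    have "complex_of_real (?N - ?N') = (\<Sum>k<d. cnj (a k) * (\<Sum>j<d. a j * (L2_inner M (v j) (v k) - L2_inner M (v' j) (v' k))))"
    proof -
      have "complex_of_real ?N = (\<Sum>k<d. cnj (a k) * (\<Sum>j<d. a j * L2_inner M (v j) (v k)))"
        by (rule gram_norm[OF v])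
      moreover have "complex_of_real ?N' = (\<Sum>k<d. cnj (a k) * (\<Sum>j<d. a j * L2_inner M (v' j) (v' k)))"
        using v' by (intro gram_norm) blast
      ultimately show ?thesis by (simp only: of_real_diff right_diff_distrib sum_subtractf)
    qed
    then have "?N - ?N' \<le> cmod (\<Sum>k<d. cnj (a k) * (\<Sum>j<d. a j * (L2_inner M (v j) (v k) - L2_inner M (v' j) (v' k))))"
      using abs_ge_self[of "?N - ?N'"] unfolding norm_of_real[symmetric, where 'a=complex] by (simp only:)
    also have "\<dots> \<le> (\<Sum>k<d. cmod (a k) * (\<Sum>j<d. cmod (a j) * \<delta>))"
    proof (intro sum_norm_le)
      fix k assume k: "k \<in> {..<d}"
      have "cmod (\<Sum>j<d. a j * (L2_inner M (v j) (v k) - L2_inner M (v' j) (v' k))) \<le> (\<Sum>j<d. cmod (a j) * \<delta>)"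
      proof (intro sum_norm_le)
        fix j assume "j \<in> {..<d}"
        then have "cmod (L2_inner M (v j) (v k) - L2_inner M (v' j) (v' k)) \<le> \<delta>"
          using G k by (simp add: norm_minus_commute)
        then show "cmod (a j * (L2_inner M (v j) (v k) - L2_inner M (v' j) (v' k))) \<le> cmod (a j) * \<delta>"
          unfolding norm_mult by (intro mult_left_mono) auto
      qed
      then show "cmod (cnj (a k) * (\<Sum>j<d. a j * (L2_inner M (v j) (v k) - L2_inner M (v' j) (v' k))))
          \<le> cmod (a k) * (\<Sum>j<d. cmod (a j) * \<delta>)"
        unfolding norm_mult complex_mod_cnj by (intro mult_left_mono) auto
    qed
    also have "\<dots> = \<delta> * (\<Sum>k<d. cmod (a k))\<^sup>2"
    proof -
      have "(\<Sum>k<d. cmod (a k) * (\<Sum>j<d. cmod (a j) * \<delta>)) = (\<Sum>k<d. cmod (a k)) * ((\<Sum>k<d. cmod (a k)) * \<delta>)"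
        by (simp only: sum_distrib_right)
      then show ?thesis unfolding power2_eq_square by (simp only: mult_ac)
    qed
    also have "\<dots> \<le> \<delta> * (D * ?L)\<^sup>2"
    proof -
      have "(\<Sum>k<d. cmod (a k)) \<le> D * ?L"
        unfolding D_def distrib_right mult_1 using sum_cmod_le_L2_set[where a=a and d=d] L0 by linarith
      then show ?thesis using \<delta> by (intro mult_left_mono power_mono sum_nonneg) auto
    qed
    also have "\<dots> = \<delta> * D\<^sup>2 * ?L\<^sup>2" by (simp add: power_mult_distrib)
    also have "\<dots> \<le> \<kappa> / 2 * ?L\<^sup>2" using \<delta>1 by (intro mult_right_mono) auto
    finally have "?N \<le> ?N' + \<kappa> / 2 * (\<Sum>k<d. (cmod (a k))\<^sup>2)" by (simp add: L2)
    then show "\<kappa> / 2 * (\<Sum>k<d. (cmod (a k))\<^sup>2) \<le> ?N'"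
      using \<kappa>(2)[of a] by simp
  qed
  have close: "L2_set (\<lambda>j. cmod (c' j - c j)) {..<d} < \<epsilon>"
    if close: "inner_products_close M d \<delta> v u v' u'" and c': "normal_equations M d v' u' c'"
    for v' u' c'
  proof -
    have v': "\<forall>i<d. v' i \<in> L2_space M"
      and G: "\<forall>j<d. \<forall>k<d. cmod (L2_inner M (v' j) (v' k) - L2_inner M (v j) (v k)) \<le> \<delta>"
      and b: "\<forall>k<d. cmod (L2_inner M u' (v' k) - L2_inner M u (v k)) \<le> \<delta>"
      using close unfolding inner_products_close_def by blast+
    define a where "a = (\<lambda>j. c' j - c j)"
    let ?L = "L2_set (\<lambda>k. cmod (a k)) {..<d}"
    let ?N' = "(L2_norm M (\<lambda>x. \<Sum>j<d. a j * v' j x))\<^sup>2"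
    have L2: "?L\<^sup>2 = (\<Sum>k<d. (cmod (a k))\<^sup>2)" by (simp add: L2_set_def sum_nonneg)
    have L0: "?L \<ge> 0" by simp
    have residual: "cmod (\<Sum>j<d. a j * L2_inner M (v' j) (v' k)) \<le> \<delta> * C" if k: "k < d" for k
    proof -
      let ?e = "\<Sum>j<d. c j * (L2_inner M (v' j) (v' k) - L2_inner M (v j) (v k))"
      have e1: "(\<Sum>j<d. a j * L2_inner M (v' j) (v' k)) = (L2_inner M u' (v' k) - L2_inner M u (v k)) - ?e"
        using c c' k unfolding normal_equations_def
        by (simp add: a_def left_diff_distrib right_diff_distrib sum_subtractf)
      have e2: "cmod (L2_inner M u' (v' k) - L2_inner M u (v k)) \<le> \<delta>" using b k by blast
      have e3: "cmod ?e \<le> (\<Sum>j<d. cmod (c j) * \<delta>)"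
      proof (intro sum_norm_le)
        fix j assume "j \<in> {..<d}"
        then show "cmod (c j * (L2_inner M (v' j) (v' k) - L2_inner M (v j) (v k))) \<le> cmod (c j) * \<delta>"
          unfolding norm_mult using G k by (intro mult_left_mono) auto
      qed
      have "cmod (\<Sum>j<d. a j * L2_inner M (v' j) (v' k)) \<le> \<delta> + (\<Sum>j<d. cmod (c j) * \<delta>)"
        unfolding e1 using e2 e3 norm_triangle_ineq4[of "L2_inner M u' (v' k) - L2_inner M u (v k)" ?e] by linarith
      also have "\<dots> = \<delta> * C" 
        unfolding sum_distrib_right[symmetric] C_def distrib_left by (simp add: mult.commute)
      finally show ?thesis .
    qed
    have "?N' = cmod (complex_of_real ?N')" unfolding norm_of_real by simp
    also have "\<dots> = cmod (\<Sum>k<d. cnj (a k) * (\<Sum>j<d. a j * L2_inner M (v' j) (v' k)))"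
      using v' by (subst gram_norm) auto
    also have "\<dots> \<le> (\<Sum>k<d. cmod (a k) * (\<delta> * C))"
    proof (intro sum_norm_le)
      fix k assume "k \<in> {..<d}"
      then show "cmod (cnj (a k) * (\<Sum>j<d. a j * L2_inner M (v' j) (v' k))) \<le> cmod (a k) * (\<delta> * C)"
        unfolding norm_mult complex_mod_cnj using residual by (intro mult_left_mono) auto
    qed
    also have "\<dots> = \<delta> * C * (\<Sum>k<d. cmod (a k))"
      unfolding sum_distrib_right[symmetric] by (rule mult.commute)
    also have "\<dots> \<le> \<delta> * C * (D * ?L)"
    proof -
      have "(\<Sum>k<d. cmod (a k)) \<le> D * ?L"
        unfolding D_def distrib_right mult_1 using sum_cmod_le_L2_set[where a=a and d=d] L0 by linarith
      then show ?thesis using \<delta> C by (intro mult_left_mono) auto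
    qed
    finally have "\<kappa> / 2 * ?L\<^sup>2 \<le> \<delta> * C * D * ?L"
      using lower[OF close, of a] unfolding L2 by (simp only: mult.assoc)
    then have "(\<kappa> / 2 * ?L) * ?L \<le> (\<delta> * C * D) * ?L"
      by (simp only: power2_eq_square mult.assoc)
    then have "\<kappa> / 2 * ?L \<le> \<delta> * C * D \<or> ?L = 0"
      using L0 by (metis mult_le_cancel_right_pos order_le_less)
    then have "?L \<le> \<epsilon> / 2"
    proof
      assume "\<kappa> / 2 * ?L \<le> \<delta> * C * D"
      then have "\<kappa> * ?L \<le> \<kappa> * (\<epsilon> / 2)" using \<delta>2 by (simp add: mult_ac)
      then show ?thesis using \<kappa>(1) by simp
    qed (use \<epsilon> in simp)
    then show ?thesis using \<epsilon> by (simp add: a_def)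
  qed
  from \<delta> lower close show ?thesis by blast
qed

definition autocorrelation :: "'a measure \<Rightarrow> ('a \<Rightarrow> 'a) \<Rightarrow> ('a \<Rightarrow> complex) \<Rightarrow> nat \<Rightarrow> complex" where
  "autocorrelation M S f k = L2_inner M (\<lambda>x. f ((S ^^ k) x)) f"

lemma AE_mpt_inv_funpow:
  assumes S: "S \<in> MPT M"
  shows "AE x in M. (mpt_inv M S ^^ j) ((S ^^ j) x) = x"
proof (induction j)
  case (Suc j)
  show ?case
    using Suc MPT_AE_funpow[OF S AE_mpt_inv_left[OF S], of j]
  proof eventually_elim
    case (elim x)
    then show ?case
      unfolding funpow_Suc_right[where n=j and f="mpt_inv M S"] funpow.simps(2)[where n=j and f=S] by simp
  qed
qed simp

lemma L2_funpow:
  assumes "S \<in> MPT M" "f \<in> L2_space M"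
  shows "(\<lambda>x. f ((S ^^ k) x)) \<in> L2_space M"
  using L2_space_compose[OF MPT_funpow[OF assms(1)] assms(2)] .

lemma AE_delay_funpow:
  assumes S: "S \<in> MPT M"
  shows "AE x in M. delay M S f j ((S ^^ (j + k)) x) = f ((S ^^ k) x)"
  using MPT_AE_funpow[OF S AE_mpt_inv_funpow[OF S, of j], of k]
  by eventually_elim (simp add: delay_def funpow_add)

text \<open>Composing both factors with a power of S removes the later delay.\<close>

lemma delay_inner_autocorrelation:
  assumes S: "S \<in> MPT M" and f: "f \<in> L2_space M"
  shows "j \<le> k \<Longrightarrow> L2_inner M (delay M S f j) (delay M S f k) = autocorrelation M S f (k - j)"
    and "L2_inner M (\<lambda>x. f (S x)) (delay M S f j) = autocorrelation M S f (Suc j)"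
proof -
  have dm: "delay M S f i \<in> borel_measurable M" for i
    by (rule L2_space_measurable[OF delay_L2[OF S f]])
  have fm: "(\<lambda>x. f ((S ^^ i) x)) \<in> borel_measurable M" for i
    by (rule L2_space_measurable[OF L2_funpow[OF S f]])
  have cm: "(\<lambda>x. delay M S f i ((S ^^ k) x)) \<in> borel_measurable M" for i k
    by (rule measurable_compose[OF MPT_funpow(1)[OF S] dm])
  have d0: "AE x in M. delay M S f k ((S ^^ k) x) = f x" for k
    using AE_delay_funpow[OF S, of f k 0] by simp
  show "L2_inner M (delay M S f j) (delay M S f k) = autocorrelation M S f (k - j)" if "j \<le> k"
  proof -
    have "L2_inner M (delay M S f j) (delay M S f k)
        = L2_inner M (\<lambda>x. delay M S f j ((S ^^ k) x)) (\<lambda>x. delay M S f k ((S ^^ k) x))"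
      by (rule L2_inner_compose[OF MPT_funpow[OF S] dm dm, symmetric])
    also have "\<dots> = autocorrelation M S f (k - j)"
      unfolding autocorrelation_def
      using AE_delay_funpow[OF S, of f j "k - j"] d0[of k] that cm fm L2_space_measurable[OF f]
      by (intro L2_inner_cong_AE) auto
    finally show ?thesis .
  qed
  have "L2_inner M (\<lambda>x. f (S x)) (delay M S f j)
      = L2_inner M (\<lambda>x. f (S ((S ^^ j) x))) (\<lambda>x. delay M S f j ((S ^^ j) x))"
    using fm[of 1] by (intro L2_inner_compose[OF MPT_funpow[OF S] _ dm, symmetric]) simp
  also have "\<dots> = autocorrelation M S f (Suc j)"
    unfolding autocorrelation_def
    using d0[of j] cm fm[of "Suc j"] L2_space_measurable[OF f]
    by (intro L2_inner_cong_AE) auto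
  finally show "L2_inner M (\<lambda>x. f (S x)) (delay M S f j) = autocorrelation M S f (Suc j)" .
qed

theorem filter_continuous:
  assumes T: "T \<in> MPT M" and f: "f \<in> L2_space M"
    and indep: "lin_indep_mod_null M d (delay M T f)" and \<epsilon>: "\<epsilon> > 0"
  shows "\<exists>\<delta>>0. \<forall>S\<in>MPT M.
    (\<forall>k\<le>d. cmod (autocorrelation M S f k - autocorrelation M T f k) \<le> \<delta>) \<longrightarrow>
    (\<exists>!c. is_delay_filter M f d S c) \<and>
    L2_set (\<lambda>j. cmod (filter_of M f d S j - filter_of M f d T j)) {..<d} < \<epsilon>"
proof -
  have v: "delay M S f i \<in> L2_space M" if "S \<in> MPT M" for S i by (rule delay_L2[OF that f])
  have u: "(\<lambda>x. f (S x)) \<in> L2_space M" if "S \<in> MPT M" for S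
    by (rule L2_space_compose[OF MPT_measurable[OF that] MPT_distr[OF that] f])
  obtain \<kappa> where \<kappa>: "\<kappa> > 0"
    "\<And>c. \<kappa> * (\<Sum>k<d. (cmod (c k))\<^sup>2) \<le> (L2_norm M (\<lambda>x. \<Sum>j<d. c j * delay M T f j x))\<^sup>2"
    using lin_indep_lower_bound[of d "delay M T f" M] v[OF T] indep by blast
  note normal_T = filter_unique(2)[OF T f \<kappa>]
  obtain \<delta> where \<delta>: "\<delta> > 0" and stable: "\<forall>v' u'. inner_products_close M d \<delta> (delay M T f) (\<lambda>x. f (T x)) v' u' \<longrightarrow>
      (\<forall>a. \<kappa> / 2 * (\<Sum>k<d. (cmod (a k))\<^sup>2) \<le> (L2_norm M (\<lambda>x. \<Sum>j<d. a j * v' j x))\<^sup>2) \<and>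
      (\<forall>c'. normal_equations M d v' u' c' \<longrightarrow> L2_set (\<lambda>j. cmod (c' j - filter_of M f d T j)) {..<d} < \<epsilon>)"
    using least_squares_stable[OF v[OF T] u[OF T] \<kappa> normal_T \<epsilon>] by blast
  have "(\<exists>!c. is_delay_filter M f d S c) \<and>
      L2_set (\<lambda>j. cmod (filter_of M f d S j - filter_of M f d T j)) {..<d} < \<epsilon>"
    if S: "S \<in> MPT M" and close: "\<forall>k\<le>d. cmod (autocorrelation M S f k - autocorrelation M T f k) \<le> \<delta>" for S
  proof -
    have upper: "cmod (L2_inner M (delay M S f j) (delay M S f k) - L2_inner M (delay M T f j) (delay M T f k)) \<le> \<delta>"
      if "j \<le> k" "k < d" for j k
      using close that delay_inner_autocorrelation(1)[OF S f that(1)] delay_inner_autocorrelation(1)[OF T f that(1)]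
      by simp
    have gram: "cmod (L2_inner M (delay M S f j) (delay M S f k) - L2_inner M (delay M T f j) (delay M T f k)) \<le> \<delta>"
      if "j < d" "k < d" for j k
    proof (cases "j \<le> k")
      case False
      have "cmod (L2_inner M (delay M S f j) (delay M S f k) - L2_inner M (delay M T f j) (delay M T f k))
          = cmod (cnj (L2_inner M (delay M S f k) (delay M S f j) - L2_inner M (delay M T f k) (delay M T f j)))"
        by (simp add: L2_inner_cnj)
      also have "\<dots> \<le> \<delta>" unfolding complex_mod_cnj using upper[of k j] False that by simp
      finally show ?thesis .
    qed (use upper that in simp)
    have rhs: "cmod (L2_inner M (\<lambda>x. f (S x)) (delay M S f k) - L2_inner M (\<lambda>x. f (T x)) (delay M T f k)) \<le> \<delta>"
      if "k < d" for k
      using close that delay_inner_autocorrelation(2)[OF S f] delay_inner_autocorrelation(2)[OF T f] by simp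
    have res: "(\<forall>a. \<kappa> / 2 * (\<Sum>k<d. (cmod (a k))\<^sup>2) \<le> (L2_norm M (\<lambda>x. \<Sum>j<d. a j * delay M S f j x))\<^sup>2) \<and>
      (\<forall>c'. normal_equations M d (delay M S f) (\<lambda>x. f (S x)) c' \<longrightarrow>
        L2_set (\<lambda>j. cmod (c' j - filter_of M f d T j)) {..<d} < \<epsilon>)"
    proof -
      have "inner_products_close M d \<delta> (delay M T f) (\<lambda>x. f (T x)) (delay M S f) (\<lambda>x. f (S x))"
        unfolding inner_products_close_def using v[OF S] u[OF S] gram rhs by blast
      then show ?thesis using stable by blast
    qed
    have "\<kappa> / 2 > 0" using \<kappa>(1) by simp
    from filter_unique[OF S f this] res show ?thesis by blast
  qed
  then show ?thesis using \<delta> by blast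
qed

section \<open>Imitating a map by an irrational rotation\<close>

lemma L2_space_of_compose:
  assumes S: "S \<in> M \<rightarrow>\<^sub>M N" "distr M N S = N" and f: "f \<in> borel_measurable N"
    and fS: "(\<lambda>x. f (S x)) \<in> L2_space M"
  shows "f \<in> L2_space N"
proof -
  have "(\<lambda>x. (cmod (f x))\<^sup>2) \<in> borel_measurable N" using f by measurable
  then have "integrable (distr M N S) (\<lambda>x. (cmod (f x))\<^sup>2)"
    using L2_space_integrable[OF fS] by (subst integrable_distr_eq[OF S(1)]) auto
  then show ?thesis using f by (simp add: L2_space_def S(2))
qed

lemma L2_inner_close:
  assumes "a \<in> L2_space M" "a' \<in> L2_space M" "b \<in> L2_space M" "b' \<in> L2_space M"
  shows "cmod (L2_inner M a b - L2_inner M a' b')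
    \<le> L2_norm M (\<lambda>x. a x - a' x) * L2_norm M b + L2_norm M a' * L2_norm M (\<lambda>x. b x - b' x)"
proof -
  have "L2_inner M a b - L2_inner M a' b'
      = L2_inner M (\<lambda>x. a x - a' x) b + L2_inner M a' (\<lambda>x. b x - b' x)"
    using assms by (simp add: L2_inner_diff_left L2_inner_diff_right)
  also have "cmod \<dots> \<le> cmod (L2_inner M (\<lambda>x. a x - a' x) b) + cmod (L2_inner M a' (\<lambda>x. b x - b' x))"
    by (rule norm_triangle_ineq)
  also have "\<dots> \<le> L2_norm M (\<lambda>x. a x - a' x) * L2_norm M b + L2_norm M a' * L2_norm M (\<lambda>x. b x - b' x)"
    using assms by (intro add_mono L2_Cauchy_Schwarz L2_space_diff)
  finally show ?thesis .
qed

text \<open>The code names the square of side \<open>\<delta>\<close> that contains the point. Natural numbers as codes make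
  the rounded functions accessible to \<open>equidistributed_iso\<close>.\<close>

lemma discretization:
  fixes \<delta> :: real
  assumes \<delta>: "\<delta> > 0"
  shows "\<exists>code :: complex \<Rightarrow> nat. code \<in> borel \<rightarrow>\<^sub>M count_space UNIV \<and>
    (\<forall>z w. code z = code w \<longrightarrow> cmod (z - w) \<le> 2 * \<delta>)"
proof -
  define a where "a = (\<lambda>z. \<lfloor>Re z / \<delta>\<rfloor>)"
  define b where "b = (\<lambda>z. \<lfloor>Im z / \<delta>\<rfloor>)"
  have fl: "(\<lambda>z. \<lfloor>k z\<rfloor>) \<in> borel \<rightarrow>\<^sub>M count_space UNIV" if "k \<in> borel_measurable borel" for k :: "complex \<Rightarrow> real"
    using that by (rule measurable_compose[OF _ measurable_real_floor])
  have a: "a \<in> borel \<rightarrow>\<^sub>M count_space UNIV" and b: "b \<in> borel \<rightarrow>\<^sub>M count_space UNIV"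
    unfolding a_def b_def by (intro fl; measurable)+
  define code where "code = (\<lambda>z. to_nat (a z, b z))"
  have "(\<lambda>z. to_nat (i, b z)) \<in> borel \<rightarrow>\<^sub>M count_space UNIV" for i :: int
    by (rule measurable_compose[OF b]) simp
  then have m: "code \<in> borel \<rightarrow>\<^sub>M count_space UNIV"
    unfolding code_def by (rule measurable_compose_countable[OF _ a])
  have near: "\<bar>x - y\<bar> \<le> \<delta>" if "\<lfloor>x / \<delta>\<rfloor> = \<lfloor>y / \<delta>\<rfloor>" for x y
  proof -
    have "\<bar>x / \<delta> - y / \<delta>\<bar> \<le> 1" using that by linarith
    then have "\<bar>(x - y) / \<delta>\<bar> \<le> 1" by (simp add: diff_divide_distrib)
    then show ?thesis using \<delta> by (simp add: abs_divide)
  qed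
  have "cmod (z - w) \<le> 2 * \<delta>" if "code z = code w" for z w
  proof -
    have "a z = a w" "b z = b w" using that by (auto simp: code_def)
    then have "\<bar>Re (z - w)\<bar> \<le> \<delta>" "\<bar>Im (z - w)\<bar> \<le> \<delta>"
      using near by (auto simp: a_def b_def)
    then show ?thesis using cmod_le[of "z - w"] by linarith
  qed
  with m show ?thesis by blast
qed

text \<open>On the unit interval: \<open>h 0, \<dots>, h (L - 1)\<close> written side by side, \<open>h l\<close> compressed to the
  interval from \<open>l / L\<close> to \<open>(l + 1) / L\<close>.\<close>

definition tower :: "nat \<Rightarrow> (nat \<Rightarrow> real \<Rightarrow> complex) \<Rightarrow> real \<Rightarrow> complex" where
  "tower L h y = h (nat \<lfloor>real L * y\<rfloor>) (frac (real L * y))"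

lemma tower_measurable:
  assumes h: "\<And>l. h l \<in> borel_measurable borel"
  shows "tower L h \<in> borel_measurable borel"
proof -
  have "(\<lambda>y. h i (frac (real L * y))) \<in> borel_measurable borel" for i
    by (rule measurable_compose[OF _ h]) measurable
  moreover have "(\<lambda>y::real. nat \<lfloor>real L * y\<rfloor>) \<in> borel \<rightarrow>\<^sub>M count_space UNIV"
    by measurable
  ultimately show ?thesis
    unfolding tower_def by (rule measurable_compose_countable)
qed

lemma tower_piece:
  assumes "L > 0" "0 < t" "t < 1"
  shows "tower L h ((t + real l) / real L) = h l t"
proof -
  have "real L * ((t + real l) / real L) = t + real l" using assms by simp
  moreover have "\<lfloor>t + real l\<rfloor> = int l" using assms by (intro floor_unique) auto
  ultimately show ?thesis using assms by (simp add: tower_def frac_def)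
qed

lemma tower_distribution:
  assumes L: "L > 0" and h: "\<And>l. h l \<in> borel_measurable borel" and B: "B \<in> sets borel"
  shows "measure unif {y. tower L h y \<in> B} = (\<Sum>l<L. measure unif {t. h l t \<in> B} / real L)"
proof -
  have m: "{y. k y \<in> B} \<in> sets borel" if "k \<in> borel_measurable borel" for k :: "real \<Rightarrow> complex"
    using measurable_sets[OF that B] by (simp add: vimage_def)
  have ind: "(\<integral>y. indicator {y. k y \<in> B} y \<partial>unif) = measure unif {y. k y \<in> B}"
    if "k \<in> borel_measurable borel" for k :: "real \<Rightarrow> complex"
    using m[OF that] by simp
  let ?G = "\<lambda>y. indicator {y. tower L h y \<in> B} y :: real"
  have int: "integrable unif ?G"
    using m[OF tower_measurable[where h=h and L=L, OF h]] by (intro integrable_real_indicator) (auto simp: unif.emeasure_eq_measure)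
  have "measure unif {y. tower L h y \<in> B} = (\<integral>y. ?G y \<partial>unif)"
    by (rule ind[symmetric]) (rule tower_measurable[OF h])
  also have "\<dots> = (\<Sum>l<L. (1 / real L) *\<^sub>R (\<integral>t. ?G ((t + real l) / real L) \<partial>unif))"
    by (rule integral_unif_pieces[OF int L])
  also have "\<dots> = (\<Sum>l<L. measure unif {t. h l t \<in> B} / real L)"
  proof (rule sum.cong[OF refl])
    fix l
    have "(\<integral>t. ?G ((t + real l) / real L) \<partial>unif) = (\<integral>t. indicator {t. h l t \<in> B} t \<partial>unif)"
    proof (rule integral_cong_AE)
      show "AE t in unif. ?G ((t + real l) / real L) = indicator {t. h l t \<in> B} t"
        using AE_unif_bounds by eventually_elim (simp add: tower_piece[OF L] indicator_def)
      have "?G \<in> borel_measurable borel"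
        using m[OF tower_measurable[where h=h and L=L, OF h]] by simp
      then have "(\<lambda>t. ?G ((t + real l) / real L)) \<in> borel_measurable borel"
        by (rule measurable_compose[rotated]) measurable
      then show "(\<lambda>t. ?G ((t + real l) / real L)) \<in> borel_measurable unif" by simp
      show "(\<lambda>t. indicator {t. h l t \<in> B} t :: real) \<in> borel_measurable unif"
        using m[OF h] by simp
    qed
    also have "\<dots> = measure unif {t. h l t \<in> B}" by (rule ind[OF h])
    finally show "(1 / real L) *\<^sub>R (\<integral>t. ?G ((t + real l) / real L) \<partial>unif) = measure unif {t. h l t \<in> B} / real L"
      by simp
  qed
  finally show ?thesis .
qed

lemma rotation_L2:
  assumes "H \<in> L2_space unif"
  shows "(\<lambda>y. H (frac (y + s))) \<in> L2_space unif"
    and "L2_norm unif (\<lambda>y. H (frac (y + s))) = L2_norm unif H"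
proof -
  have r: "(\<lambda>y. frac (y + s)) \<in> unif \<rightarrow>\<^sub>M unif" "distr unif unif (\<lambda>y. frac (y + s)) = unif"
    using distr_unif_rotation[of s] by (auto cong: distr_cong)
  show "(\<lambda>y. H (frac (y + s))) \<in> L2_space unif" by (rule L2_space_compose[OF r assms])
  show "L2_norm unif (\<lambda>y. H (frac (y + s))) = L2_norm unif H"
    by (rule L2_norm_compose[OF r L2_space_measurable[OF assms]])
qed

text \<open>The rotation by \<open>k / L\<close> shifts the pieces of the tower cyclically by k.\<close>

lemma tower_rotation_inner:
  assumes L: "L > 0" and h: "\<And>l. h l \<in> borel_measurable borel" and H: "tower L h \<in> L2_space unif"
  shows "L2_inner unif (\<lambda>y. tower L h (frac (y + real k / real L))) (tower L h)
    = (\<Sum>l<L. L2_inner unif (h ((l + k) mod L)) (h l) / of_nat L)"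
proof -
  let ?G = "\<lambda>y. tower L h (frac (y + real k / real L)) * cnj (tower L h y)"
  have int: "integrable unif ?G"
    by (rule L2_product_integrable(2)[OF rotation_L2(1)[OF H] H])
  have "L2_inner unif (\<lambda>y. tower L h (frac (y + real k / real L))) (tower L h)
      = (\<Sum>l<L. (1 / real L) *\<^sub>R (\<integral>t. ?G ((t + real l) / real L) \<partial>unif))"
    unfolding L2_inner_def by (rule integral_unif_pieces[OF int L])
  also have "\<dots> = (\<Sum>l<L. L2_inner unif (h ((l + k) mod L)) (h l) / of_nat L)"
  proof (rule sum.cong[OF refl])
    fix l
    have "(\<integral>t. ?G ((t + real l) / real L) \<partial>unif) = (\<integral>t. h ((l + k) mod L) t * cnj (h l t) \<partial>unif)"
    proof (rule integral_cong_AE)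
      show "AE t in unif. ?G ((t + real l) / real L) = h ((l + k) mod L) t * cnj (h l t)"
        using AE_unif_bounds
      proof eventually_elim
        case (elim t)
        define m where "m = (l + k) mod L"
        have "real (l + k) = real L * real ((l + k) div L) + real m"
          unfolding m_def of_nat_mult[symmetric] of_nat_add[symmetric] by simp
        then have "(t + real l) / real L + real k / real L = (t + real m) / real L + of_int (int ((l + k) div L))"
          using L by (simp add: field_simps)
        then have "frac ((t + real l) / real L + real k / real L) = frac ((t + real m) / real L)"
          by (simp add: frac_def)
        also have "\<dots> = (t + real m) / real L"
        proof -
          have "m < L" using L by (simp add: m_def)
          then have "t + real m < real L" using elim by linarith
          then show ?thesis using elim L by (simp add: frac_eq)
        qed
        finally show ?case using elim by (simp add: tower_piece[OF L] m_def)
      qed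
      have "?G \<in> borel_measurable borel" using borel_measurable_integrable[OF int] by simp
      then have "(\<lambda>t. ?G ((t + real l) / real L)) \<in> borel_measurable borel"
        by (rule measurable_compose[rotated]) measurable
      then show "(\<lambda>t. ?G ((t + real l) / real L)) \<in> borel_measurable unif" by simp
      have "h i \<in> borel_measurable unif" for i using h[of i] by simp
      then show "(\<lambda>t. h ((l + k) mod L) t * cnj (h l t)) \<in> borel_measurable unif"
        by (intro borel_measurable_times borel_measurable_cnj)
    qed
    then show "(1 / real L) *\<^sub>R (\<integral>t. ?G ((t + real l) / real L) \<partial>unif)
        = L2_inner unif (h ((l + k) mod L)) (h l) / of_nat L"
      by (simp add: L2_inner_def scaleR_conv_of_real)
  qed
  finally show ?thesis .
qed

lemma trig_poly_periodic: "trig_poly p \<Longrightarrow> p (frac t) = p t"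
proof (induction rule: trig_poly.induct)
  case (monomial c n)
  have "2 * pi * real_of_int n * frac t = 2 * pi * real_of_int n * t - 2 * pi * real_of_int (n * \<lfloor>t\<rfloor>)"
    by (simp add: frac_def algebra_simps)
  then have "cis (2 * pi * real_of_int n * frac t)
      = cis (2 * pi * real_of_int n * t) / cis (2 * pi * real_of_int (n * \<lfloor>t\<rfloor>))"
    by (simp only: cis_divide)
  also have "cis (2 * pi * real_of_int (n * \<lfloor>t\<rfloor>)) = 1"
    by (rule cis_multiple_2pi) simp
  finally show ?case by simp
qed simp

lemma trig_poly_translation:
  "trig_poly p \<Longrightarrow> e > 0 \<Longrightarrow> \<exists>\<eta>>0. \<forall>s. \<bar>s - s0\<bar> < \<eta> \<longrightarrow> (\<forall>t. cmod (p (t + s) - p (t + s0)) \<le> e)"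
proof (induction arbitrary: e rule: trig_poly.induct)
  case (monomial c n)
  let ?k = "\<lambda>s. c * cis (2 * pi * real_of_int n * s)"
  have "continuous_on UNIV ?k" by (intro continuous_intros)
  then have "isCont ?k s0" by (simp add: continuous_on_eq_continuous_at)
  then obtain \<eta> where \<eta>: "\<eta> > 0" "\<And>s. \<bar>s - s0\<bar> < \<eta> \<Longrightarrow> cmod (?k s - ?k s0) < e"
    using monomial unfolding continuous_at_eps_delta dist_norm by (metis real_norm_def)
  have "cmod (?k (t + s) - ?k (t + s0)) = cmod (?k s - ?k s0)" for t s
  proof -
    have "?k (t + s') = cis (2 * pi * real_of_int n * t) * ?k s'" for s'
      by (simp add: distrib_left cis_mult[symmetric])
    then have "?k (t + s) - ?k (t + s0) = cis (2 * pi * real_of_int n * t) * (?k s - ?k s0)"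
      by (simp only: right_diff_distrib)
    then show ?thesis by (simp only: norm_mult norm_cis mult_1)
  qed
  then show ?case using \<eta> by (intro exI[of _ \<eta>]) (auto intro: less_imp_le)
next
  case (add p q)
  have "e / 2 > 0" using add.prems by simp
  then obtain \<eta>1 \<eta>2 where \<eta>: "\<eta>1 > 0" "\<forall>s. \<bar>s - s0\<bar> < \<eta>1 \<longrightarrow> (\<forall>t. cmod (p (t + s) - p (t + s0)) \<le> e / 2)"
    "\<eta>2 > 0" "\<forall>s. \<bar>s - s0\<bar> < \<eta>2 \<longrightarrow> (\<forall>t. cmod (q (t + s) - q (t + s0)) \<le> e / 2)"
    using add.IH by blast
  have "cmod (p (t + s) + q (t + s) - (p (t + s0) + q (t + s0))) \<le> e"
    if "\<bar>s - s0\<bar> < min \<eta>1 \<eta>2" for s t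
  proof -
    have "cmod (p (t + s) - p (t + s0)) \<le> e / 2" "cmod (q (t + s) - q (t + s0)) \<le> e / 2"
      using \<eta> that by auto
    then show ?thesis
      using norm_triangle_ineq[of "p (t + s) - p (t + s0)" "q (t + s) - q (t + s0)"]
      by (simp add: algebra_simps)
  qed
  then show ?case using \<eta> by (intro exI[of _ "min \<eta>1 \<eta>2"]) auto
qed

text \<open>Translations of a trigonometric polynomial converge uniformly; rotations are isometries and
  these polynomials are dense.\<close>

lemma rotation_continuous:
  assumes H: "H \<in> L2_space unif" and e: "e > 0"
  shows "\<exists>\<eta>>0. \<forall>s. \<bar>s - s0\<bar> < \<eta> \<longrightarrow> L2_norm unif (\<lambda>y. H (frac (y + s)) - H (frac (y + s0))) < e"
proof -
  have e4: "e / 4 > 0" using e by simp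
  then obtain p where p: "trig_poly p" "L2_norm unif (\<lambda>t. H t - p t) < e / 4"
    using trig_polys_dense[OF H] unfolding trig_approximable_def by blast
  obtain \<eta> where \<eta>: "\<eta> > 0" "\<forall>s. \<bar>s - s0\<bar> < \<eta> \<longrightarrow> (\<forall>t. cmod (p (t + s) - p (t + s0)) \<le> e / 4)"
    using trig_poly_translation[OF p(1) e4] by blast
  have pL2: "p \<in> L2_space unif" by (rule trig_poly_L2[OF p(1)])
  have Hp: "(\<lambda>t. H t - p t) \<in> L2_space unif" by (rule L2_space_diff[OF H pL2])
  have near: "L2_norm unif (\<lambda>y. H (frac (y + s)) - p (frac (y + s))) < e / 4" for s
    using rotation_L2(2)[OF Hp, of s] p(2) by simp
  have "L2_norm unif (\<lambda>y. H (frac (y + s)) - H (frac (y + s0))) < e" if s: "\<bar>s - s0\<bar> < \<eta>" for s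
  proof -
    note R = rotation_L2(1)[OF H] and P = rotation_L2(1)[OF pL2]
    have "L2_norm unif (\<lambda>y. p (frac (y + s)) - p (frac (y + s0))) \<le> e / 4"
    proof (rule L2_norm_bounded[OF prob_space_unif])
      show "(\<lambda>y. p (frac (y + s)) - p (frac (y + s0))) \<in> borel_measurable unif"
        by (intro L2_space_measurable L2_space_diff P)
      show "AE y in unif. cmod (p (frac (y + s)) - p (frac (y + s0))) \<le> e / 4"
        using \<eta>(2) s by (simp add: trig_poly_periodic[OF p(1)])
    qed (use e in simp)
    moreover have "L2_norm unif (\<lambda>y. H (frac (y + s)) - H (frac (y + s0)))
        \<le> L2_norm unif (\<lambda>y. H (frac (y + s)) - p (frac (y + s)))
        + (L2_norm unif (\<lambda>y. p (frac (y + s)) - p (frac (y + s0)))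
        + L2_norm unif (\<lambda>y. p (frac (y + s0)) - H (frac (y + s0))))"
      by (intro order_trans[OF L2_norm_triangle_dist[OF R[of s] P[of s] R[of s0]]] add_left_mono L2_norm_triangle_dist R P)
    ultimately show ?thesis
      using near[of s] near[of s0] e
      unfolding L2_norm_commute[of unif "\<lambda>y. p (frac (y + s0))"] by linarith
  qed
  then show ?thesis using \<eta>(1) by blast
qed

lemma character_measurable: "character k \<in> borel_measurable borel"
  unfolding character_def by (intro borel_measurable_continuous_onI continuous_intros)

lemma character_trig_poly: "trig_poly (character k)"
  using trig_poly.monomial[of 1 "int_decode k"] by (simp add: character_def[abs_def])

lemma character_rotation: "character k (frac (y + s)) = character k s * character k y"
proof -
  have "character k (frac (y + s)) = character k (y + s)"
    by (rule trig_poly_periodic[OF character_trig_poly])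
  then show ?thesis by (simp add: character_def distrib_left cis_mult add.commute)
qed

text \<open>Two equal eigenvalues would make an integer multiple of \<open>\<beta>\<close> an integer.\<close>

lemma irrational_characters_distinct:
  assumes "\<beta> \<notin> \<rat>"
  shows "inj (\<lambda>k. character k \<beta>)"
proof (rule injI)
  fix j k assume eq: "character j \<beta> = character k \<beta>"
  define m where "m = int_decode j - int_decode k"
  have "cis (2 * pi * real_of_int (int_decode j) * \<beta> - 2 * pi * real_of_int (int_decode k) * \<beta>) = 1"
    using eq by (simp add: character_def cis_divide[symmetric])
  moreover have "2 * pi * real_of_int (int_decode j) * \<beta> - 2 * pi * real_of_int (int_decode k) * \<beta>
      = 2 * pi * (real_of_int m * \<beta>)" by (simp add: m_def algebra_simps)
  ultimately have "cos (2 * pi * (real_of_int m * \<beta>)) = 1" by (simp add: complex_eq_iff)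
  then obtain n :: int where "2 * pi * (real_of_int m * \<beta>) = of_int n * 2 * pi"
    unfolding cos_one_2pi_int by blast
  then have "real_of_int m * \<beta> = of_int n" by simp
  then have "m = 0"
  proof (rule contrapos_pp)
    assume "m \<noteq> 0"
    then have "real_of_int m * \<beta> = of_int n \<Longrightarrow> \<beta> = of_int n / of_int m" by (simp add: field_simps)
    then show "real_of_int m * \<beta> \<noteq> of_int n" using assms by auto
  qed
  then show "j = k" by (simp add: m_def int_decode_eq)
qed

text \<open>The characters, pulled back along \<open>\<theta>\<close>, are eigenfunctions. Their span is dense because every
  observable is a function of \<open>\<theta>\<close>.\<close>

lemma conjugate_rotation_predictive:
  assumes M: "prob_space M" and S: "S \<in> MPT M"
    and \<theta>: "\<theta> \<in> borel_measurable M" "distr M borel \<theta> = unif"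
    and conj: "AE x in M. \<theta> (S x) = frac (\<theta> x + \<beta>)" and irr: "\<beta> \<notin> \<rat>"
    and gen: "\<And>g::'a \<Rightarrow> complex. g \<in> borel_measurable M \<Longrightarrow>
       \<exists>g'\<in>borel_measurable borel. AE x in M. g x = g' (\<theta> x)"
  shows "predictive M S"
proof -
  have \<theta>u: "\<theta> \<in> M \<rightarrow>\<^sub>M unif" "distr M unif \<theta> = unif" using \<theta> by (auto cong: distr_cong)
  have "discrete_simple_spectrum M S (\<lambda>k x. character k (\<theta> x)) (\<lambda>k. character k \<beta>)"
  proof (rule discrete_simple_spectrum.intro)
    show "prob_space M" "S \<in> MPT M" by fact+
    show "(\<lambda>x. character k (\<theta> x)) \<in> borel_measurable M" for k
      by (rule measurable_compose[OF \<theta>(1) character_measurable])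
    show "cmod (character k (\<theta> x)) = 1" "cmod (character k \<beta>) = 1" for k x
      by (simp_all add: character_def)
    show "AE x in M. character k (\<theta> (S x)) = character k \<beta> * character k (\<theta> x)" for k
      using conj by eventually_elim (simp add: character_rotation)
    show "inj (\<lambda>k. character k \<beta>)" by (rule irrational_characters_distinct[OF irr])
    fix g :: "'a \<Rightarrow> complex" and \<delta> :: real assume g: "g \<in> L2_space M" and "\<delta> > 0"
    obtain g' where g': "g' \<in> borel_measurable borel" "AE x in M. g x = g' (\<theta> x)"
      using gen[OF L2_space_measurable[OF g]] by blast
    have g'\<theta>m: "(\<lambda>x. g' (\<theta> x)) \<in> borel_measurable M" by (rule measurable_compose[OF \<theta>(1) g'(1)])
    have "AE x in M. g' (\<theta> x) = g x" using g'(2) by eventually_elim simp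
    then have g'\<theta>: "(\<lambda>x. g' (\<theta> x)) \<in> L2_space M" using g'\<theta>m g by (rule L2_space_cong_AE)
    have g'u: "g' \<in> L2_space unif"
      using g'(1) by (intro L2_space_of_compose[OF \<theta>u _ g'\<theta>]) simp
    obtain p where p: "trig_poly p" "L2_norm unif (\<lambda>t. g' t - p t) < \<delta>"
      using trig_polys_dense[OF g'u] \<open>\<delta> > 0\<close> unfolding trig_approximable_def by blast
    obtain n a where pe: "p = (\<lambda>t. \<Sum>k<n. a k * character k t)"
      using trig_poly_characters[OF p(1)] by blast
    have diff: "(\<lambda>t. g' t - p t) \<in> borel_measurable unif"
      by (intro L2_space_measurable L2_space_diff g'u trig_poly_L2 p)
    have p\<theta>m: "(\<lambda>x. p (\<theta> x)) \<in> borel_measurable M"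
      by (rule measurable_compose[OF \<theta>(1) trig_poly_measurable[OF p(1)]])
    have "L2_norm M (\<lambda>x. g x - p (\<theta> x)) = L2_norm M (\<lambda>x. g' (\<theta> x) - p (\<theta> x))"
    proof (rule L2_norm_cong_AE)
      show "AE x in M. g x - p (\<theta> x) = g' (\<theta> x) - p (\<theta> x)" using g'(2) by eventually_elim simp
    qed (intro borel_measurable_diff p\<theta>m g'\<theta>m L2_space_measurable[OF g])+
    also have "\<dots> = L2_norm unif (\<lambda>t. g' t - p t)"
      by (rule L2_norm_compose[OF \<theta>u diff])
    finally have "L2_norm M (\<lambda>x. g x - (\<Sum>k<n. a k * character k (\<theta> x))) < \<delta>"
      using p(2) by (simp add: pe)
    then show "\<exists>n a. L2_norm M (\<lambda>x. g x - (\<Sum>k<n. a k * character k (\<theta> x))) < \<delta>" by blast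
  qed
  then show ?thesis by (rule discrete_simple_spectrum.predictive)
qed

lemma exists_irrational_between:
  assumes "a < (b::real)"
  shows "\<exists>\<beta>. a < \<beta> \<and> \<beta> < b \<and> \<beta> \<notin> \<rat>"
proof (rule ccontr)
  assume "\<not> ?thesis"
  then have "{a<..<b} \<subseteq> \<rat>" by auto
  then have "countable {a<..<b}" using countable_rat countable_subset by blast
  then show False using assms uncountable_open_interval by blast
qed

text \<open>For the average over the L pieces of the tower: only k pieces are moved across the end of the
  interval, and only they contribute a wrong value.\<close>

lemma cyclic_autocorrelation_close:
  fixes c :: "nat \<Rightarrow> complex"
  assumes L: "L > 0" and k: "k \<le> L" and main: "\<And>l. l + k < L \<Longrightarrow> c l = \<gamma>"
    and bound: "\<And>l. l < L \<Longrightarrow> cmod (c l) \<le> B" and \<gamma>: "cmod \<gamma> \<le> B"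
  shows "cmod ((\<Sum>l<L. c l / of_nat L) - \<gamma>) \<le> 2 * B * real k / real L"
proof -
  have "(\<Sum>l<L. c l / of_nat L) - \<gamma> = (\<Sum>l<L. (c l - \<gamma>) / of_nat L)"
    using L by (simp add: diff_divide_distrib sum_subtractf)
  also have "\<dots> = (\<Sum>l\<in>{L - k..<L}. (c l - \<gamma>) / of_nat L)"
    using main by (intro sum.mono_neutral_right) auto
  also have "cmod \<dots> \<le> (\<Sum>l\<in>{L - k..<L}. 2 * B / real L)"
  proof (rule sum_norm_le)
    fix l assume "l \<in> {L - k..<L}"
    then have "cmod (c l - \<gamma>) \<le> 2 * B"
      using bound[of l] \<gamma> norm_triangle_ineq4[of "c l" \<gamma>] by simp
    then show "cmod ((c l - \<gamma>) / of_nat L) \<le> 2 * B / real L"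
      by (simp add: norm_divide divide_right_mono)
  qed
  also have "\<dots> = 2 * B * real k / real L" using k by simp
  finally show ?thesis .
qed

text \<open>The error e is split into three parts: rounding the values of f, replacing the angle \<open>1 / L\<close> by
  an irrational one, and the pieces of the tower that are moved across the end.\<close>

theorem predictive_autocorrelations_dense:
  assumes std: "standard_nonatomic_prob_space M" and T: "T \<in> MPT M"
    and f: "f \<in> L2_space M" and e: "e > 0"
  shows "\<exists>S\<in>MPT M. predictive M S \<and>
    (\<forall>k\<le>d. cmod (autocorrelation M S f k - autocorrelation M T f k) \<le> e)"
proof -
  interpret M: prob_space M using std by (simp add: standard_nonatomic_prob_space_def)
  obtain \<pi> where \<pi>: "\<pi> \<in> borel_measurable M" "distr M borel \<pi> = unif"
    and rep: "\<And>h::'a \<Rightarrow> complex. h \<in> borel_measurable M \<Longrightarrow>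
       \<exists>h'\<in>borel_measurable borel. AE x in M. h x = h' (\<pi> x)"
    and lift: "\<And>\<Phi> \<Phi>'. \<Phi> \<in> borel_measurable borel \<Longrightarrow> \<Phi>' \<in> borel_measurable borel \<Longrightarrow>
       distr unif borel \<Phi> = unif \<Longrightarrow> distr unif borel \<Phi>' = unif \<Longrightarrow>
       AE y in unif. \<Phi>' (\<Phi> y) = y \<Longrightarrow> AE y in unif. \<Phi> (\<Phi>' y) = y \<Longrightarrow>
       \<exists>S\<in>MPT M. AE x in M. \<pi> (S x) = \<Phi> (\<pi> x)"
    by (rule standard_space_uniform_variable[OF std]) (rule that)
  have \<pi>u: "\<pi> \<in> M \<rightarrow>\<^sub>M unif" "distr M unif \<pi> = unif" using \<pi> by (auto cong: distr_cong)
  note AE_M = AE_measure_preserving[OF \<pi>]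
  define N where "N = L2_norm M f"
  have N0: "N \<ge> 0" by (simp add: N_def)
  \<comment> \<open>Rounding changes an autocorrelation by at most \<open>2 \<delta> (2 N + 2)\<close>, where N is the norm of f.\<close>
  define \<delta> where "\<delta> = min 1 (e / (12 * (N + 1)))"
  have \<delta>: "\<delta> > 0" "\<delta> \<le> 1" "12 * \<delta> * (N + 1) \<le> e"
  proof -
    show "\<delta> > 0" "\<delta> \<le> 1" using e N0 by (auto simp: \<delta>_def)
    have "12 * \<delta> * (N + 1) \<le> 12 * (e / (12 * (N + 1))) * (N + 1)"
      using N0 by (intro mult_right_mono mult_left_mono) (auto simp: \<delta>_def)
    also have "\<dots> = e" using N0 by (simp add: field_simps add_nonneg_eq_0_iff)
    finally show "12 * \<delta> * (N + 1) \<le> e" .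
  qed
  \<comment> \<open>The k pieces at the end contribute at most \<open>2 N\<^sup>2 k / L\<close>.\<close>
  obtain L0 :: nat where L0: "6 * N\<^sup>2 * real d / e < real L0" using reals_Archimedean2 by blast
  define L where "L = L0 + d + 1"
  have L: "L > 0" "d \<le> L" and Le: "2 * N\<^sup>2 * real d / real L \<le> e / 3"
  proof -
    show "L > 0" "d \<le> L" by (auto simp: L_def)
    have "6 * N\<^sup>2 * real d / e < real L" using L0 by (simp add: L_def)
    then show "2 * N\<^sup>2 * real d / real L \<le> e / 3" using e \<open>L > 0\<close> by (simp add: field_simps)
  qed
  obtain h where h: "\<And>l. h l \<in> borel_measurable borel" and hT: "\<And>l. AE x in M. f ((T ^^ l) x) = h l (\<pi> x)"
    using rep[OF L2_space_measurable[OF L2_funpow[OF T f]]] by metis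
  have h0: "AE x in M. f x = h 0 (\<pi> x)" using hT[of 0] by simp
  have hu: "h l \<in> borel_measurable unif" for l using h[of l] by simp
  have h\<pi>m: "(\<lambda>x. h l (\<pi> x)) \<in> borel_measurable M" for l by (rule measurable_compose[OF \<pi>(1) h])
  have h_inner: "L2_inner unif (h i) (h j) = L2_inner M (\<lambda>x. f ((T ^^ i) x)) (\<lambda>x. f ((T ^^ j) x))" for i j
  proof -
    have "L2_inner unif (h i) (h j) = L2_inner M (\<lambda>x. h i (\<pi> x)) (\<lambda>x. h j (\<pi> x))"
      by (rule L2_inner_compose[OF \<pi>u hu hu, symmetric])
    also have "\<dots> = L2_inner M (\<lambda>x. f ((T ^^ i) x)) (\<lambda>x. f ((T ^^ j) x))"
      by (rule L2_inner_cong_AE[OF hT hT, symmetric])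
        (intro h\<pi>m L2_space_measurable[OF L2_funpow[OF T f]])+
    finally show ?thesis .
  qed
  have h_distr: "measure unif {t. h l t \<in> B} = measure unif {t. h 0 t \<in> B}" if B: "B \<in> sets borel" for l B
  proof -
    have *: "measure unif {t. h l t \<in> B} = measure M {x\<in>space M. f x \<in> B}" for l
    proof -
      have s: "{t. h l t \<in> B} \<in> sets borel" using measurable_sets[OF h B] by (simp add: vimage_def)
      have fT: "{x\<in>space M. f ((T ^^ l) x) \<in> B} \<in> sets M" for l
        using measurable_sets[OF L2_space_measurable[OF L2_funpow[OF T f]] B]
        by (simp add: vimage_def Int_def conj_commute)
      have "measure unif {t. h l t \<in> B} = measure (distr M borel \<pi>) {t. h l t \<in> B}" by (simp only: \<pi>(2))
      also have "\<dots> = measure M (\<pi> -` {t. h l t \<in> B} \<inter> space M)" by (rule measure_distr[OF \<pi>(1) s])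
      also have "\<dots> = measure M {x\<in>space M. f ((T ^^ l) x) \<in> B}"
      proof (rule M.finite_measure_eq_AE)
        show "AE x in M. (x \<in> \<pi> -` {t. h l t \<in> B} \<inter> space M) = (x \<in> {x\<in>space M. f ((T ^^ l) x) \<in> B})"
          using hT[of l] by eventually_elim auto
      qed (use measurable_sets[OF \<pi>(1) s] fT in auto)
      also have "{x\<in>space M. f ((T ^^ l) x) \<in> B} = (T ^^ l) -` {x\<in>space M. f x \<in> B} \<inter> space M"
        using measurable_space[OF MPT_funpow(1)[OF T]] by auto
      also have "measure M \<dots> = measure (distr M M (T ^^ l)) {x\<in>space M. f x \<in> B}"
        using fT[of 0] by (intro measure_distr[symmetric] MPT_funpow[OF T]) simp
      also have "\<dots> = measure M {x\<in>space M. f x \<in> B}" by (simp only: MPT_funpow[OF T])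
      finally show ?thesis .
    qed
    show ?thesis by (simp only: *)
  qed
  \<comment> \<open>All \<open>h l\<close> have the distribution of f because T preserves the measure, hence so has H.\<close>
  define H where "H = tower L h"
  have Hm: "H \<in> borel_measurable borel" unfolding H_def by (rule tower_measurable[OF h])
  have H_distr: "measure unif {y. H y \<in> B} = measure unif {t. h 0 t \<in> B}" if B: "B \<in> sets borel" for B
  proof -
    have "measure unif {y. H y \<in> B} = (\<Sum>l<L. measure unif {t. h l t \<in> B} / real L)"
      unfolding H_def by (rule tower_distribution[OF L(1) h B])
    also have "\<dots> = (\<Sum>l<L. measure unif {t. h 0 t \<in> B} / real L)"
      by (intro sum.cong refl arg_cong2[where f="(/)"] h_distr[OF B])
    finally show ?thesis using L(1) by simp
  qed
  obtain code :: "complex \<Rightarrow> nat" where code: "code \<in> borel \<rightarrow>\<^sub>M count_space UNIV"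
    and code_eq: "\<forall>z w. code z = code w \<longrightarrow> cmod (z - w) \<le> 2 * \<delta>"
    using discretization[OF \<delta>(1)] by blast
  have code_set: "{z. code z < i} \<in> sets borel" for i
    using measurable_sets[OF code, of "{..<i}"] by (simp add: vimage_def)
  have code_h: "(\<lambda>x. code (h 0 x)) \<in> borel \<rightarrow>\<^sub>M count_space UNIV"
    by (rule measurable_compose[OF h code])
  have code_H: "(\<lambda>x. code (H x)) \<in> borel \<rightarrow>\<^sub>M count_space UNIV"
    by (rule measurable_compose[OF Hm code])
  have code_distr: "measure unif {x. code (h 0 x) < i} = measure unif {x. code (H x) < i}" for i
    using H_distr[OF code_set[of i]] unfolding mem_Collect_eq by (rule sym)
  obtain \<phi> \<phi>' where \<phi>: "\<phi> \<in> borel_measurable borel" "\<phi>' \<in> borel_measurable borel"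
    "distr unif borel \<phi> = unif" "distr unif borel \<phi>' = unif"
    "AE x in unif. \<phi>' (\<phi> x) = x" "AE x in unif. \<phi> (\<phi>' x) = x"
    and codes: "AE x in unif. code (H (\<phi> x)) = code (h 0 x)"
    by (rule equidistributed_iso[OF code_h code_H code_distr]) (rule that)
  define \<theta> where "\<theta> = (\<lambda>x. \<phi> (\<pi> x))"
  have \<theta>m: "\<theta> \<in> borel_measurable M" unfolding \<theta>_def by (rule measurable_compose[OF \<pi>(1) \<phi>(1)])
  have \<theta>d: "distr M borel \<theta> = unif"
  proof -
    have "distr M borel \<theta> = distr (distr M borel \<pi>) borel \<phi>"
      using distr_distr[OF \<phi>(1) \<pi>(1)] by (simp add: \<theta>_def o_def)
    then show ?thesis by (simp only: \<pi>(2) \<phi>(3))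
  qed
  have \<theta>u: "\<theta> \<in> M \<rightarrow>\<^sub>M unif" "distr M unif \<theta> = unif" using \<theta>m \<theta>d by (auto cong: distr_cong)
  define F where "F = (\<lambda>x. H (\<theta> x))"
  have Fm: "F \<in> borel_measurable M" unfolding F_def by (rule measurable_compose[OF \<theta>m Hm])
  have near: "AE x in M. cmod (f x - F x) \<le> 2 * \<delta>"
    using AE_M[OF codes] h0 by eventually_elim (simp add: F_def \<theta>_def code_eq)
  have fFm: "(\<lambda>x. f x - F x) \<in> borel_measurable M"
    by (intro borel_measurable_diff L2_space_measurable[OF f] Fm)
  have fF: "(\<lambda>x. f x - F x) \<in> L2_space M"
  proof -
    have "integrable M (\<lambda>x. (cmod (f x - F x))\<^sup>2)"
    proof (rule M.integrable_const_bound)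
      show "AE x in M. norm ((cmod (f x - F x))\<^sup>2) \<le> (2 * \<delta>)\<^sup>2"
        using near
      proof eventually_elim
        case (elim x)
        then have "(cmod (f x - F x))\<^sup>2 \<le> (2 * \<delta>)\<^sup>2" by (intro power_mono) auto
        then show ?case by simp
      qed
    qed (use fFm in measurable)
    then show ?thesis using fFm by (simp add: L2_space_def)
  qed
  have fF_norm: "L2_norm M (\<lambda>x. f x - F x) \<le> 2 * \<delta>"
    using \<delta>(1) by (intro L2_norm_bounded[OF M.prob_space_axioms fFm near]) simp
  have FL2: "F \<in> L2_space M" using L2_space_diff[OF f fF] by simp
  have F_norm: "L2_norm M F \<le> N + 2"
  proof -
    have "L2_norm M F \<le> L2_norm M f + L2_norm M (\<lambda>x. F x - f x)"
      by (rule L2_norm_le_add_dist[OF FL2 f])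
    then show ?thesis using fF_norm \<delta>(2) by (simp add: N_def L2_norm_commute[of M F f])
  qed
  have HL2: "H \<in> L2_space unif"
    using Hm FL2 by (intro L2_space_of_compose[OF \<theta>u]) (auto simp: F_def)
  have H_norm: "L2_norm unif H = L2_norm M F"
    unfolding F_def by (rule L2_norm_compose[OF \<theta>u L2_space_measurable[OF HL2], symmetric])
  \<comment> \<open>The angle must be so close to \<open>1 / L\<close> that its multiples up to the d-fold one stay close to the
    multiples of \<open>1 / L\<close>; \<open>N + 2\<close> bounds the norm of H.\<close>
  define e' where "e' = e / (3 * (N + 2))"
  have e': "e' > 0" using e N0 by (simp add: e'_def)
  have "\<exists>\<eta>>0. \<forall>s. \<bar>s - real k / real L\<bar> < \<eta> \<longrightarrow>
      L2_norm unif (\<lambda>y. H (frac (y + s)) - H (frac (y + real k / real L))) < e'" for k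
    by (rule rotation_continuous[OF HL2 e'])
  then obtain \<eta> where \<eta>: "\<And>k. \<eta> k > 0" "\<And>k s. \<bar>s - real k / real L\<bar> < \<eta> k \<Longrightarrow>
      L2_norm unif (\<lambda>y. H (frac (y + s)) - H (frac (y + real k / real L))) < e'"
    by metis
  define \<eta>0 where "\<eta>0 = Min (\<eta> ` {..d}) / (real d + 1)"
  have "Min (\<eta> ` {..d}) > 0" using \<eta>(1) by (subst Min_gr_iff) auto
  then have "\<eta>0 > 0" by (simp add: \<eta>0_def)
  then obtain \<beta> where \<beta>: "1 / real L < \<beta>" "\<beta> < 1 / real L + \<eta>0" "\<beta> \<notin> \<rat>"
    using exists_irrational_between[of "1 / real L" "1 / real L + \<eta>0"] by auto
  have angle: "\<bar>real k * \<beta> - real k / real L\<bar> < \<eta> k" if "k \<le> d" for k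
  proof -
    have "real k * \<beta> - real k / real L = real k * (\<beta> - 1 / real L)" by (simp add: right_diff_distrib)
    moreover have "real k * (\<beta> - 1 / real L) \<ge> 0" using \<beta>(1) by (intro mult_nonneg_nonneg) auto
    ultimately have "\<bar>real k * \<beta> - real k / real L\<bar> = real k * (\<beta> - 1 / real L)" by simp
    also have "\<dots> \<le> real d * (\<beta> - 1 / real L)" using \<beta>(1) that by (intro mult_right_mono) auto
    also have "\<dots> < (real d + 1) * \<eta>0"
      using \<beta>(1,2) by (intro mult_strict_mono) auto
    also have "\<dots> = Min (\<eta> ` {..d})" by (simp add: \<eta>0_def)
    also have "\<dots> \<le> \<eta> k" using that by (intro Min_le) auto
    finally show ?thesis .
  qed
  define R where "R = (\<lambda>b y::real. frac (y + b))"
  have Rm: "R b \<in> borel_measurable borel" for b unfolding R_def by measurable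
  have Rd: "distr unif borel (R b) = unif" for b unfolding R_def by (rule distr_unif_rotation)
  have Rinv: "AE y in unif. R (- b) (R b y) = y" for b
    using AE_unif_bounds
  proof eventually_elim
    case (elim y)
    have "R (- b) (R b y) = frac (y + of_int (- \<lfloor>y + b\<rfloor>))" by (simp add: R_def frac_def)
    also have "\<dots> = y" using elim by (simp add: frac_def floor_unique)
    finally show ?case .
  qed
  define \<Phi> where "\<Phi> = (\<lambda>b y. \<phi>' (R b (\<phi> y)))"
  have \<Phi>m: "\<Phi> b \<in> borel_measurable borel" for b
    unfolding \<Phi>_def by (rule measurable_compose[OF measurable_compose[OF \<phi>(1) Rm] \<phi>(2)])
  have \<Phi>d: "distr unif borel (\<Phi> b) = unif" for b
  proof -
    have "distr unif borel (\<Phi> b) = distr (distr (distr unif borel \<phi>) borel (R b)) borel \<phi>'"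
      using Rm[of b] \<phi>(1,2) by (simp add: \<Phi>_def distr_distr o_def)
    then show ?thesis by (simp only: \<phi>(3,4) Rd)
  qed
  have \<phi>R: "AE y in unif. \<phi> (\<phi>' (R b (\<phi> y))) = R b (\<phi> y)" for b
    using AE_unif_compose[OF AE_unif_compose[OF \<phi>(6) Rm Rd] \<phi>(1,3)] .
  have \<Phi>inv: "AE y in unif. \<Phi> (- b) (\<Phi> b y) = y" for b
    using \<phi>R[of b] AE_unif_compose[OF Rinv[of b] \<phi>(1,3)] \<phi>(5)
    by eventually_elim (simp add: \<Phi>_def)
  obtain S where S: "S \<in> MPT M" and \<pi>S: "AE x in M. \<pi> (S x) = \<Phi> \<beta> (\<pi> x)"
    using lift[OF \<Phi>m \<Phi>m \<Phi>d \<Phi>d \<Phi>inv[of \<beta>]] \<Phi>inv[of "- \<beta>"] by auto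
  have \<theta>S: "AE x in M. \<theta> (S x) = frac (\<theta> x + \<beta>)"
    using \<pi>S AE_M[OF \<phi>R[of \<beta>]] by eventually_elim (simp add: \<theta>_def \<Phi>_def R_def)
  have pred: "predictive M S"
  proof (rule conjugate_rotation_predictive[OF M.prob_space_axioms S \<theta>m \<theta>d \<theta>S \<beta>(3)])
    fix g :: "'a \<Rightarrow> complex" assume "g \<in> borel_measurable M"
    then obtain g' where g': "g' \<in> borel_measurable borel" "AE x in M. g x = g' (\<pi> x)" using rep by blast
    have "AE x in M. g x = g' (\<phi>' (\<theta> x))"
      using g'(2) AE_M[OF \<phi>(5)] by eventually_elim (simp add: \<theta>_def)
    moreover have "(\<lambda>y. g' (\<phi>' y)) \<in> borel_measurable borel" by (rule measurable_compose[OF \<phi>(2) g'(1)])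
    ultimately show "\<exists>g'\<in>borel_measurable borel. AE x in M. g x = g' (\<theta> x)"
      by (intro bexI[where x="\<lambda>y. g' (\<phi>' y)"])
  qed
  have \<theta>Sk: "AE x in M. \<theta> ((S ^^ k) x) = frac (\<theta> x + real k * \<beta>)" for k
  proof (induction k)
    case 0
    have "AE x in M. 0 < \<theta> x \<and> \<theta> x < 1"
      by (rule AE_measure_preserving[OF \<theta>m \<theta>d AE_unif_bounds])
    then show ?case by eventually_elim (simp add: frac_eq)
  next
    case (Suc k)
    show ?case using Suc MPT_AE_funpow[OF S \<theta>S, of k]
    proof eventually_elim
      case (elim x)
      have "frac (frac (\<theta> x + real k * \<beta>) + \<beta>) = frac (\<theta> x + real (Suc k) * \<beta> + of_int (- \<lfloor>\<theta> x + real k * \<beta>\<rfloor>))"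
        by (intro arg_cong[where f=frac]) (simp add: frac_def algebra_simps)
      also have "\<dots> = frac (\<theta> x + real (Suc k) * \<beta>)" by (simp only: frac_def floor_add_int) simp
      finally show ?case using elim by simp
    qed
  qed
  have close: "cmod (autocorrelation M S f k - autocorrelation M T f k) \<le> e" if k: "k \<le> d" for k
  proof -
    have kL: "k \<le> L" using k L(2) by simp
    let ?A = "L2_inner unif (\<lambda>y. H (frac (y + real k * \<beta>))) H"
    let ?B = "L2_inner unif (\<lambda>y. H (frac (y + real k / real L))) H"
    have FSL2: "(\<lambda>x. F ((S ^^ k) x)) \<in> L2_space M" by (rule L2_funpow[OF S FL2])
    have "cmod (autocorrelation M S f k - L2_inner M (\<lambda>x. F ((S ^^ k) x)) F)
        \<le> L2_norm M (\<lambda>x. f ((S ^^ k) x) - F ((S ^^ k) x)) * L2_norm M f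
          + L2_norm M (\<lambda>x. F ((S ^^ k) x)) * L2_norm M (\<lambda>x. f x - F x)"
      unfolding autocorrelation_def by (rule L2_inner_close[OF L2_funpow[OF S f] FSL2 f FL2])
    also have "L2_norm M (\<lambda>x. f ((S ^^ k) x) - F ((S ^^ k) x)) = L2_norm M (\<lambda>x. f x - F x)"
      using L2_norm_compose[OF MPT_funpow[OF S] fFm, of k] .
    also have "L2_norm M (\<lambda>x. F ((S ^^ k) x)) = L2_norm M F"
      using L2_norm_compose[OF MPT_funpow[OF S] Fm, of k] .
    also have "L2_norm M (\<lambda>x. f x - F x) * L2_norm M f + L2_norm M F * L2_norm M (\<lambda>x. f x - F x)
        \<le> 2 * \<delta> * N + (N + 2) * (2 * \<delta>)"
      using fF_norm F_norm N0 \<delta>(1) unfolding N_def by (intro add_mono mult_mono) auto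
    also have "\<dots> = (12 * \<delta> * (N + 1)) / 3" by (simp add: algebra_simps)
    also have "\<dots> \<le> e / 3" using \<delta>(3) by simp
    finally have 1: "cmod (autocorrelation M S f k - L2_inner M (\<lambda>x. F ((S ^^ k) x)) F) \<le> e / 3" .
    have HR: "(\<lambda>y. H (frac (y + s))) \<in> L2_space unif" for s by (rule rotation_L2(1)[OF HL2])
    have FA: "L2_inner M (\<lambda>x. F ((S ^^ k) x)) F = ?A"
    proof -
      have "L2_inner M (\<lambda>x. F ((S ^^ k) x)) F
          = L2_inner M (\<lambda>x. H (frac (\<theta> x + real k * \<beta>))) (\<lambda>x. H (\<theta> x))"
      proof (rule L2_inner_cong_AE)
        show "AE x in M. F ((S ^^ k) x) = H (frac (\<theta> x + real k * \<beta>))"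
          using \<theta>Sk[of k] by eventually_elim (simp add: F_def)
        show "(\<lambda>x. H (frac (\<theta> x + real k * \<beta>))) \<in> borel_measurable M"
          by (rule measurable_compose[OF \<theta>u(1) L2_space_measurable[OF HR]])
      qed (use Fm L2_space_measurable[OF FSL2] in \<open>simp_all add: F_def\<close>)
      also have "\<dots> = ?A"
        by (rule L2_inner_compose[OF \<theta>u L2_space_measurable[OF HR] L2_space_measurable[OF HL2]])
      finally show ?thesis .
    qed
    have "cmod (?A - ?B) \<le> L2_norm unif (\<lambda>y. H (frac (y + real k * \<beta>)) - H (frac (y + real k / real L))) * L2_norm unif H
        + L2_norm unif (\<lambda>y. H (frac (y + real k / real L))) * L2_norm unif (\<lambda>y. H y - H y)"
      by (rule L2_inner_close[OF HR HR HL2 HL2])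
    also have "\<dots> = L2_norm unif (\<lambda>y. H (frac (y + real k * \<beta>)) - H (frac (y + real k / real L))) * L2_norm M F"
      by (simp add: H_norm)
    also have "\<dots> \<le> e' * (N + 2)"
      using \<eta>(2)[OF angle[OF k]] F_norm e' by (intro mult_mono) auto
    also have "\<dots> = e / 3"
    proof -
      have "N + 2 \<noteq> 0" using N0 by simp
      then show ?thesis by (simp add: e'_def field_simps)
    qed
    finally have 2: "cmod (?A - ?B) \<le> e / 3" .
    have "?B = (\<Sum>l<L. L2_inner unif (h ((l + k) mod L)) (h l) / of_nat L)"
      unfolding H_def by (rule tower_rotation_inner[OF L(1) h HL2[unfolded H_def]])
    also have "cmod (\<dots> - autocorrelation M T f k) \<le> 2 * N\<^sup>2 * real k / real L"
    proof (rule cyclic_autocorrelation_close[OF L(1) kL])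
      have T_norm: "L2_norm M (\<lambda>x. f ((T ^^ i) x)) = N" for i
        unfolding N_def by (rule L2_norm_compose[OF MPT_funpow[OF T] L2_space_measurable[OF f]])
      show "cmod (L2_inner unif (h ((l + k) mod L)) (h l)) \<le> N\<^sup>2" for l
        unfolding h_inner using L2_Cauchy_Schwarz[OF L2_funpow[OF T f] L2_funpow[OF T f]]
        by (simp add: T_norm power2_eq_square)
      show "cmod (autocorrelation M T f k) \<le> N\<^sup>2"
        unfolding autocorrelation_def using L2_Cauchy_Schwarz[OF L2_funpow[OF T f, of k] f]
        by (simp add: T_norm power2_eq_square N_def[symmetric])
      fix l assume "l + k < L"
      then have "L2_inner unif (h ((l + k) mod L)) (h l)
          = L2_inner M (\<lambda>x. f ((T ^^ k) ((T ^^ l) x))) (\<lambda>x. f ((T ^^ l) x))"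
        by (simp add: h_inner funpow_add add.commute[of l k])
      also have "\<dots> = autocorrelation M T f k"
        unfolding autocorrelation_def
        by (rule L2_inner_compose[OF MPT_funpow[OF T] L2_space_measurable[OF L2_funpow[OF T f]] L2_space_measurable[OF f]])
      finally show "L2_inner unif (h ((l + k) mod L)) (h l) = autocorrelation M T f k" .
    qed
    also have "2 * N\<^sup>2 * real k / real L \<le> 2 * N\<^sup>2 * real d / real L"
      using k by (intro divide_right_mono mult_left_mono) auto
    also have "\<dots> \<le> e / 3" by (rule Le)
    finally have 3: "cmod (?B - autocorrelation M T f k) \<le> e / 3" .
    have "autocorrelation M S f k - autocorrelation M T f k
        = (autocorrelation M S f k - ?A) + (?A - ?B) + (?B - autocorrelation M T f k)" by simp
    also have "cmod \<dots> \<le> e / 3 + e / 3 + e / 3"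
      by (intro norm_triangle_le add_mono 1[unfolded FA] 2 3)
    also have "\<dots> = e" by simp
    finally show ?thesis .
  qed
  show ?thesis using S pred close by blast
qed

theorem proposition38:
  fixes M :: "'a measure" and T :: "'a \<Rightarrow> 'a" and f :: "'a \<Rightarrow> complex"
    and d :: nat and \<epsilon> :: real
  assumes "standard_nonatomic_prob_space M"
    and "T \<in> MPT M"
    and "d \<ge> 1"
    and "f \<in> L2_space M"
    and "lin_indep_mod_null M d (delay M T f)"
    and "\<epsilon> > 0"
  shows "\<exists>S \<in> MPT M. predictive M S \<and>
           (\<exists>!c. is_delay_filter M f d S c) \<and>
           L2_set (\<lambda>j. cmod (filter_of M f d S j - filter_of M f d T j)) {..<d} < \<epsilon>"
  proof -
  obtain \<delta> where \<delta>: "\<delta> > 0" and cont: "\<forall>S\<in>MPT M.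
      (\<forall>k\<le>d. cmod (autocorrelation M S f k - autocorrelation M T f k) \<le> \<delta>) \<longrightarrow>
      (\<exists>!c. is_delay_filter M f d S c) \<and>
      L2_set (\<lambda>j. cmod (filter_of M f d S j - filter_of M f d T j)) {..<d} < \<epsilon>"
    using filter_continuous[OF assms(2,4,5,6)] by blast
  obtain S where "S \<in> MPT M" "predictive M S"
    "\<forall>k\<le>d. cmod (autocorrelation M S f k - autocorrelation M T f k) \<le> \<delta>"
    using predictive_autocorrelations_dense[OF assms(1,2,4) \<delta>, of d] by blast
  then show ?thesis using cont by blast
qed

end
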